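(* Let $f\colon \mathbb{S}^2\to \mathbb{S}^2$ be an orientation-preserving homeomorphism with no wandering points. Let $B\subset \mathbb{S}^2$ be a closed topological disk such that there exist three pairwise disjoint open topological disks $U_1,U_2,U_3\subset \mathbb{S}^2$ with $f(U_i)=U_i$ and $B\cap U_i\neq\emptyset$ for $i=1,2,3$. Then $f(B)\cap B\neq \emptyset$.
   Context: An open topological disk is an open subset homeomorphic to $\mathbb{R}^2$. A closed topological disk is a subset homeomorphic to the closed unit disk of $\mathbb{R}^2$. A point $x$ is wandering for $f$ if it has an open neighborhood $V$ such that $f^n(V)\cap V=\emptyset$ for all $n\geq 1$. *)

theory Defs
  imports "HOL-Analysis.Analysis" "HOL-Homology.Homology"
begin

definition open_topological_disk :: "'a topology \<Rightarrow> 'a set \<Rightarrow> bool" where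
  "open_topological_disk X U \<longleftrightarrow>
     openin X U \<and> subtopology X U homeomorphic_space (euclidean :: (real^2) topology)"

definition closed_topological_disk :: "'a topology \<Rightarrow> 'a set \<Rightarrow> bool" where
  "closed_topological_disk X B \<longleftrightarrow>
     B \<subseteq> topspace X \<and> subtopology X B homeomorphic_space top_of_set (cball (0 :: real^2) 1)"

definition wandering_point :: "'a topology \<Rightarrow> ('a \<Rightarrow> 'a) \<Rightarrow> 'a \<Rightarrow> bool" where
  "wandering_point X f x \<longleftrightarrow>
     (\<exists>V. openin X V \<and> x \<in> V \<and> (\<forall>n\<ge>1. (f ^^ n) ` V \<inter> V = {}))"

text \<open>A homeomorphism of the sphere has Brouwer degree 1 or -1, according to whether it
  preserves or reverses the orientation class in the top homology group.\<close>

definition orientation_preserving_homeomorphism ::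
    "nat \<Rightarrow> ((nat \<Rightarrow> real) \<Rightarrow> nat \<Rightarrow> real) \<Rightarrow> bool" where
  "orientation_preserving_homeomorphism p f \<longleftrightarrow>
     homeomorphic_map (nsphere p) (nsphere p) f \<and> Brouwer_degree2 p f = 1"

end

theory Submission
  imports Defs "HOL-Complex_Analysis.Complex_Analysis"
begin

text \<open>
  Suppose that \<open>f\<close> moves the closed disk \<open>B\<close> off itself. A simple closed curve \<open>J\<close> in \<open>B\<close> that passes
  through the three invariant disks is then disjoint from \<open>f(J)\<close>, and the contradiction comes from
  the way in which \<open>J\<close> crosses the disks.

  Crossing numbers. Let \<open>P\<close> be an arc of \<open>J\<close> that starts in one of the disks, crosses a second one,
  \<open>U\<close>, and ends in the third. Suppose that the first and the third disk contain arcs that join the two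
  ends of \<open>P\<close> to the corresponding ends of \<open>f(P)\<close> and that meet \<open>J\<close> and \<open>f(J)\<close> nowhere else. Together
  with \<open>P\<close> and \<open>f(P)\<close> they form a simple closed curve \<open>\<Gamma>\<close>, whose winding number takes only two values,
  \<open>0\<close> and one of \<open>1\<close> and \<open>-1\<close>. As \<open>U\<close> is simply connected, the winding number of \<open>P\<close> differs on \<open>U\<close> by
  a continuous function from an integer-valued height \<open>k\<close>, which changes by one when a point crosses
  \<open>P\<close>. As \<open>f\<close> preserves the orientation, the same holds for \<open>f(P)\<close> and the height \<open>k \<circ> f\<^sup>-\<^sup>1\<close>. Hence
  the winding number of \<open>\<Gamma>\<close> is \<open>k - k \<circ> f\<^sup>-\<^sup>1 + c\<close> on \<open>U\<close> with an integer constant \<open>c\<close>. No integer lies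
  strictly between the two values, so \<open>k\<close> changes in one direction only along every orbit in \<open>U\<close>, and
  it does change whenever the orbit arrives on a certain side of \<open>\<Gamma>\<close>. Points of \<open>U\<close> on this side
  cannot be recurrent. This is \<open>connecting_arcs_impossible\<close>.

  Crosscuts. The connecting arcs are found as follows. A disk \<open>U\<close> is a plane, and the components of
  \<open>J \<inter> U\<close> are disjoint closed lines in it, disjoint also from their images. As nothing wanders, every
  such crosscut has exactly one side that is disjoint from its own image, its inner side. Inner sides are
  nested or disjoint, and each lies in a maximal one. If the image of each maximal inner side were contained
  in another one, then some cycle of them would be mapped strictly into itself. It follows that there
  is a maximal crosscut \<open>M\<close> whose image lies in no maximal inner side and which lies in the image of
  none. Now Janiszewski's theorem yields an arc from \<open>M\<close> to \<open>f(M)\<close> that avoids all other crosscuts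
  and their images: \<open>crosscut_family.exists_connecting_arc\<close>. It joins points \<open>x\<close> and \<open>f(y)\<close> with \<open>x\<close>
  and \<open>y\<close> on the same crosscut. The piece of \<open>J\<close> between \<open>x\<close> and \<open>y\<close> stays in the disk, so \<open>x \<noteq> y\<close>
  does no harm to the crossing numbers in the other disks.

  Orientation. A map of degree one has a fixed point, and the stereographic projection from it turns
  \<open>f\<close> into a homeomorphism \<open>F\<close> of the plane. Degree one then means that all difference quotients
  \<open>(F z - F w) / (z - w)\<close> have continuous logarithms in \<open>z\<close>: otherwise \<open>F\<close> would be homotopic to a
  reflection (\<open>degree_one_orientation_log\<close>). The fixed point may lie in one of the disks; the arc \<open>P\<close>
  is therefore chosen such that the disk which it crosses is another one.
\<close>

section \<open>Unions of nonseparating sets in the plane\<close>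

definition inversion :: "complex \<Rightarrow> complex \<Rightarrow> complex" where
  "inversion e z = inverse (z - e)"

text \<open>The image of \<open>A \<union> {\<infinity>}\<close> under the inversion that exchanges \<open>e\<close> and \<open>\<infinity>\<close>. Inversions bring
  closed sets and their behaviour at infinity within reach of theorems about compact plane sets.\<close>

definition point_inversion :: "complex \<Rightarrow> complex set \<Rightarrow> complex set" where
  "point_inversion e A = insert 0 (inversion e ` A)"

lemma inversion_continuous: "continuous_on (-{e}) (inversion e)"
  unfolding inversion_def by (intro continuous_intros) auto

lemma inversion_back_continuous:
  fixes e :: complex
  shows "continuous_on (-{0}) (\<lambda>w. e + inverse w)"
  by (intro continuous_intros) auto

lemma inversion_back: "z \<noteq> e \<Longrightarrow> e + inverse (inversion e z) = z"
  by (simp add: inversion_def)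

lemma inversion_inversion_back: "inversion e (e + inverse w) = w"
  by (simp add: inversion_def)

lemma inversion_eq_0: "inversion e z = 0 \<longleftrightarrow> z = e"
  by (simp add: inversion_def)

lemma inversion_inj: "inversion e z = inversion e w \<longleftrightarrow> z = w"
  by (simp add: inversion_def)

lemma point_inversion_alt:
  assumes "e \<notin> A"
  shows "point_inversion e A = - {w \<in> -{0}. e + inverse w \<in> - A}"
proof -
  have "w \<in> inversion e ` A" if "w \<noteq> 0" "e + inverse w \<in> A" for w
    using that imageI[of "e + inverse w" A "inversion e"] by (simp add: inversion_inversion_back)
  moreover have "e + inverse (inversion e z) \<in> A" if "z \<in> A" for z
    using that assms inversion_back[of z e] by metis
  moreover have "inversion e z \<noteq> 0" if "z \<in> A" for z
    using that assms by (auto simp: inversion_eq_0)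
  ultimately show ?thesis
    unfolding point_inversion_def by auto
qed

lemma compact_point_inversion:
  assumes "closed A" "e \<notin> A"
  shows "compact (point_inversion e A)"
proof -
  have "open ((-{0}) \<inter> (\<lambda>w. e + inverse w) -` (- A))"
    using assms by (intro continuous_open_preimage inversion_back_continuous) auto
  also have "(-{0}) \<inter> (\<lambda>w. e + inverse w) -` (- A) = {w \<in> -{0}. e + inverse w \<in> - A}"
    by auto
  finally have "open {w \<in> -{0}. e + inverse w \<in> - A}" .
  then have cl: "closed (point_inversion e A)"
    by (simp add: point_inversion_alt assms open_closed)
  obtain d where d: "d > 0" "\<And>z. z \<in> A \<Longrightarrow> d \<le> dist e z"
    using separate_point_closed[OF assms] by blast
  have "norm w \<le> inverse d" if w: "w \<in> point_inversion e A" for w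
  proof -
    consider "w = 0" | z where "z \<in> A" "w = inversion e z"
      using w unfolding point_inversion_def by blast
    then show ?thesis
    proof cases
      case 1 then show ?thesis using d by simp
    next
      case 2
      then have "norm w = inverse (dist e z)"
        by (simp add: inversion_def norm_inverse dist_norm norm_minus_commute)
      with d 2 show ?thesis by (simp add: le_imp_inverse_le)
    qed
  qed
  then have "bounded (point_inversion e A)"
    by (auto simp: bounded_iff)
  with cl show ?thesis by (simp add: compact_eq_bounded_closed)
qed

text \<open>An unbounded set accumulates at infinity, so adding that point keeps it connected.\<close>

lemma connected_point_inversion:
  assumes "connected A" "\<not> bounded A" "e \<notin> A"
  shows "connected (point_inversion e A)"
proof -
  have con: "connected (inversion e ` A)"
    using assms by (intro connected_continuous_image continuous_on_subset[OF inversion_continuous]) auto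
  have "0 \<in> closure (inversion e ` A)"
    unfolding closure_approachable
  proof (intro allI impI)
    fix r::real assume "r > 0"
    obtain z where z: "z \<in> A" "norm z > norm e + inverse r"
      using assms(2) by (auto simp: bounded_iff not_le)
    then have "norm (z - e) > inverse r"
      using norm_triangle_ineq2[of z e] by simp
    then have "inverse (norm (z - e)) < inverse (inverse r)"
      using \<open>r > 0\<close> by (intro less_imp_inverse_less) auto
    then have "norm (inversion e z) < r"
      by (simp add: inversion_def norm_inverse)
    then show "\<exists>y\<in>inversion e ` A. dist y 0 < r"
      using z by auto
  qed
  then have "point_inversion e A \<subseteq> closure (inversion e ` A)"
    unfolding point_inversion_def using closure_subset[of "inversion e ` A"] by auto
  then show ?thesis
    by (rule connected_intermediate_closure[OF con, rotated]) (auto simp: point_inversion_def)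
qed

lemma connected_component_point_inversion:
  assumes "connected_component (- A - {e}) x y"
  shows "connected_component (- point_inversion e A) (inversion e x) (inversion e y)"
proof -
  obtain T where T: "connected T" "T \<subseteq> - A - {e}" "x \<in> T" "y \<in> T"
    using assms by (auto simp: connected_component_def)
  have "connected (inversion e ` T)"
    using T by (intro connected_continuous_image continuous_on_subset[OF inversion_continuous]) auto
  moreover have "inversion e ` T \<subseteq> - point_inversion e A"
    using T by (auto simp: point_inversion_def inversion_eq_0 inversion_inj)
  ultimately show ?thesis
    using T by (auto simp: connected_component_def)
qed

lemma connected_component_inversion_back:
  assumes "connected_component (- point_inversion e A) (inversion e x) (inversion e y)"
    and "x \<noteq> e" "y \<noteq> e" "e \<notin> A"
  shows "connected_component (- A) x y"
proof -
  obtain T where T: "connected T" "T \<subseteq> - point_inversion e A" "inversion e x \<in> T" "inversion e y \<in> T"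
    using assms by (auto simp: connected_component_def)
  have "connected ((\<lambda>w. e + inverse w) ` T)"
    using T by (intro connected_continuous_image continuous_on_subset[OF inversion_back_continuous])
      (auto simp: point_inversion_def)
  moreover have "(\<lambda>w. e + inverse w) ` T \<subseteq> - A"
    using T assms(4) by (auto simp: point_inversion_alt)
  moreover have "x \<in> (\<lambda>w. e + inverse w) ` T" "y \<in> (\<lambda>w. e + inverse w) ` T"
    using imageI[OF T(3), of "\<lambda>w. e + inverse w"] imageI[OF T(4), of "\<lambda>w. e + inverse w"]
      inversion_back[OF assms(2)] inversion_back[OF assms(3)] by simp_all
  ultimately show ?thesis
    by (auto simp: connected_component_def)
qed

lemma closed_Union_locally_finite:
  fixes \<Y> :: "'a::heine_borel set set"
  assumes "\<And>Y. Y \<in> \<Y> \<Longrightarrow> closed Y"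
    and "\<And>K. compact K \<Longrightarrow> finite {Y \<in> \<Y>. Y \<inter> K \<noteq> {}}"
  shows "closed (\<Union>\<Y>)"
proof -
  have "open (- \<Union>\<Y>)"
    unfolding open_contains_ball
  proof
    fix x assume x: "x \<in> - \<Union>\<Y>"
    define \<F> where "\<F> = {Y \<in> \<Y>. Y \<inter> cball x 1 \<noteq> {}}"
    have "finite \<F>" unfolding \<F>_def by (rule assms) simp
    then have "closed (\<Union>\<F>)" by (intro closed_Union) (auto simp: \<F>_def assms)
    moreover have "x \<in> - \<Union>\<F>" using x by (auto simp: \<F>_def)
    ultimately obtain r where r: "r > 0" "ball x r \<subseteq> - \<Union>\<F>"
      by (meson open_Compl open_contains_ball)
    have "ball x (min r 1) \<subseteq> - \<Union>\<Y>"
    proof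
      fix y assume y: "y \<in> ball x (min r 1)"
      then have "y \<in> ball x r" "y \<in> cball x 1" by auto
      then have "y \<notin> \<Union>\<F>" "y \<in> cball x 1" using r by auto
      then show "y \<in> - \<Union>\<Y>" unfolding \<F>_def by blast
    qed
    with r show "\<exists>e>0. ball x e \<subseteq> - \<Union>\<Y>" by (intro exI[of _ "min r 1"]) auto
  qed
  then show ?thesis by (simp add: closed_def)
qed

text \<open>Janiszewski's theorem wants the intersection of the two sets to be connected. After an inversion all
  members of the family share the point \<open>0\<close>, and by the nesting assumption the intersection of one
  member with a union of others is a union of members. A path from \<open>x\<close> to \<open>y\<close> misses all but finitely
  many members, so Janiszewski's theorem is needed only finitely often.\<close>

theorem nonseparating_locally_finite_Union:
  fixes x y :: complex
  assumes clo: "\<And>Y. Y \<in> \<Y> \<Longrightarrow> closed Y"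
    and con: "\<And>Y. Y \<in> \<Y> \<Longrightarrow> connected Y" "\<And>Y. Y \<in> \<Y> \<Longrightarrow> \<not> bounded Y"
    and nonsep: "\<And>Y. Y \<in> \<Y> \<Longrightarrow> connected (- Y)"
    and nest: "\<And>Y Z. Y \<in> \<Y> \<Longrightarrow> Z \<in> \<Y> \<Longrightarrow> Y \<inter> Z = {} \<or> Y \<subseteq> Z \<or> Z \<subseteq> Y"
    and locfin: "\<And>K. compact K \<Longrightarrow> finite {Y \<in> \<Y>. Y \<inter> K \<noteq> {}}"
    and xy: "x \<notin> \<Union>\<Y>" "y \<notin> \<Union>\<Y>"
  shows "connected_component (- \<Union>\<Y>) x y"
proof -
  have cloU: "closed (\<Union>\<Y>')" if "\<Y>' \<subseteq> \<Y>" for \<Y>'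
  proof (rule closed_Union_locally_finite)
    fix K :: "complex set" assume "compact K"
    then show "finite {Y \<in> \<Y>'. Y \<inter> K \<noteq> {}}"
      by (rule finite_subset[rotated, OF locfin]) (use that in auto)
  qed (use clo that in auto)
  obtain r where r: "r > 0" "ball x r \<subseteq> - \<Union>\<Y>"
    using cloU[of \<Y>] xy(1) by (metis ComplI open_Compl open_contains_ball subset_refl)
  obtain e where e: "e \<in> ball x r" "e \<noteq> x" "e \<noteq> y"
  proof (cases "x + of_real (r/2) = y")
    case True
    have "x - of_real (r/2) \<in> ball x r" using r by (simp add: dist_norm)
    moreover have "x - of_real (r/2) \<noteq> x" "x - of_real (r/2) \<noteq> y"
      using r True by (auto simp: complex_eq_iff)
    ultimately show ?thesis using that by blast
  next
    case False
    have "x + of_real (r/2) \<in> ball x r" using r by (simp add: dist_norm)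
    moreover have "x + of_real (r/2) \<noteq> x" using r by (auto simp: complex_eq_iff)
    ultimately show ?thesis using that False by blast
  qed
  have eY: "e \<notin> \<Union>\<Y>" using e r by blast
  have "path_connected (- {e})"
    by (simp add: path_connected_punctured_universe)
  then obtain \<alpha> where \<alpha>: "path \<alpha>" "path_image \<alpha> \<subseteq> - {e}" "pathstart \<alpha> = x" "pathfinish \<alpha> = y"
    unfolding path_connected_def using e by (metis Compl_iff singletonD)
  define \<F> where "\<F> = {Y \<in> \<Y>. Y \<inter> path_image \<alpha> \<noteq> {}}"
  have fin: "finite \<F>" unfolding \<F>_def using \<alpha> by (intro locfin) auto
  \<comment> \<open>The members that \<open>\<alpha>\<close> misses are avoided from the start; those in \<open>\<F>\<close> are added one by one.\<close>
  define T where "T \<G> = point_inversion e (\<Union>((\<Y> - \<F>) \<union> \<G>))" for \<G>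
  have "connected_component (- T \<G>) (inversion e x) (inversion e y)" if "finite \<G>" "\<G> \<subseteq> \<F>" for \<G>
    using that
  proof (induction \<G>)
    case empty
    have "connected_component (- \<Union>(\<Y> - \<F>) - {e}) x y"
      unfolding connected_component_def
      by (rule exI[of _ "path_image \<alpha>"]) (use \<alpha> pathstart_in_path_image[of \<alpha>] pathfinish_in_path_image[of \<alpha>] in \<open>auto simp: \<F>_def connected_path_image\<close>)
    then show ?case
      unfolding T_def by (auto intro: connected_component_point_inversion)
  next
    case (insert Y \<G>)
    have Y: "Y \<in> \<Y>" using insert by (auto simp: \<F>_def)
    define \<H> where "\<H> = (\<Y> - \<F>) \<union> \<G>"
    have \<H>: "\<H> \<subseteq> \<Y>" using insert by (auto simp: \<H>_def \<F>_def)
    have eq: "T (insert Y \<G>) = point_inversion e Y \<union> T \<G>"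
      by (auto simp: T_def point_inversion_def)
    show ?case
      unfolding eq
    proof (rule Janiszewski)
      show "compact (point_inversion e Y)"
        using Y eY by (intro compact_point_inversion clo) auto
      show "closed (T \<G>)"
        unfolding T_def \<H>_def[symmetric]
        using eY \<H> by (intro compact_imp_closed compact_point_inversion cloU) auto
      have "point_inversion e Y \<inter> T \<G> = \<Union>(insert {0} ((\<lambda>Z. point_inversion e (Y \<inter> Z)) ` \<H>))"
        by (auto simp: T_def point_inversion_def \<H>_def[symmetric] inversion_inj)
      moreover have "connected (\<Union>(insert {0} ((\<lambda>Z. point_inversion e (Y \<inter> Z)) ` \<H>)))"
      proof (rule connected_Union)
        fix S assume "S \<in> insert {0} ((\<lambda>Z. point_inversion e (Y \<inter> Z)) ` \<H>)"
        then consider "S = {0}" | Z where "Z \<in> \<Y>" "S = point_inversion e (Y \<inter> Z)"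
          using \<H> by auto
        then show "connected S"
        proof cases
          case 2
          then consider "Y \<inter> Z = {}" | "Y \<inter> Z = Y" | "Y \<inter> Z = Z"
            using nest[OF Y] by blast
          then show ?thesis
            using 2 Y eY con connected_point_inversion
            by cases (auto simp: point_inversion_def[of _ "{}"])
        qed auto
      next
        have "0 \<in> \<Inter>(insert {0} ((\<lambda>Z. point_inversion e (Y \<inter> Z)) ` \<H>))"
          by (auto simp: point_inversion_def)
        then show "\<Inter>(insert {0} ((\<lambda>Z. point_inversion e (Y \<inter> Z)) ` \<H>)) \<noteq> {}"
          by blast
      qed
      ultimately show "connected (point_inversion e Y \<inter> T \<G>)" by simp
      have "connected (- Y - {e})"
        using clo[OF Y] nonsep[OF Y] by (intro connected_open_delete) auto
      then have "connected_component (- Y - {e}) x y"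
        using xy Y e by (auto simp: connected_component_def)
      then show "connected_component (- point_inversion e Y) (inversion e x) (inversion e y)"
        by (rule connected_component_point_inversion)
      show "connected_component (- T \<G>) (inversion e x) (inversion e y)"
        using insert by auto
    qed
  qed
  from this[OF fin subset_refl] have "connected_component (- point_inversion e (\<Union>\<Y>)) (inversion e x) (inversion e y)"
    unfolding T_def by (simp add: Un_absorb2 \<F>_def del: Union_Un_distrib)
  then show ?thesis
    using connected_component_inversion_back eY e by blast
qed

section \<open>Closed lines in the plane\<close>

text \<open>Closures instead of frontiers, because a homeomorphism of the plane visibly preserves this form.\<close>

definition two_sides :: "complex set \<Rightarrow> complex set \<Rightarrow> complex set \<Rightarrow> bool" where
  "two_sides C A B \<longleftrightarrow> open A \<and> open B \<and> connected A \<and> connected B \<and> A \<noteq> {} \<and> B \<noteq> {} \<and>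
     A \<inter> B = {} \<and> A \<union> B = - C \<and> C \<subseteq> closure A \<and> C \<subseteq> closure B"

lemma two_sides_sym: "two_sides C A B \<Longrightarrow> two_sides C B A"
  unfolding two_sides_def by (simp add: Int_commute Un_commute)

lemma two_sides_disjoint:
  assumes "two_sides C A B"
  shows "A \<inter> B = {}" "A \<inter> C = {}" "B \<inter> C = {}" "A \<union> B = - C"
  using assms unfolding two_sides_def by (metis | metis ComplD Int_emptyI UnCI)+

lemma two_sides_closed: "two_sides C A B \<Longrightarrow> closed C"
  unfolding two_sides_def closed_def by (metis open_Un)

lemma two_sides_closed_side:
  assumes "two_sides C A B" shows "closed (A \<union> C)"
proof -
  have "A \<union> B = - C" "A \<inter> B = {}" using assms by (auto simp: two_sides_def)
  then have "A \<union> C = - B" by blast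
  then show ?thesis using assms unfolding two_sides_def by (simp add: closed_def)
qed

lemma two_sides_connected_side:
  assumes "two_sides C A B" shows "connected (A \<union> C)"
proof (rule connected_intermediate_closure)
  show "connected A" "A \<subseteq> A \<union> C" "A \<union> C \<subseteq> closure A"
    using assms closure_subset[of A] unfolding two_sides_def by auto
qed

lemma two_sides_cases:
  assumes "two_sides C A B" "connected D" "D \<inter> C = {}"
  shows "D \<subseteq> A \<or> D \<subseteq> B"
proof -
  note C = assms(1)[unfolded two_sides_def]
  have sub: "D \<subseteq> A \<union> B" using C assms(3) by (metis Int_commute disjoint_eq_subset_Compl)
  moreover have "A \<inter> B \<inter> D = {}" using C by simp
  ultimately have "A \<inter> D = {} \<or> B \<inter> D = {}"
    using C assms(2) by (intro connectedD) auto
  then show ?thesis using sub by blast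
qed

lemma two_sides_image:
  assumes F: "homeomorphism UNIV UNIV F G" and C: "two_sides C A B"
  shows "two_sides (F ` C) (F ` A) (F ` B)"
proof -
  have inj: "inj F" and surj: "surj F"
    using F by (auto simp: homeomorphism_def inj_on_def) (metis UNIV_I)
  have cont: "continuous_on UNIV F" using F by (simp add: homeomorphism_def)
  have op: "open (F ` W)" if "open W" for W
  proof -
    have "F ` W = G -` W" using F by (auto simp: homeomorphism_def) (metis UNIV_I image_eqI)
    then show ?thesis using F that by (simp add: homeomorphism_def open_vimage)
  qed
  have clo: "F ` closure W \<subseteq> closure (F ` W)" for W
    using cont by (intro image_closure_subset) (auto intro: continuous_on_subset closure_subset[THEN subsetD])
  have "F ` A \<union> F ` B = - F ` C"
    using C inj surj unfolding two_sides_def by (metis bij_def bij_image_Compl_eq image_Un)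
  moreover have "F ` A \<inter> F ` B = {}"
    using C inj unfolding two_sides_def by (metis image_Int image_empty)
  moreover have "F ` C \<subseteq> closure (F ` A)" "F ` C \<subseteq> closure (F ` B)"
    using C clo[of A] clo[of B] unfolding two_sides_def by blast+
  ultimately show ?thesis
    using C op connected_continuous_image[OF continuous_on_subset[OF cont]] unfolding two_sides_def by auto
qed

text \<open>Each line lies on one side of the other, and a side stays connected when its line is added to it.\<close>

lemma two_sides_position:
  assumes C: "two_sides C A B" "connected C" "C \<noteq> {}"
    and D: "two_sides D A' B'" "connected D" "D \<noteq> {}" and CD: "C \<inter> D = {}"
  obtains "(A \<union> C) \<inter> (A' \<union> D) = {}" | "A \<union> C \<subseteq> A'" | "A' \<union> D \<subseteq> A"
    | "B \<union> C \<subseteq> A'" "B' \<union> D \<subseteq> A"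
proof -
  have disj: "A \<inter> B = {}" "A' \<inter> B' = {}" "A \<inter> C = {}" "B \<inter> C = {}" "A' \<inter> D = {}" "B' \<inter> D = {}"
    using two_sides_disjoint[OF C(1)] two_sides_disjoint[OF D(1)] by auto
  have DA: "D \<subseteq> A \<or> D \<subseteq> B" using two_sides_cases C D CD by blast
  have CA: "C \<subseteq> A' \<or> C \<subseteq> B'" using two_sides_cases C D CD by blast
  have 1: "A \<union> C \<subseteq> A' \<or> A \<union> C \<subseteq> B'" if "D \<subseteq> B"
    by (rule two_sides_cases[OF D(1) two_sides_connected_side[OF C(1)]])
      (use that CD disj in blast)
  have 2: "B \<union> C \<subseteq> A' \<or> B \<union> C \<subseteq> B'" if "D \<subseteq> A"
    by (rule two_sides_cases[OF D(1) two_sides_connected_side[OF two_sides_sym[OF C(1)]]])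
      (use that CD disj in blast)
  have 3: "A' \<union> D \<subseteq> A \<or> A' \<union> D \<subseteq> B" if "C \<subseteq> B'"
    by (rule two_sides_cases[OF C(1) two_sides_connected_side[OF D(1)]])
      (use that CD disj in blast)
  have 4: "B' \<union> D \<subseteq> A \<or> B' \<union> D \<subseteq> B" if "C \<subseteq> A'"
    by (rule two_sides_cases[OF C(1) two_sides_connected_side[OF two_sides_sym[OF D(1)]]])
      (use that CD disj in blast)
  show thesis
  proof (cases "D \<subseteq> A")
    case True
    show thesis
    proof (cases "C \<subseteq> A'")
      case t: True
      then have "B \<union> C \<subseteq> A'" using 2 True disj C(3) by blast
      moreover have "B' \<union> D \<subseteq> A" using 4 True t disj D(3) by blast
      ultimately show thesis by (rule that(4))
    next
      case f: False
      then have "C \<subseteq> B'" using CA by blast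
      then have "A' \<union> D \<subseteq> A" using 3 True disj D(3) by blast
      then show thesis by (rule that(3))
    qed
  next
    case False
    then have DB: "D \<subseteq> B" using DA by blast
    show thesis
    proof (cases "C \<subseteq> A'")
      case True
      then have "A \<union> C \<subseteq> A'" using 1 DB disj C(3) by blast
      then show thesis by (rule that(2))
    next
      case f: False
      then have "A \<union> C \<subseteq> B'" using 1 DB disj C(3) by blast
      then have "(A \<union> C) \<inter> (A' \<union> D) = {}" using disj by blast
      then show thesis by (rule that(1))
    qed
  qed
qed

text \<open>The Jordan curve theorem after an inversion about a point \<open>e\<close> off the line, which sends both ends of
  the line to \<open>0\<close>. The point \<open>e\<close> itself corresponds to infinity and has to be restored to the side that
  comes from the outside of the Jordan curve.\<close>

theorem two_sides_proper_line:
  fixes c :: "real \<Rightarrow> complex"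
  assumes ab: "a < b" and cont: "continuous_on {a<..<b} c" and inj: "inj_on c {a<..<b}"
    and proper: "\<And>r. \<exists>a' b'. a < a' \<and> b' < b \<and> (\<forall>t\<in>{a<..<b}. norm (c t) \<le> r \<longrightarrow> a' \<le> t \<and> t \<le> b')"
    and e: "e \<notin> c ` {a<..<b}"
  shows "connected (c ` {a<..<b})" "\<not> bounded (c ` {a<..<b})" "\<exists>A B. two_sides (c ` {a<..<b}) A B"
proof -
  let ?L = "c ` {a<..<b}"
  show "connected ?L"
    by (intro connected_continuous_image cont) auto
  show "\<not> bounded ?L"
  proof
    assume "bounded ?L"
    then obtain r where r: "\<And>t. t \<in> {a<..<b} \<Longrightarrow> norm (c t) \<le> r"
      unfolding bounded_iff by blast
    obtain a' b' where "a < a'" "b' < b" "\<forall>t\<in>{a<..<b}. norm (c t) \<le> r \<longrightarrow> a' \<le> t \<and> t \<le> b'"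
      using proper by metis
    moreover have "(a + min a' b) / 2 \<in> {a<..<b}" "(a + min a' b) / 2 < a'"
      using \<open>a < a'\<close> ab by (auto simp: min_def)
    ultimately show False using r by (meson not_le)
  qed
  \<comment> \<open>The inverted line, closed up at \<open>0\<close>.\<close>
  define k where "k t = (if t \<in> {a<..<b} then inversion e (c t) else 0)" for t
  have small: "\<exists>a' b'. a < a' \<and> b' < b \<and> (\<forall>t. t < a' \<or> b' < t \<longrightarrow> norm (k t) < \<epsilon>)" if "\<epsilon> > 0" for \<epsilon>
  proof -
    obtain a' b' where *: "a < a'" "b' < b" "\<forall>t\<in>{a<..<b}. norm (c t) \<le> norm e + inverse \<epsilon> \<longrightarrow> a' \<le> t \<and> t \<le> b'"
      using proper by metis
    have "norm (k t) < \<epsilon>" if t: "t < a' \<or> b' < t" for t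
    proof (cases "t \<in> {a<..<b}")
      case True
      with * t have "norm (c t) > norm e + inverse \<epsilon>" by force
      then have "inverse \<epsilon> < norm (c t - e)" using norm_triangle_ineq2[of "c t" e] by simp
      then have "inverse (norm (c t - e)) < inverse (inverse \<epsilon>)"
        using \<open>\<epsilon> > 0\<close> by (intro less_imp_inverse_less) auto
      then show ?thesis using True by (simp add: k_def inversion_def norm_inverse)
    qed (use \<open>\<epsilon> > 0\<close> in \<open>auto simp: k_def\<close>)
    with * show ?thesis by blast
  qed
  have contk: "isCont k t" for t
  proof (cases "t \<in> {a<..<b}")
    case True
    have "continuous_on {a<..<b} (\<lambda>t. inversion e (c t))"
      unfolding inversion_def using cont e by (intro continuous_intros) auto
    then have "isCont (\<lambda>t. inversion e (c t)) t"
      using True by (simp add: continuous_on_eq_continuous_at)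
    moreover have "\<forall>\<^sub>F s in nhds t. inversion e (c s) = k s"
      using True by (intro eventually_nhds_in_open[THEN eventually_mono, of "{a<..<b}"]) (auto simp: k_def)
    ultimately show ?thesis using isCont_cong by metis
  next
    case False
    then have kt: "k t = 0" unfolding k_def by (rule if_not_P)
    show ?thesis
      unfolding continuous_at_eps_delta
    proof (intro allI impI)
      fix \<epsilon>::real assume "\<epsilon> > 0"
      then obtain a' b' where *: "a < a'" "b' < b" "\<And>s. s < a' \<or> b' < s \<Longrightarrow> norm (k s) < \<epsilon>"
        using small by blast
      define d where "d = min (a' - a) (b - b')"
      have "norm (k s) < \<epsilon>" if "dist s t < d" for s
        using * that False by (intro *(3)) (auto simp: d_def dist_real_def)
      then show "\<exists>d>0. \<forall>s. dist s t < d \<longrightarrow> dist (k s) (k t) < \<epsilon>"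
        using * by (intro exI[of _ d]) (auto simp: d_def kt)
    qed
  qed
  define q where "q s = k (a + s * (b - a))" for s
  have qe: "q 0 = 0" "q 1 = 0" by (auto simp: q_def k_def)
  have par: "a + s * (b - a) \<in> {a<..<b} \<longleftrightarrow> s \<in> {0<..<1}" for s
  proof -
    have "0 < s * (b - a) \<longleftrightarrow> 0 < s" using ab by (simp add: zero_less_mult_iff)
    moreover have "s * (b - a) < 1 * (b - a) \<longleftrightarrow> s < 1"
      using ab by (intro mult_less_cancel_right_pos) auto
    ultimately show ?thesis by auto
  qed
  have kinj: "s = t" if "k s = k t" "s \<in> {a<..<b}" for s t
  proof -
    have "k s \<noteq> 0" using that e by (auto simp: k_def inversion_eq_0)
    then have "t \<in> {a<..<b}" using that by (auto simp: k_def split: if_splits)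
    then show ?thesis using that inj by (auto simp: k_def inversion_inj inj_on_def)
  qed
  have "simple_path q"
    unfolding simple_path_def loop_free_def
  proof
    show "path q"
      unfolding path_def q_def
      by (intro continuous_at_imp_continuous_on ballI continuous_at_compose[unfolded comp_def, OF _ contk] continuous_intros)
    show "\<forall>x\<in>{0..1}. \<forall>y\<in>{0..1}. q x = q y \<longrightarrow> x = y \<or> x = 0 \<and> y = 1 \<or> x = 1 \<and> y = 0"
    proof (intro ballI impI)
      fix x y :: real assume xy: "x \<in> {0..1}" "y \<in> {0..1}" "q x = q y"
      show "x = y \<or> x = 0 \<and> y = 1 \<or> x = 1 \<and> y = 0"
      proof (cases "x \<in> {0<..<1} \<or> y \<in> {0<..<1}")
        case True
        then have "a + x * (b - a) = a + y * (b - a)"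
          using kinj[of "a + x * (b - a)" "a + y * (b - a)"] kinj[of "a + y * (b - a)" "a + x * (b - a)"] xy
          unfolding par q_def by metis
        then show ?thesis using ab by simp
      next
        case False
        then show ?thesis using xy by auto
      qed
    qed
  qed
  moreover have "pathfinish q = pathstart q" by (simp add: pathfinish_def pathstart_def qe)
  ultimately have J: "inside(path_image q) \<noteq> {}" "open(inside(path_image q))" "connected(inside(path_image q))"
    "outside(path_image q) \<noteq> {}" "open(outside(path_image q))" "connected(outside(path_image q))"
    "\<not> bounded(outside(path_image q))" "bounded(inside(path_image q))"
    "inside(path_image q) \<inter> outside(path_image q) = {}"
    "inside(path_image q) \<union> outside(path_image q) = - path_image q"
    "frontier(inside(path_image q)) = path_image q" "frontier(outside(path_image q)) = path_image q"
    using Jordan_inside_outside[of q] by auto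
  have im: "path_image q = point_inversion e ?L"
  proof -
    have "q ` {0..1} = insert 0 (q ` {0<..<1})"
    proof -
      have "{0..1} = insert 0 (insert 1 {0<..<1::real})" by auto
      then show ?thesis using qe by simp
    qed
    also have "q ` {0<..<1} = inversion e ` ?L"
    proof (intro equalityI subsetI)
      fix w assume "w \<in> inversion e ` ?L"
      then obtain t where t: "t \<in> {a<..<b}" "w = inversion e (c t)" by auto
      define s where "s = (t - a) / (b - a)"
      have "a + s * (b - a) = t" using ab by (simp add: s_def)
      with t par[of s] have "s \<in> {0<..<1}" "q s = w" by (auto simp: q_def k_def)
      then show "w \<in> q ` {0<..<1}" by blast
    next
      fix w assume "w \<in> q ` {0<..<1}"
      then obtain s where s: "s \<in> {0<..<1}" "w = q s" by auto
      then have "a + s * (b - a) \<in> {a<..<b}" using par by blast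
      then show "w \<in> inversion e ` ?L" using s by (auto simp: q_def k_def)
    qed
    finally show ?thesis by (simp add: path_image_def point_inversion_def)
  qed
  let ?\<kappa> = "\<lambda>w. e + inverse w"
  have 0: "0 \<in> path_image q" by (simp add: im point_inversion_def)
  define pre where "pre W = (- {e}) \<inter> inversion e -` W" for W
  have pre_open: "open (pre W)" if "open W" for W
    unfolding pre_def using that by (intro continuous_open_preimage inversion_continuous) auto
  have pre_image: "pre W = ?\<kappa> ` W" if "W \<subseteq> - path_image q" for W
  proof (intro equalityI subsetI)
    fix z assume "z \<in> pre W"
    then show "z \<in> ?\<kappa> ` W" unfolding pre_def by (metis ComplD IntD1 IntD2 image_eqI insertI1 inversion_back vimageD)
  next
    fix z assume "z \<in> ?\<kappa> ` W"
    then obtain w where "w \<in> W" "z = ?\<kappa> w" by auto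
    moreover have "w \<noteq> 0" using \<open>w \<in> W\<close> that 0 by auto
    ultimately show "z \<in> pre W" by (auto simp: pre_def inversion_inversion_back)
  qed
  have pre_connected: "connected (pre W)" if "W \<subseteq> - path_image q" "connected W" for W
    unfolding pre_image[OF that(1)] using that 0
    by (intro connected_continuous_image continuous_on_subset[OF inversion_back_continuous]) auto
  have pre_closure: "?L \<subseteq> closure (pre W)" if W: "W \<subseteq> - path_image q" "path_image q \<subseteq> closure W" for W
  proof
    fix z assume z: "z \<in> ?L"
    then have ze: "z \<noteq> e" using e by auto
    show "z \<in> closure (pre W)"
      unfolding closure_iff_nhds_not_empty
    proof (intro allI impI)
      fix V S assume S: "z \<in> S" "open S" "S \<subseteq> V"
      have "open ((- {0}) \<inter> ?\<kappa> -` S)"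
        using S by (intro continuous_open_preimage inversion_back_continuous) auto
      moreover have "inversion e z \<in> (- {0}) \<inter> ?\<kappa> -` S"
        using S ze by (simp add: inversion_back inversion_eq_0)
      moreover have "inversion e z \<in> closure W"
        using W z im by (auto simp: point_inversion_def)
      ultimately have "W \<inter> ((- {0}) \<inter> ?\<kappa> -` S) \<noteq> {}"
        unfolding closure_iff_nhds_not_empty by (meson subset_refl)
      then obtain w where "w \<in> W" "w \<noteq> 0" "?\<kappa> w \<in> S" by auto
      then have "?\<kappa> w \<in> pre W" "?\<kappa> w \<in> V" using pre_image[OF W(1)] S by auto
      then show "pre W \<inter> V \<noteq> {}" by blast
    qed
  qed
  let ?I = "inside (path_image q)" and ?O = "outside (path_image q)"
  have IO: "?I \<subseteq> - path_image q" "?O \<subseteq> - path_image q" using J by blast+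
  obtain R where R: "?I \<union> path_image q \<subseteq> ball 0 R" "R > 0"
    using J(8) \<open>simple_path q\<close>
    by (metis bounded_Un bounded_simple_path_image bounded_subset_ballD)
  have near_e: "z \<in> pre ?O" if "z \<noteq> e" "norm (z - e) < inverse R" for z
  proof -
    have "R < norm (inversion e z)"
      using that R less_imp_inverse_less[of "norm (z - e)" "inverse R"] by (simp add: inversion_def norm_inverse)
    then have "inversion e z \<in> ?O" using R J(10) by (metis ComplI UnCI UnE mem_ball_0 not_less_iff_gr_or_eq subsetD)
    then show ?thesis using that by (simp add: pre_def)
  qed
  have e_ball: "ball e (inverse R) \<subseteq> insert e (pre ?O)"
  proof
    fix z assume "z \<in> ball e (inverse R)"
    then have "norm (z - e) < inverse R" by (simp add: dist_norm norm_minus_commute)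
    then show "z \<in> insert e (pre ?O)" using near_e by blast
  qed
  have opO: "open (insert e (pre ?O))"
  proof -
    have "insert e (pre ?O) = pre ?O \<union> ball e (inverse R)"
      using e_ball R by auto
    then show ?thesis using pre_open J by (metis open_Un open_ball)
  qed
  have "connected (insert e (pre ?O))"
  proof -
    have "e \<in> closure (pre ?O)"
      unfolding closure_approachable
    proof (intro allI impI)
      fix d::real assume "d > 0"
      define r where "r = min d (inverse R) / 2"
      define z where "z = e + of_real r"
      have r: "0 < r" "r < d" "r < inverse R"
        using \<open>d > 0\<close> R(2) positive_imp_inverse_positive[OF R(2)] by (auto simp: r_def min_def)
      then have "dist z e < d" "z \<noteq> e" "norm (z - e) < inverse R"
        by (auto simp: z_def dist_norm)
      with near_e show "\<exists>y\<in>pre ?O. dist y e < d" by blast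
    qed
    then have "insert e (pre ?O) \<subseteq> closure (pre ?O)"
      using closure_subset[of "pre ?O"] by blast
    then show ?thesis
      by (rule connected_intermediate_closure[OF pre_connected[OF IO(2) J(6)] subset_insertI])
  qed
  moreover have "pre ?I \<union> insert e (pre ?O) = - ?L"
  proof -
    have "z \<in> pre ?I \<or> z \<in> pre ?O \<longleftrightarrow> z \<notin> ?L" if "z \<noteq> e" for z
    proof -
      have "z \<in> pre ?I \<or> z \<in> pre ?O \<longleftrightarrow> inversion e z \<notin> path_image q"
        using that J(10) unfolding pre_def by (metis (no_types, lifting) Compl_iff Int_iff Un_iff singletonD vimage_eq)
      also have "\<dots> \<longleftrightarrow> z \<notin> ?L"
        using that by (auto simp: im point_inversion_def inversion_eq_0 inversion_inj)
      finally show ?thesis .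
    qed
    moreover have "e \<notin> pre ?I" by (simp add: pre_def)
    ultimately show ?thesis
      using e by (intro Set.set_eqI) (metis Compl_iff UnE UnI1 UnI2 insert_iff)
  qed
  moreover have "pre ?I \<inter> insert e (pre ?O) = {}"
    using J(9) unfolding pre_def by blast
  moreover have "pre ?I \<noteq> {}" using pre_image[OF IO(1)] J by simp
  moreover have "?L \<subseteq> closure (pre ?I)"
    using J(11) by (intro pre_closure IO) (auto simp: frontier_def)
  moreover have "?L \<subseteq> closure (insert e (pre ?O))"
    using J(12) pre_closure[OF IO(2)] closure_mono[OF subset_insertI, of "pre ?O" e]
    by (auto simp: frontier_def)
  ultimately have "two_sides ?L (pre ?I) (insert e (pre ?O))"
    unfolding two_sides_def using opO pre_open J pre_connected IO by auto
  then show "\<exists>A B. two_sides ?L A B" by blast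
qed

section \<open>Recurrence and crosscuts\<close>

definition recurrent :: "('a::topological_space \<Rightarrow> 'a) \<Rightarrow> bool" where
  "recurrent F \<longleftrightarrow> (\<forall>V. open V \<and> V \<noteq> {} \<longrightarrow> (\<exists>n\<ge>1. (F ^^ n) ` V \<inter> V \<noteq> {}))"

lemma recurrentE:
  assumes "recurrent F" "open V" "V \<noteq> {}"
  obtains n z where "n \<ge> 1" "z \<in> V" "(F ^^ n) z \<in> V"
  using assms unfolding recurrent_def by blast

lemma disjoint_subsets: "A \<subseteq> A' \<Longrightarrow> B \<subseteq> B' \<Longrightarrow> A' \<inter> B' = {} \<Longrightarrow> A \<inter> B = {}"
  by blast

lemma funpow_absorb:
  assumes "F ` P \<subseteq> P" "n \<ge> (1::nat)" "z \<in> P"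
  shows "(F ^^ n) z \<in> F ` P"
  using assms(2)
proof (induction n rule: dec_induct)
  case base then show ?case using assms by simp
next
  case (step n) then show ?case using assms by auto
qed

text \<open>An orbit that starts in \<open>V\<close> remains in \<open>F ` P\<close> from its first step on.\<close>

lemma no_trap:
  assumes "recurrent F" "F ` P \<subseteq> P" "open V" "V \<noteq> {}" "V \<subseteq> P" "V \<inter> F ` P = {}"
  shows False
proof -
  obtain n z where "n \<ge> 1" "z \<in> V" "(F ^^ n) z \<in> V"
    using recurrentE[OF assms(1,3,4)] by blast
  then show False using funpow_absorb[OF assms(2)] assms(5,6) by blast
qed

text \<open>The complement of an expanding set is mapped into itself.\<close>

lemma no_expanding_trap:
  assumes "recurrent F" "bij F" "P \<subseteq> F ` P" "open V" "V \<noteq> {}" "V \<subseteq> F ` P" "V \<inter> P = {}"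
  shows False
proof (rule no_trap[of F "- P" V])
  have "F ` (- P) = - F ` P" using assms(2) by (rule bij_image_Compl_eq)
  then show "F ` (- P) \<subseteq> - P" "V \<inter> F ` (- P) = {}" using assms by auto
qed (use assms in auto)

lemma recurrent_inverse:
  assumes F: "\<And>z. G (F z) = z" and rec: "recurrent F"
  shows "recurrent G"
  unfolding recurrent_def
proof (intro allI impI)
  fix V :: "'a set" assume "open V \<and> V \<noteq> {}"
  then obtain n z where n: "n \<ge> 1" "z \<in> V" "(F ^^ n) z \<in> V"
    using recurrentE[OF rec] by blast
  have "(G ^^ n) ((F ^^ n) z) = z"
    by (induction n arbitrary: z) (simp_all add: F funpow_swap1)
  then show "\<exists>n\<ge>1. (G ^^ n) ` V \<inter> V \<noteq> {}" using n by (metis IntI emptyE imageI)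
qed

text \<open>If every \<open>F ` X i\<close> were nested in some \<open>inn j\<close>, recurrence would close up a chain of such inclusions
  to a cycle. The union of the inner sets along the cycle would be mapped into itself and miss a gap.\<close>

lemma nesting_chain_ends:
  fixes F :: "'a::topological_space \<Rightarrow> 'a" and inn X :: "'i \<Rightarrow> 'a set"
  assumes rec: "recurrent F" and ne: "I \<noteq> {}"
    and inn: "\<And>i. i \<in> I \<Longrightarrow> open (inn i)" "\<And>i. i \<in> I \<Longrightarrow> inn i \<noteq> {}" "\<And>i. i \<in> I \<Longrightarrow> inn i \<subseteq> X i"
    and disj: "\<And>i j. i \<in> I \<Longrightarrow> j \<in> I \<Longrightarrow> i \<noteq> j \<Longrightarrow> inn i \<inter> inn j = {}"
    and gap: "\<And>i j. i \<in> I \<Longrightarrow> j \<in> I \<Longrightarrow> F ` X i \<subseteq> inn j \<Longrightarrow>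
                \<exists>V. open V \<and> V \<noteq> {} \<and> V \<subseteq> inn j \<and> V \<inter> F ` inn i = {}"
  shows "\<exists>i\<in>I. \<forall>j\<in>I. \<not> F ` X i \<subseteq> inn j"
proof (rule ccontr)
  assume "\<not> ?thesis"
  then obtain nx where nx: "\<And>i. i \<in> I \<Longrightarrow> nx i \<in> I" "\<And>i. i \<in> I \<Longrightarrow> F ` X i \<subseteq> inn (nx i)"
    by metis
  obtain m where m: "m \<in> I" using ne by blast
  define a where "a k = (nx ^^ k) m" for k
  have a: "a k \<in> I" for k by (induction k) (auto simp: a_def m nx)
  have step: "F ` inn (a k) \<subseteq> inn (a (Suc k))" for k
    using nx(2)[OF a[of k]] inn(3)[OF a[of k]] by (auto simp: a_def)
  have orbit: "(F ^^ k) z \<in> inn (a k)" if "z \<in> inn m" for k z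
    using that step by (induction k) (auto simp: a_def)
  define Q where "Q n \<longleftrightarrow> n \<ge> 1 \<and> a n = m" for n
  obtain n z where "n \<ge> 1" "z \<in> inn m" "(F ^^ n) z \<in> inn m"
    using recurrentE[OF rec] inn m by metis
  then have Qn: "Q n" using orbit[of z n] disj[OF a[of n] m] by (auto simp: Q_def)
  \<comment> \<open>On a shortest cycle, only the last inner set is mapped into the first one.\<close>
  define n where "n = (LEAST n. Q n)"
  have n: "n \<ge> 1" "a n = m" using LeastI[of Q, OF Qn] by (auto simp: n_def Q_def)
  have least: "a k \<noteq> m" if "k \<ge> 1" "k < n" for k
    using not_less_Least[of k Q] that by (auto simp: n_def Q_def)
  obtain p where p: "n = Suc p" using n(1) by (cases n) auto
  define P where "P = (\<Union>k<n. inn (a k))"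
  have Xm: "F ` X (a p) \<subseteq> inn m" using nx(2)[OF a[of p]] n(2) by (simp add: a_def p)
  then obtain V where V: "open V" "V \<noteq> {}" "V \<subseteq> inn m" "V \<inter> F ` inn (a p) = {}"
    using gap[OF a m Xm] by metis
  show False
  proof (rule no_trap[OF rec _ V(1,2)])
    have a0: "a 0 = m" by (simp add: a_def)
    show "F ` P \<subseteq> P"
    proof
      fix y assume "y \<in> F ` P"
      then obtain k where k: "k < n" "y \<in> F ` inn (a k)" by (auto simp: P_def)
      then have y: "y \<in> inn (a (Suc k))" using step by blast
      show "y \<in> P"
      proof (cases "Suc k < n")
        case True then show ?thesis using y by (auto simp: P_def)
      next
        case False
        then have "a (Suc k) = a 0" using k n a0 by (metis Suc_lessI)
        then show ?thesis using y n by (auto simp: P_def)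
      qed
    qed
    show "V \<subseteq> P" using V(3) a0 n by (force simp: P_def)
    show "V \<inter> F ` P = {}"
    proof (rule ccontr)
      assume "V \<inter> F ` P \<noteq> {}"
      then obtain k y where k: "k < n" "y \<in> F ` inn (a k)" "y \<in> V" by (auto simp: P_def)
      then have y: "y \<in> inn (a (Suc k))" "y \<in> inn m" using step V by blast+
      then have "a (Suc k) = m" using disj[OF a m] by blast
      then have "\<not> Suc k < n" using least by auto
      then have "k = p" using k p by simp
      then show False using k V by blast
    qed
  qed
qed

text \<open>The traces of a curve on an invariant disk, once the disk is identified with the plane and if the
  curve is disjoint from its image.\<close>

locale crosscut_family =
  fixes F G :: "complex \<Rightarrow> complex" and \<C> :: "complex set set"
  assumes homeo: "homeomorphism UNIV UNIV F G"
    and rec: "recurrent F"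
    and nonempty: "\<C> \<noteq> {}"
    and line: "\<And>C. C \<in> \<C> \<Longrightarrow> connected C" "\<And>C. C \<in> \<C> \<Longrightarrow> \<not> bounded C"
      "\<And>C. C \<in> \<C> \<Longrightarrow> \<exists>A B. two_sides C A B"
    and disjoint: "\<And>C D. C \<in> \<C> \<Longrightarrow> D \<in> \<C> \<Longrightarrow> C \<noteq> D \<Longrightarrow> C \<inter> D = {}"
    and free: "\<And>C D. C \<in> \<C> \<Longrightarrow> D \<in> \<C> \<Longrightarrow> F ` C \<inter> D = {}"
    and locfin: "\<And>K. compact K \<Longrightarrow> finite {C \<in> \<C>. C \<inter> K \<noteq> {}}"
begin

lemma line_nonempty: "C \<in> \<C> \<Longrightarrow> C \<noteq> {}"
  using line(2) by auto

lemma GF: "G (F z) = z" and FG: "F (G z) = z"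
  using homeo by (auto simp: homeomorphism_def)

lemma bijF: "bij F"
  by (metis GF FG bijI' )

lemma cont: "continuous_on UNIV F" "continuous_on UNIV G"
  using homeo by (auto simp: homeomorphism_def)

lemma F_image: "F ` W = G -` W"
  using GF FG by (auto simp: image_iff) metis

lemma open_F: "open W \<Longrightarrow> open (F ` W)" and closed_F: "closed W \<Longrightarrow> closed (F ` W)"
  unfolding F_image by (simp_all add: open_vimage closed_vimage cont)

lemma homeoG: "homeomorphism UNIV UNIV G F"
  using homeo homeomorphism_symD by blast

text \<open>Let \<open>B\<close> be the side that contains \<open>F ` C\<close>, and \<open>A\<close> the other one. Then \<open>A \<union> C\<close> lies on one side of \<open>F ` C\<close>.
  If this were \<open>F ` A\<close>, the set \<open>A\<close> would expand.\<close>

lemma exists_free_side: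
  assumes C: "C \<in> \<C>"
  shows "\<exists>A B. two_sides C A B \<and> F ` C \<subseteq> B \<and> F ` A \<inter> A = {}"
proof -
  have "connected (F ` C)" using line(1)[OF C] cont by (meson connected_continuous_image continuous_on_subset subset_UNIV)
  then obtain A B where AB: "two_sides C A B" "F ` C \<subseteq> B"
    using line(3)[OF C] two_sides_cases free[OF C C] two_sides_sym by metis
  note FC = two_sides_image[OF homeo AB(1)]
  note d = two_sides_disjoint[OF AB(1)] and fd = two_sides_disjoint[OF FC]
  have "(A \<union> C) \<inter> F ` C = {}" using AB(2) d by blast
  then consider "A \<union> C \<subseteq> F ` A" | "A \<union> C \<subseteq> F ` B"
    using two_sides_cases[OF FC two_sides_connected_side[OF AB(1)]] by blast
  then show ?thesis
  proof cases
    case 1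
    define V where "V = F ` A \<inter> B"
    have "open V" using AB(1) open_F by (auto simp: V_def two_sides_def)
    moreover have "V \<noteq> {}"
    proof -
      obtain z where "z \<in> F ` C" using line_nonempty[OF C] by blast
      then have "z \<in> closure (F ` A)" "z \<in> B" using FC AB(2) by (auto simp: two_sides_def)
      moreover have "open B" using AB by (simp add: two_sides_def)
      ultimately show ?thesis unfolding V_def using open_Int_closure_eq_empty[of B "F ` A"] by blast
    qed
    ultimately have False
      by (intro no_expanding_trap[OF rec bijF, of A V]) (use 1 d in \<open>auto simp: V_def\<close>)
    then show ?thesis ..
  next
    case 2
    then have "F ` A \<inter> A = {}" using fd by blast
    then show ?thesis using AB by blast
  qed
qed

definition inner_side :: "complex set \<Rightarrow> complex set" where
  "inner_side C = (SOME A. \<exists>B. two_sides C A B \<and> F ` C \<subseteq> B \<and> F ` A \<inter> A = {})"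

definition outer_side :: "complex set \<Rightarrow> complex set" where
  "outer_side C = - (inner_side C \<union> C)"

definition closed_side :: "complex set \<Rightarrow> complex set" where
  "closed_side C = inner_side C \<union> C"

lemma sides:
  assumes "C \<in> \<C>"
  shows "two_sides C (inner_side C) (outer_side C)" "F ` C \<subseteq> outer_side C"
    "F ` inner_side C \<inter> inner_side C = {}"
proof -
  have "\<exists>B. two_sides C (inner_side C) B \<and> F ` C \<subseteq> B \<and> F ` inner_side C \<inter> inner_side C = {}"
    unfolding inner_side_def using exists_free_side[OF assms] by (rule someI_ex)
  then obtain B where B: "two_sides C (inner_side C) B" "F ` C \<subseteq> B" "F ` inner_side C \<inter> inner_side C = {}"
    by blast
  have "B = outer_side C" using two_sides_disjoint[OF B(1)] unfolding outer_side_def by blast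
  with B show "two_sides C (inner_side C) (outer_side C)" "F ` C \<subseteq> outer_side C"
    "F ` inner_side C \<inter> inner_side C = {}" by auto
qed

lemma side_facts:
  assumes "C \<in> \<C>"
  shows "open (inner_side C)" "inner_side C \<noteq> {}" "closed (closed_side C)" "connected (closed_side C)"
    "C \<subseteq> closed_side C" "inner_side C \<subseteq> closed_side C" "inner_side C \<inter> C = {}"
    "outer_side C = - closed_side C" "connected (outer_side C)" "\<not> bounded (closed_side C)" "closed C"
proof -
  note t = sides(1)[OF assms]
  note d = two_sides_disjoint[OF t] and u = t[unfolded two_sides_def]
  show "open (inner_side C)" "inner_side C \<noteq> {}" "connected (outer_side C)" using u by simp_all
  show "closed (closed_side C)" "connected (closed_side C)"
    unfolding closed_side_def by (rule two_sides_closed_side[OF t], rule two_sides_connected_side[OF t])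
  show "C \<subseteq> closed_side C" "inner_side C \<subseteq> closed_side C" by (simp_all add: closed_side_def)
  show "inner_side C \<inter> C = {}" by (rule d(2))
  show "outer_side C = - closed_side C" by (simp add: outer_side_def closed_side_def)
  show "\<not> bounded (closed_side C)"
    using line(2)[OF assms] bounded_subset[of "closed_side C" C] by (auto simp: closed_side_def)
  show "closed C" by (rule two_sides_closed[OF t])
qed

lemma free_inner: "C \<in> \<C> \<Longrightarrow> z \<in> inner_side C \<Longrightarrow> F z \<notin> inner_side C"
  using sides(3)[of C] by (metis IntI emptyE imageI)

text \<open>In the one other position of two lines, the inner side of \<open>D\<close> contains \<open>C\<close> and the outer side of \<open>C\<close>.
  It is disjoint from its image, whereas \<open>F ` C\<close> lies in the outer side of \<open>C\<close>.\<close>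

lemma sides_nested_or_disjoint:
  assumes C: "C \<in> \<C>" and D: "D \<in> \<C>" and CD: "C \<noteq> D"
  shows "closed_side C \<inter> closed_side D = {} \<or> closed_side C \<subseteq> inner_side D \<or> closed_side D \<subseteq> inner_side C"
proof (cases rule: two_sides_position[OF sides(1)[OF C] line(1)[OF C] line_nonempty[OF C]
        sides(1)[OF D] line(1)[OF D] line_nonempty[OF D] disjoint[OF C D CD]])
  case 4
  have "F ` C \<inter> outer_side C = {}"
  proof (rule disjoint_subsets[OF image_mono _ sides(3)[OF D]])
    show "C \<subseteq> inner_side D" "outer_side C \<subseteq> inner_side D" using 4(1) by (rule Un_subset_iff[THEN iffD1, THEN conjunct2], rule Un_subset_iff[THEN iffD1, THEN conjunct1])
  qed
  then have "F ` C = {}" using sides(2)[OF C] by (metis inf.absorb1)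
  then show ?thesis using line_nonempty[OF C] by simp
qed (simp_all add: closed_side_def)

definition maximal :: "complex set set" where
  "maximal = {C \<in> \<C>. \<forall>D\<in>\<C>. \<not> closed_side C \<subseteq> inner_side D}"

text \<open>A line whose inner side contains a point \<open>c\<close> but, being free, not \<open>F c\<close> meets the segment between
  them. So only finitely many inner sides contain \<open>c\<close>.\<close>

lemma below_maximal:
  assumes C: "C \<in> \<C>"
  shows "\<exists>M\<in>maximal. closed_side C \<subseteq> closed_side M"
proof -
  obtain c where c: "c \<in> C" using line_nonempty[OF C] by blast
  define K where "K = closed_segment c (F c)"
  define Up where "Up = {D \<in> \<C>. closed_side C \<subseteq> closed_side D}"
  have "D \<inter> K \<noteq> {}" if D: "D \<in> Up" for D
  proof
    assume e: "D \<inter> K = {}"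
    have D': "D \<in> \<C>" "c \<in> closed_side D" using D c side_facts(5)[OF C] by (auto simp: Up_def)
    have "c \<notin> D" using e by (auto simp: K_def)
    then have c': "c \<in> inner_side D" using D' by (auto simp: closed_side_def)
    have "K \<subseteq> inner_side D \<or> K \<subseteq> outer_side D"
      by (rule two_sides_cases[OF sides(1)[OF D'(1)]]) (use e in \<open>auto simp: K_def\<close>)
    moreover have "c \<in> K" "F c \<in> K" by (auto simp: K_def)
    ultimately have "F c \<in> inner_side D"
      using c' two_sides_disjoint(1)[OF sides(1)[OF D'(1)]] by blast
    then show False using free_inner[OF D'(1) c'] by simp
  qed
  then have "Up \<subseteq> {D \<in> \<C>. D \<inter> K \<noteq> {}}" by (auto simp: Up_def)
  then have "finite Up" using locfin[of K] finite_subset by (auto simp: K_def)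
  moreover have "C \<in> Up" using C by (simp add: Up_def)
  ultimately obtain X where X: "X \<in> closed_side ` Up" "\<And>Y. Y \<in> closed_side ` Up \<Longrightarrow> X \<subseteq> Y \<Longrightarrow> X = Y"
    using finite_has_maximal[of "closed_side ` Up"] by blast
  then obtain M where M: "M \<in> Up" "X = closed_side M" by blast
  have "M \<in> maximal"
    unfolding maximal_def
  proof (intro CollectI conjI ballI notI)
    show "M \<in> \<C>" using M by (simp add: Up_def)
    fix D assume D: "D \<in> \<C>" "closed_side M \<subseteq> inner_side D"
    then have sub: "closed_side M \<subseteq> closed_side D" using side_facts(6) by blast
    then have "D \<in> Up" using M D by (auto simp: Up_def)
    then have "closed_side M = closed_side D" using X(2) M sub by blast
    then have "closed_side D \<subseteq> inner_side D" using D by simp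
    then show False using side_facts(5,7)[OF D(1)] line_nonempty[OF D(1)] by blast
  qed
  then show ?thesis using M by (auto simp: Up_def)
qed

lemma maximalD: "M \<in> maximal \<Longrightarrow> M \<in> \<C>"
  by (simp add: maximal_def)

lemma maximal_disjoint:
  assumes "M \<in> maximal" "N \<in> maximal" "M \<noteq> N"
  shows "closed_side M \<inter> closed_side N = {}"
  using sides_nested_or_disjoint[of M N] assms unfolding maximal_def by blast

text \<open>In the one other position of the lines \<open>F ` M\<close> and \<open>N\<close>, the inner sides of \<open>F ` M\<close> and \<open>N\<close> cover the
  plane, which makes the inner side of \<open>N\<close> meet its image.\<close>

lemma maximal_image_position:
  assumes M: "M \<in> maximal" and N: "N \<in> maximal"
  shows "F ` closed_side M \<inter> closed_side N = {} \<or> F ` closed_side M \<subseteq> inner_side N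
     \<or> closed_side N \<subseteq> F ` inner_side M"
proof -
  note MC = maximalD[OF M] and NC = maximalD[OF N]
  have conn: "connected (F ` M)"
    using line(1)[OF MC] cont by (meson connected_continuous_image continuous_on_subset subset_UNIV)
  have ne: "F ` M \<noteq> {}" using line_nonempty[OF MC] by simp
  show ?thesis
  proof (cases rule: two_sides_position[OF two_sides_image[OF homeo sides(1)[OF MC]] conn ne
        sides(1)[OF NC] line(1)[OF NC] line_nonempty[OF NC] free[OF MC NC]])
    case 4
    have False
    proof (cases "M = N")
      case True
      have NF: "N \<subseteq> F ` inner_side N" using 4(2) True by simp
      obtain z where z: "z \<in> N" using line_nonempty[OF NC] by blast
      then have "z \<in> F ` inner_side N" "z \<in> closure (inner_side N)"
        using NF sides(1)[OF NC] by (auto simp: two_sides_def)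
      then have "F ` inner_side N \<inter> inner_side N \<noteq> {}"
        using open_Int_closure_eq_empty[OF open_F[OF side_facts(1)[OF NC]], of "inner_side N"] by (metis IntI emptyE)
      then show False using sides(3)[OF NC] by contradiction
    next
      case False
      have "inner_side N \<inter> closed_side M = {}"
        by (rule disjoint_subsets[OF side_facts(6)[OF NC] order_refl]) (use maximal_disjoint[OF N M] False in simp)
      then have "inner_side N \<subseteq> outer_side M"
        unfolding side_facts(8)[OF MC] by (simp add: disjoint_eq_subset_Compl)
      then have "F ` inner_side N \<subseteq> inner_side N" using 4(1) image_mono by (metis Un_subset_iff order_trans)
      then have "F ` inner_side N = {}" using sides(3)[OF NC] by (metis inf.absorb1)
      then show False using side_facts(2)[OF NC] by simp
    qed
    then show ?thesis ..
  qed (simp_all add: closed_side_def image_Un)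
qed

lemma nested_gap:
  assumes M: "M \<in> \<C>" and N: "N \<in> \<C>" and H: "homeomorphism UNIV UNIV H H'"
    and sub: "H ` closed_side M \<subseteq> inner_side N"
  shows "\<exists>V. open V \<and> V \<noteq> {} \<and> V \<subseteq> inner_side N \<and> V \<inter> H ` inner_side M = {}"
proof -
  note s = two_sides_image[OF H sides(1)[OF M]]
  define V where "V = inner_side N \<inter> H ` outer_side M"
  have "open V" using s side_facts(1)[OF N] by (auto simp: V_def two_sides_def)
  moreover have "V \<noteq> {}"
  proof -
    obtain z where "z \<in> H ` M" using line_nonempty[OF M] by blast
    then have "z \<in> closure (H ` outer_side M)" "z \<in> inner_side N"
      using s sub by (auto simp: two_sides_def closed_side_def)
    then show ?thesis unfolding V_def
      using open_Int_closure_eq_empty[OF side_facts(1)[OF N], of "H ` outer_side M"] by blast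
  qed
  moreover have "V \<inter> H ` inner_side M = {}"
    using two_sides_disjoint(1)[OF s] by (auto simp: V_def)
  ultimately show ?thesis by (intro exI[of _ V]) (auto simp: V_def)
qed

text \<open>Chains of inclusions under \<open>F\<close> end, so there are crosscuts whose image is nested in no inner side.
  Among these, chains under \<open>G\<close> end as well, and a chain under \<open>G\<close> cannot leave this set.\<close>

lemma exists_unnested_maximal:
  obtains M where "M \<in> maximal" "\<And>N. N \<in> maximal \<Longrightarrow> \<not> F ` closed_side M \<subseteq> inner_side N"
    "\<And>N. N \<in> maximal \<Longrightarrow> \<not> closed_side M \<subseteq> F ` inner_side N"
proof -
  have max_ne: "maximal \<noteq> {}" using below_maximal nonempty by blast
  have inner_disj: "inner_side M \<inter> inner_side N = {}" if "M \<in> maximal" "N \<in> maximal" "M \<noteq> N" for M N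
    using maximal_disjoint[OF that] side_facts(6) maximalD that by blast
  \<comment> \<open>The crosscuts at which every chain of inclusions under \<open>F\<close> ends.\<close>
  define T where "T = {M \<in> maximal. \<forall>N\<in>maximal. \<not> F ` closed_side M \<subseteq> inner_side N}"
  have "\<exists>M\<in>maximal. \<forall>N\<in>maximal. \<not> F ` closed_side M \<subseteq> inner_side N"
    by (rule nesting_chain_ends[OF rec max_ne, where inn = inner_side])
      (use side_facts maximalD inner_disj nested_gap[OF _ _ homeo] in auto)
  then have "T \<noteq> {}" by (auto simp: T_def)
  then have "\<exists>M\<in>T. \<forall>N\<in>T. \<not> G ` closed_side M \<subseteq> inner_side N"
    by (intro nesting_chain_ends[OF recurrent_inverse[OF GF rec], where inn = inner_side])
      (use side_facts maximalD inner_disj nested_gap[OF _ _ homeoG] in \<open>auto simp: T_def\<close>)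
  then obtain M where M: "M \<in> T" "\<And>N. N \<in> T \<Longrightarrow> \<not> G ` closed_side M \<subseteq> inner_side N" by blast
  have "\<not> closed_side M \<subseteq> F ` inner_side N" if N: "N \<in> maximal" for N
  proof
    assume sub: "closed_side M \<subseteq> F ` inner_side N"
    have "N \<in> T"
      unfolding T_def
    proof (intro CollectI conjI ballI notI N)
      fix P assume P: "P \<in> maximal" "F ` closed_side N \<subseteq> inner_side P"
      have "F ` inner_side N \<subseteq> inner_side P" using P(2) side_facts(6)[OF maximalD[OF N]] by blast
      then have MP: "closed_side M \<subseteq> inner_side P" using sub by blast
      have "M \<in> \<C>" "P \<in> \<C>" using M P by (auto simp: T_def maximal_def)
      then show False using MP M P by (auto simp: T_def maximal_def)
    qed
    moreover have "G ` closed_side M \<subseteq> inner_side N" using sub by (auto simp: F_image GF)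
    ultimately show False using M by blast
  qed
  then show thesis using M that unfolding T_def by blast
qed

text \<open>A disk that meets a closed side but not its line lies in the inner side, and maximal inner sides are
  disjoint.\<close>

lemma maximal_locally_finite:
  assumes "compact K"
  shows "finite {M \<in> maximal. closed_side M \<inter> K \<noteq> {}}"
proof -
  obtain r where "K \<subseteq> ball 0 r"
    using bounded_subset_ballD[OF compact_imp_bounded[OF assms]] by blast
  then have r: "K \<subseteq> cball 0 r" using ball_subset_cball by blast
  define B where "B = cball (0::complex) r"
  have "finite {M \<in> maximal. closed_side M \<inter> B \<noteq> {}}"
  proof -
    have "finite {M \<in> \<C>. M \<inter> B \<noteq> {}}" using locfin by (simp add: B_def)
    moreover have "{M \<in> maximal. closed_side M \<inter> B \<noteq> {}} \<subseteq> {M \<in> \<C>. M \<inter> B \<noteq> {}} \<union> {M \<in> maximal. B \<noteq> {} \<and> B \<subseteq> inner_side M}"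
    proof
      fix M assume M: "M \<in> {M \<in> maximal. closed_side M \<inter> B \<noteq> {}}"
      then have MC: "M \<in> \<C>" using maximalD by blast
      show "M \<in> {M \<in> \<C>. M \<inter> B \<noteq> {}} \<union> {M \<in> maximal. B \<noteq> {} \<and> B \<subseteq> inner_side M}"
      proof (cases "M \<inter> B = {}")
        case True
        then have "B \<subseteq> inner_side M \<or> B \<subseteq> outer_side M"
          by (intro two_sides_cases[OF sides(1)[OF MC]]) (auto simp: B_def)
        then show ?thesis using M side_facts(8)[OF MC] by blast
      qed (use MC in auto)
    qed
    moreover have "finite {M \<in> maximal. B \<noteq> {} \<and> B \<subseteq> inner_side M}"
    proof (rule ccontr)
      assume inf: "infinite {M \<in> maximal. B \<noteq> {} \<and> B \<subseteq> inner_side M}"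
      then obtain M where M: "M \<in> maximal" "B \<noteq> {}" "B \<subseteq> inner_side M"
        using infinite_imp_nonempty by blast
      have "{M \<in> maximal. B \<noteq> {} \<and> B \<subseteq> inner_side M} \<subseteq> {M}"
      proof
        fix N assume N: "N \<in> {M \<in> maximal. B \<noteq> {} \<and> B \<subseteq> inner_side M}"
        then have "closed_side N \<inter> closed_side M \<noteq> {}"
          using M side_facts(6)[OF maximalD] by blast
        then show "N \<in> {M}" using maximal_disjoint N M by blast
      qed
      then show False using inf finite_subset by blast
    qed
    ultimately show ?thesis by (meson finite_Un finite_subset)
  qed
  then show ?thesis
    by (rule finite_subset[rotated]) (use r in \<open>auto simp: B_def\<close>)
qed

end

section \<open>Arcs that join a crosscut to its image\<close>

lemma arc_endpoint_not_isolated: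
  fixes \<beta> :: "real \<Rightarrow> 'a::real_normed_vector"
  assumes \<beta>: "arc \<beta>" and W: "open W" "W \<inter> path_image \<beta> \<subseteq> {pathstart \<beta>}"
  shows "pathstart \<beta> \<notin> W"
proof
  assume "pathstart \<beta> \<in> W"
  then have 0: "\<beta> 0 \<in> W" by (simp add: pathstart_def)
  have "continuous_on {0..1} \<beta>" using \<beta> by (simp add: arc_def path_def)
  then obtain A where A: "open A" "A \<inter> {0..1} = \<beta> -` W \<inter> {0..1}"
    using W(1) by (metis continuous_on_open_invariant)
  have "0 \<in> \<beta> -` W \<inter> {0..1}" using 0 by simp
  then have "0 \<in> A" using A(2) by (metis IntD1)
  then obtain d where d: "d > 0" "ball 0 d \<subseteq> A" using A(1) open_contains_ball by blast
  define s where "s = min (d/2) 1"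
  have s: "0 < s" "s \<le> 1" "s \<in> ball 0 d" using d by (auto simp: s_def)
  then have "s \<in> A \<inter> {0..1}" using d(2) by auto
  then have "\<beta> s \<in> W" unfolding A(2) by simp
  moreover have "\<beta> s \<in> path_image \<beta>" using s by (auto simp: path_image_def)
  ultimately have "\<beta> s = \<beta> 0" using W(2) by (auto simp: pathstart_def)
  moreover have "inj_on \<beta> {0..1}" using \<beta> by (simp add: arc_def)
  ultimately have "s = 0" using inj_onD[of \<beta> "{0..1}" s 0] s by simp
  then show False using s by simp
qed

text \<open>Choose parameters of points in \<open>A\<close> and \<open>B\<close> at the least possible distance.\<close>

lemma exists_arc_between_closed_sets:
  fixes \<alpha> :: "real \<Rightarrow> 'a::real_normed_vector"
  assumes \<alpha>: "arc \<alpha>" and cl: "closed A" "closed B" "A \<inter> B = {}"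
    and ends: "pathstart \<alpha> \<in> A" "pathfinish \<alpha> \<in> B"
  obtains \<beta> where "arc \<beta>" "path_image \<beta> \<subseteq> path_image \<alpha>"
    "path_image \<beta> \<inter> A = {pathstart \<beta>}" "path_image \<beta> \<inter> B = {pathfinish \<beta>}"
proof -
  have cont: "continuous_on {0..1} \<alpha>" using \<alpha> by (simp add: arc_def path_def)
  define TA where "TA = {0..1} \<inter> \<alpha> -` A"
  define TB where "TB = {0..1} \<inter> \<alpha> -` B"
  have "closed TA" "closed TB"
    unfolding TA_def TB_def using cl by (auto intro: continuous_closed_preimage[OF cont])
  moreover have "bounded TA" "bounded TB"
    unfolding TA_def TB_def by (auto intro: bounded_subset[OF bounded_closed_interval[of 0 "1::real"]])
  ultimately have comp: "compact (TA \<times> TB)"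
    by (intro compact_Times) (auto simp: compact_eq_bounded_closed)
  have "0 \<in> TA" "1 \<in> TB" using ends by (auto simp: TA_def TB_def pathstart_def pathfinish_def)
  then have ne: "TA \<times> TB \<noteq> {}" by blast
  have "continuous_on (TA \<times> TB) (\<lambda>p. dist (fst p) (snd p))"
    by (intro continuous_intros)
  then obtain p where p: "p \<in> TA \<times> TB" "\<And>q. q \<in> TA \<times> TB \<Longrightarrow> dist (fst p) (snd p) \<le> dist (fst q) (snd q)"
    using continuous_attains_inf[OF comp ne] by blast
  obtain u v where uv: "p = (u, v)" by (cases p)
  have u: "u \<in> TA" and v: "v \<in> TB" and min: "\<And>s t. s \<in> TA \<Longrightarrow> t \<in> TB \<Longrightarrow> dist u v \<le> dist s t"
    using p uv by auto
  have uv01: "u \<in> {0..1}" "v \<in> {0..1}" using u v by (auto simp: TA_def TB_def)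
  have "u \<noteq> v" using u v cl(3) by (auto simp: TA_def TB_def)
  define \<beta> where "\<beta> = subpath u v \<alpha>"
  have ends\<beta>: "pathstart \<beta> = \<alpha> u" "pathfinish \<beta> = \<alpha> v" by (simp_all add: \<beta>_def)
  have im: "path_image \<beta> = \<alpha> ` closed_segment u v"
    unfolding \<beta>_def by (rule path_image_subpath_gen)
  have seg: "closed_segment u v \<subseteq> {0..1}" using uv01 by (auto simp: closed_segment_eq_real_ivl)
  have eqA: "t = u" if "t \<in> closed_segment u v" "\<alpha> t \<in> A" for t
  proof -
    have "t \<in> TA" using that seg by (auto simp: TA_def)
    then have "dist u v \<le> dist t v" using min v by blast
    then show ?thesis using that(1) by (auto simp: closed_segment_eq_real_ivl dist_real_def split: if_splits)
  qed
  have eqB: "t = v" if "t \<in> closed_segment u v" "\<alpha> t \<in> B" for t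
  proof -
    have "t \<in> TB" using that seg by (auto simp: TB_def)
    then have "dist u v \<le> dist u t" using min u by blast
    then show ?thesis using that(1) by (auto simp: closed_segment_eq_real_ivl dist_real_def split: if_splits)
  qed
  show thesis
  proof
    show "arc \<beta>" unfolding \<beta>_def using \<alpha> uv01 \<open>u \<noteq> v\<close> by (intro arc_subpath_arc) auto
    have "\<alpha> ` closed_segment u v \<subseteq> \<alpha> ` {0..1}" using seg by (rule image_mono)
    then show "path_image \<beta> \<subseteq> path_image \<alpha>" unfolding im by (simp add: path_image_def)
    show "path_image \<beta> \<inter> A = {pathstart \<beta>}" using eqA u by (auto simp: im ends\<beta> TA_def)
    show "path_image \<beta> \<inter> B = {pathfinish \<beta>}" using eqB v by (auto simp: im ends\<beta> TB_def)
  qed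
qed

context crosscut_family
begin

text \<open>The arc leaves an unnested maximal crosscut and avoids all closed sides, and images of closed sides,
  that are disjoint from that of \<open>M\<close> and from its image. These sets, together with the two closed
  sides between which the arc runs, contain all crosscuts and their images.\<close>

theorem exists_connecting_arc:
  assumes Z: "finite Z" "\<And>z. z \<in> Z \<Longrightarrow> F z = z"
  obtains C \<gamma> where "C \<in> \<C>" "arc \<gamma>" "pathstart \<gamma> \<in> C" "pathfinish \<gamma> \<in> F ` C" "path_image \<gamma> \<inter> Z = {}"
    "\<And>D. D \<in> \<C> \<Longrightarrow> path_image \<gamma> \<inter> D \<subseteq> {pathstart \<gamma>}"
    "\<And>D. D \<in> \<C> \<Longrightarrow> path_image \<gamma> \<inter> F ` D \<subseteq> {pathfinish \<gamma>}"
proof -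
  obtain M where M: "M \<in> maximal" and out: "\<And>N. N \<in> maximal \<Longrightarrow> \<not> F ` closed_side M \<subseteq> inner_side N"
    "\<And>N. N \<in> maximal \<Longrightarrow> \<not> closed_side M \<subseteq> F ` inner_side N"
    using exists_unnested_maximal by blast
  note MC = maximalD[OF M]
  define X where "X = closed_side M"
  have FX_closed: "closed (F ` X)" "closed X"
    using closed_F side_facts(3)[OF MC] by (auto simp: X_def)
  have XFX: "X \<inter> F ` X = {}"
  proof -
    have "\<not> X \<subseteq> F ` inner_side M" "\<not> F ` X \<subseteq> inner_side M" using out M by (auto simp: X_def)
    then show ?thesis using maximal_image_position[OF M M] by (auto simp: X_def)
  qed
  define \<Y> where "\<Y> = {Y \<in> closed_side ` maximal \<union> (\<lambda>N. F ` closed_side N) ` maximal. Y \<inter> (X \<union> F ` X) = {}}"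
  have cover: "D \<subseteq> X \<union> F ` inner_side M \<union> \<Union>\<Y>" if D: "D \<in> \<C>" for D
  proof -
    obtain N where N: "N \<in> maximal" "closed_side D \<subseteq> closed_side N" using below_maximal[OF D] by blast
    then have DN: "D \<subseteq> closed_side N" using side_facts(5)[OF D] by blast
    show ?thesis
    proof (cases "N = M")
      case False
      then have 1: "closed_side N \<inter> X = {}" using maximal_disjoint[OF N(1) M] by (simp add: X_def)
      consider "closed_side N \<inter> F ` X = {}" | "closed_side N \<subseteq> F ` inner_side M"
        using maximal_image_position[OF M N(1)] out(1)[OF N(1)] by (auto simp: X_def)
      then show ?thesis
      proof cases
        case 1
        then have "closed_side N \<in> \<Y>" using \<open>closed_side N \<inter> X = {}\<close> N by (auto simp: \<Y>_def)
        then show ?thesis using DN by blast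
      qed (use DN in blast)
    qed (use DN in \<open>auto simp: X_def\<close>)
  qed
  have coverF: "F ` D \<subseteq> F ` X \<union> inner_side M \<union> \<Union>\<Y>" if D: "D \<in> \<C>" for D
  proof -
    obtain N where N: "N \<in> maximal" "closed_side D \<subseteq> closed_side N" using below_maximal[OF D] by blast
    then have DN: "F ` D \<subseteq> F ` closed_side N" using side_facts(5)[OF D] by blast
    show ?thesis
    proof (cases "N = M")
      case False
      then have "closed_side N \<inter> X = {}" using maximal_disjoint[OF N(1) M] by (simp add: X_def)
      then have 1: "F ` closed_side N \<inter> F ` X = {}" using bijF by (metis bij_def image_Int image_empty)
      consider "F ` closed_side N \<inter> X = {}" | "F ` closed_side N \<subseteq> inner_side M"
        using maximal_image_position[OF N(1) M] out(2)[OF N(1)] by (auto simp: X_def)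
      then show ?thesis
      proof cases
        case c: 1
        have "F ` closed_side N \<in> \<Y>" unfolding \<Y>_def using 1 c N(1) by blast
        then show ?thesis using DN by blast
      qed (use DN in blast)
    qed (use DN in \<open>auto simp: X_def\<close>)
  qed
  have Ycases: "\<exists>N\<in>maximal. Y = closed_side N \<or> Y = F ` closed_side N" if "Y \<in> \<Y>" for Y
    using that by (auto simp: \<Y>_def)
  have "\<exists>x. x \<in> M" using line_nonempty[OF MC] by blast
  then obtain x where x: "x \<in> M" by blast
  define y where "y = F x"
  have xX: "x \<in> X" "y \<in> F ` X" using x side_facts(5)[OF MC] by (auto simp: X_def y_def)
  have YX: "Y \<inter> X = {}" "Y \<inter> F ` X = {}" if "Y \<in> \<Y>" for Y using that by (auto simp: \<Y>_def)
  have xyY: "x \<notin> \<Union>\<Y>" "y \<notin> \<Union>\<Y>" using xX YX by blast+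
  have conF: "connected (F ` W)" if "connected W" for W
    using that cont(1) by (meson connected_continuous_image continuous_on_subset subset_UNIV)
  have injF: "F ` V \<subseteq> F ` W \<longleftrightarrow> V \<subseteq> W" "F ` V \<inter> F ` W = F ` (V \<inter> W)" for V W
    using bijF by (auto simp: bij_def inj_image_subset_iff image_Int)
  have cloY: "closed Y" if "Y \<in> \<Y>" for Y
    using Ycases[OF that] side_facts(3) closed_F maximalD by blast
  have finY: "finite {Y \<in> \<Y>. Y \<inter> K \<noteq> {}}" if K: "compact K" for K
  proof -
    have GK: "compact (G ` K)" using K cont(2) by (meson compact_continuous_image continuous_on_subset subset_UNIV)
    have meet: "F ` W \<inter> K \<noteq> {} \<longleftrightarrow> W \<inter> G ` K \<noteq> {}" for W
      by (auto simp: disjoint_iff image_iff) (metis GF FG)+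
    have "{Y \<in> \<Y>. Y \<inter> K \<noteq> {}} \<subseteq> closed_side ` {N \<in> maximal. closed_side N \<inter> K \<noteq> {}} \<union>
        (\<lambda>N. F ` closed_side N) ` {N \<in> maximal. closed_side N \<inter> G ` K \<noteq> {}}"
    proof
      fix Y assume "Y \<in> {Y \<in> \<Y>. Y \<inter> K \<noteq> {}}"
      then have Y: "Y \<in> \<Y>" "Y \<inter> K \<noteq> {}" by auto
      then obtain N where N: "N \<in> maximal" "Y = closed_side N \<or> Y = F ` closed_side N" using Ycases by blast
      from N(2) show "Y \<in> closed_side ` {N \<in> maximal. closed_side N \<inter> K \<noteq> {}} \<union>
        (\<lambda>N. F ` closed_side N) ` {N \<in> maximal. closed_side N \<inter> G ` K \<noteq> {}}"
      proof
        assume e: "Y = closed_side N"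
        then have "N \<in> {N \<in> maximal. closed_side N \<inter> K \<noteq> {}}" using Y(2) N(1) by simp
        then show ?thesis using e by blast
      next
        assume e: "Y = F ` closed_side N"
        then have "N \<in> {N \<in> maximal. closed_side N \<inter> G ` K \<noteq> {}}" using Y(2) N(1) meet by simp
        then show ?thesis using e by blast
      qed
    qed
    moreover have "finite (closed_side ` {N \<in> maximal. closed_side N \<inter> K \<noteq> {}} \<union>
        (\<lambda>N. F ` closed_side N) ` {N \<in> maximal. closed_side N \<inter> G ` K \<noteq> {}})"
      using maximal_locally_finite[OF K] maximal_locally_finite[OF GK] by blast
    ultimately show ?thesis by (rule finite_subset)
  qed
  have cc: "connected_component (- \<Union>\<Y>) x y"
  proof (rule nonseparating_locally_finite_Union)
    fix Y assume Y: "Y \<in> \<Y>"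
    obtain N where N: "N \<in> maximal" "Y = closed_side N \<or> Y = F ` closed_side N" using Ycases[OF Y] by blast
    note NC = maximalD[OF N(1)]
    show "connected Y" using N side_facts(4)[OF NC] conF by blast
    show "\<not> bounded Y"
    proof
      assume b: "bounded Y"
      have "bounded (G ` Y)"
        using b cont(2) by (metis bounded_subset closure_subset compact_closure compact_continuous_image
            compact_imp_bounded continuous_on_subset image_mono subset_UNIV)
      moreover have "G ` F ` closed_side N = closed_side N" by (force simp: GF)
      ultimately show False using N b side_facts(10)[OF NC] by auto
    qed
    have "- closed_side N = outer_side N" using side_facts(8)[OF NC] by blast
    moreover have "- F ` closed_side N = F ` (- closed_side N)" using bijF by (simp add: bij_image_Compl_eq)
    ultimately show "connected (- Y)" using N(2) side_facts(9)[OF NC] conF by metis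
    fix Y' assume Y': "Y' \<in> \<Y>"
    obtain N' where N': "N' \<in> maximal" "Y' = closed_side N' \<or> Y' = F ` closed_side N'" using Ycases[OF Y'] by blast
    have inn: "inner_side N \<subseteq> closed_side N" "inner_side N' \<subseteq> closed_side N'" 
      using side_facts(6) NC maximalD[OF N'(1)] by blast+
    have dd: "closed_side N \<inter> closed_side N' = {} \<or> N = N'" using maximal_disjoint N N' by blast
    have m1: "F ` closed_side N \<inter> closed_side N' = {} \<or> F ` closed_side N \<subseteq> closed_side N'
        \<or> closed_side N' \<subseteq> F ` closed_side N"
      using maximal_image_position[OF N(1) N'(1)] inn by blast
    have m2: "F ` closed_side N' \<inter> closed_side N = {} \<or> F ` closed_side N' \<subseteq> closed_side N
        \<or> closed_side N \<subseteq> F ` closed_side N'"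
      using maximal_image_position[OF N'(1) N(1)] inn by blast
    have d2: "F ` closed_side N \<inter> F ` closed_side N' = {} \<or> N = N'" using dd injF(2) by auto
    show "Y \<inter> Y' = {} \<or> Y \<subseteq> Y' \<or> Y' \<subseteq> Y"
      using N(2) N'(2) dd m1 m2 d2 by (elim disjE) (simp_all add: Int_commute)
  qed (use cloY finY xyY in auto)
  define Q where "Q = connected_component_set (- \<Union>\<Y>) x"
  have cloU: "closed (\<Union>\<Y>)" using cloY finY by (rule closed_Union_locally_finite)
  have xyQ: "x \<in> Q" "y \<in> Q" using cc xyY by (auto simp: Q_def connected_component_refl_eq)
  have "open Q" "connected Q"
    using cloU by (auto simp: Q_def open_connected_component open_Compl)
  then have "connected (Q - Z)"
    by (rule connected_open_delete_finite) (use Z(1) in auto)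
  moreover have "open (Q - Z)" using \<open>open Q\<close> finite_imp_closed[OF Z(1)] by (rule open_Diff)
  ultimately have pc: "path_connected (Q - Z)" by (simp add: connected_open_path_connected)
  have MF: "F ` M \<inter> M = {}" using free[OF MC MC] .
  then have "x \<noteq> y" "x \<notin> Z" "y \<notin> Z"
    using x Z(2) bijF unfolding y_def by (metis IntI emptyE imageI, metis IntI emptyE imageI, metis GF IntI emptyE imageI)
  then obtain \<alpha> where \<alpha>: "arc \<alpha>" "path_image \<alpha> \<subseteq> Q - Z" "pathstart \<alpha> = x" "pathfinish \<alpha> = y"
    using pc xyQ unfolding path_connected_arcwise by blast
  obtain \<beta> where \<beta>: "arc \<beta>" "path_image \<beta> \<subseteq> path_image \<alpha>"
    "path_image \<beta> \<inter> X = {pathstart \<beta>}" "path_image \<beta> \<inter> F ` X = {pathfinish \<beta>}"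
    by (rule exists_arc_between_closed_sets[OF \<alpha>(1) FX_closed(2,1) XFX])
      (use \<alpha> xX in auto)
  have "Q \<subseteq> - \<Union>\<Y>" by (simp add: Q_def connected_component_subset)
  then have \<beta>Y: "path_image \<beta> \<inter> \<Union>\<Y> = {}" "path_image \<beta> \<inter> Z = {}" using \<alpha>(2) \<beta>(2) by blast+
  have innM: "inner_side M \<subseteq> X" "X = inner_side M \<union> M" by (auto simp: X_def closed_side_def)
  have "pathstart \<beta> \<notin> inner_side M"
    by (rule arc_endpoint_not_isolated[OF \<beta>(1) side_facts(1)[OF MC]]) (use \<beta>(3) innM in blast)
  then have start: "pathstart \<beta> \<in> M" using \<beta>(3) innM by blast
  have "pathstart (reversepath \<beta>) \<notin> F ` inner_side M"
    by (rule arc_endpoint_not_isolated[OF arc_reversepath[OF \<beta>(1)] open_F[OF side_facts(1)[OF MC]]])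
      (use \<beta>(4) innM in auto)
  then have finish: "pathfinish \<beta> \<in> F ` M" using \<beta>(4) innM by auto
  show thesis
  proof
    show "M \<in> \<C>" "arc \<beta>" "pathstart \<beta> \<in> M" "pathfinish \<beta> \<in> F ` M" "path_image \<beta> \<inter> Z = {}"
      using MC \<beta> start finish \<beta>Y by auto
    fix D assume D: "D \<in> \<C>"
    have "F ` M \<inter> D = {}" "F ` D \<inter> M = {}" using free MC D by auto
    show "path_image \<beta> \<inter> D \<subseteq> {pathstart \<beta>}"
    proof
      fix z assume z: "z \<in> path_image \<beta> \<inter> D"
      then have "z \<in> X \<or> z \<in> F ` X" using cover[OF D] \<beta>Y innM by blast
      moreover have "z \<notin> F ` X"
      proof
        assume "z \<in> F ` X"
        then have "z = pathfinish \<beta>" using z \<beta>(4) by (metis IntD1 IntI singletonD)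
        then show False using finish z \<open>F ` M \<inter> D = {}\<close> by (metis IntD2 IntI emptyE)
      qed
      ultimately show "z \<in> {pathstart \<beta>}" using z \<beta>(3) by blast
    qed
    show "path_image \<beta> \<inter> F ` D \<subseteq> {pathfinish \<beta>}"
    proof
      fix z assume z: "z \<in> path_image \<beta> \<inter> F ` D"
      then have "z \<in> X \<or> z \<in> F ` X" using coverF[OF D] \<beta>Y innM by blast
      moreover have "z \<notin> X"
      proof
        assume "z \<in> X"
        then have "z = pathstart \<beta>" using z \<beta>(3) by (metis IntD1 IntI singletonD)
        then show False using start z \<open>F ` D \<inter> M = {}\<close> by (metis IntD2 IntI emptyE)
      qed
      ultimately show "z \<in> {pathfinish \<beta>}" using z \<beta>(4) by blast
    qed
  qed
qed

end

section \<open>Winding numbers and orientation\<close>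

lemma integer_valued_constant:
  fixes f :: "'a::topological_space \<Rightarrow> complex"
  assumes "connected S" "continuous_on S f" "\<And>z. z \<in> S \<Longrightarrow> f z \<in> \<int>" "S \<noteq> {}"
  obtains c where "c \<in> \<int>" "\<And>z. z \<in> S \<Longrightarrow> f z = c"
proof -
  have "f constant_on S"
  proof (rule continuous_discrete_range_constant[OF assms(1,2)])
    fix x assume x: "x \<in> S"
    have "1 \<le> norm (f y - f x)" if "y \<in> S" "f y \<noteq> f x" for y
    proof -
      have "f y - f x \<in> \<int>" using assms(3) x that(1) by (intro Ints_diff) auto
      then obtain n where n: "f y - f x = of_int n" by (elim Ints_cases) simp
      with that(2) have "n \<noteq> 0" by auto
      then show ?thesis by (simp add: n)
    qed
    then show "\<exists>e>0. \<forall>y. y \<in> S \<and> f y \<noteq> f x \<longrightarrow> e \<le> norm (f y - f x)"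
      by (intro exI[of _ 1]) auto
  qed
  then obtain c where c: "\<And>z. z \<in> S \<Longrightarrow> f z = c" by (auto simp: constant_on_def)
  moreover have "c \<in> \<int>" using c assms(3,4) by blast
  ultimately show thesis using that by blast
qed

lemma exp_2pi_eq_1_imp_Ints:
  assumes "exp (2 * of_real pi * \<i> * k) = 1"
  shows "k \<in> \<int>"
proof -
  obtain n :: int where "Re (2 * of_real pi * \<i> * k) = 0" "Im (2 * of_real pi * \<i> * k) = of_int (2 * n) * pi"
    using assms by (auto simp: exp_eq_1)
  then have "k = of_int n" by (auto simp: complex_eq_iff)
  then show ?thesis by simp
qed

lemma integer_valued_closure:
  fixes f :: "'a::metric_space \<Rightarrow> complex"
  assumes "continuous_on S f" "N \<subseteq> S" "S \<subseteq> closure N" "\<And>z. z \<in> N \<Longrightarrow> f z \<in> \<int>" "z \<in> S"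
  shows "f z \<in> \<int>"
proof -
  obtain x where x: "\<And>n. x n \<in> N" "x \<longlonglongrightarrow> z"
    using assms(3,5) closure_sequential[of z N] by blast
  then have "(\<lambda>n. f (x n)) \<longlonglongrightarrow> f z"
    using assms(1,2,5) by (intro continuous_on_tendsto_compose[OF assms(1)]) (auto intro!: always_eventually)
  moreover have "closed (\<int> :: complex set)" by (rule closed_Ints)
  ultimately show ?thesis using x(1) assms(4) by (meson closed_sequentially)
qed

text \<open>Every point of the curve is a limit of points inside it.\<close>

lemma interior_simple_closed_curve:
  fixes g :: "real \<Rightarrow> complex"
  assumes "simple_path g" "pathfinish g = pathstart g"
  shows "interior (path_image g) = {}"
proof -
  have J: "inside (path_image g) \<inter> path_image g = {}" "path_image g \<subseteq> closure (inside (path_image g))"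
    using Jordan_inside_outside[OF assms] by (auto simp: inside_no_overlap frontier_def)
  have "interior (path_image g) \<inter> inside (path_image g) = {}"
    using J(1) interior_subset by blast
  then have "interior (path_image g) \<inter> closure (inside (path_image g)) = {}"
    by (simp add: open_Int_closure_eq_empty)
  then show ?thesis using J(2) interior_subset by blast
qed

text \<open>While \<open>z\<close> runs once around \<open>w\<close>, the quotient \<open>(F z - F w) / (z - w)\<close> of a plane homeomorphism turns
  around \<open>0\<close> not at all if \<open>F\<close> preserves the orientation and twice if \<open>F\<close> reverses it.\<close>

definition orientation_log :: "(complex \<Rightarrow> complex) \<Rightarrow> bool" where
  "orientation_log F \<longleftrightarrow> (\<forall>w. \<exists>L. continuous_on (-{w}) L \<and> (\<forall>z. z \<noteq> w \<longrightarrow> F z - F w = (z - w) * exp (L z)))"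

text \<open>The two winding numbers are logarithms of quotients of end point differences, which are related by
  the difference quotients of \<open>F\<close> at the two ends. The complement of an arc is connected, so the
  integer ambiguity is a constant.\<close>

lemma winding_number_image_arc:
  assumes F: "homeomorphism UNIV UNIV F G" and ori: "orientation_log F" and p: "arc p"
  obtains \<mu> where "continuous_on (- {pathstart p, pathfinish p}) \<mu>"
    "\<And>z. z \<notin> path_image p \<Longrightarrow> winding_number (F \<circ> p) (F z) = winding_number p z + \<mu> z"
proof -
  have contF: "continuous_on UNIV F" using F by (simp add: homeomorphism_def)
  have injF: "F z = F w \<longleftrightarrow> z = w" for z w using F unfolding homeomorphism_def by (metis UNIV_I)
  let ?a = "pathstart p" and ?b = "pathfinish p"
  have path: "path p" "path (F \<circ> p)"
    using p contF arc_imp_path by (auto intro!: path_continuous_image intro: continuous_on_subset)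
  have notin: "F z \<notin> path_image (F \<circ> p)" if "z \<notin> path_image p" for z
    using that injF by (auto simp: path_image_compose)
  obtain La where La: "continuous_on (-{?a}) La" "\<And>z. z \<noteq> ?a \<Longrightarrow> F z - F ?a = (z - ?a) * exp (La z)"
    using ori unfolding orientation_log_def by metis
  obtain Lb where Lb: "continuous_on (-{?b}) Lb" "\<And>z. z \<noteq> ?b \<Longrightarrow> F z - F ?b = (z - ?b) * exp (Lb z)"
    using ori unfolding orientation_log_def by metis
  define l where "l z = (Lb z - La z) / (2 * of_real pi * \<i>)" for z
  have contl: "continuous_on (- {?a, ?b}) l"
    unfolding l_def by (intro continuous_intros continuous_on_subset[OF La(1)] continuous_on_subset[OF Lb(1)]) auto
  define d where "d z = winding_number (F \<circ> p) (F z) - winding_number p z - l z" for z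
  have "continuous_on (- path_image p) d"
    unfolding d_def
  proof (intro continuous_intros)
    show "continuous_on (- path_image p) (\<lambda>z. winding_number (F \<circ> p) (F z))"
      by (rule continuous_on_compose2[OF continuous_on_winding_number[OF path(2)] continuous_on_subset[OF contF]])
        (use notin in auto)
    show "continuous_on (- path_image p) (winding_number p)"
      by (rule continuous_on_winding_number[OF path(1)])
    show "continuous_on (- path_image p) l"
      by (rule continuous_on_subset[OF contl]) auto
  qed
  moreover have "connected (- path_image p)"
    using p by (intro connected_arc_complement) auto
  moreover have "d z \<in> \<int>" if z: "z \<in> - path_image p" for z
  proof (rule exp_2pi_eq_1_imp_Ints)
    have z': "z \<noteq> ?a" "z \<noteq> ?b" using z by auto
    let ?e = "\<lambda>k. exp (2 * of_real pi * \<i> * k)"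
    have 1: "F ?b - F z = ?e (winding_number (F \<circ> p) (F z)) * (F ?a - F z)"
      using winding_number_exp_2pi[OF path(2) notin] z by (simp add: pathfinish_compose pathstart_compose)
    have 2: "?b - z = ?e (winding_number p z) * (?a - z)"
      using winding_number_exp_2pi[OF path(1)] z by simp
    have 3: "?e (l z) = exp (Lb z) / exp (La z)"
      by (simp add: l_def exp_diff)
    have a: "F ?a - F z = (?a - z) * exp (La z)" "F ?b - F z = (?b - z) * exp (Lb z)"
      using La(2)[of z] Lb(2)[of z] z' by (simp_all add: algebra_simps)
    have ne: "?a - z \<noteq> 0" "?e (winding_number p z) \<noteq> 0" using z' by auto
    have "?e (winding_number p z) * (?a - z) * exp (Lb z) = ?e (winding_number (F \<circ> p) (F z)) * ((?a - z) * exp (La z))"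
      using 1 2 a by simp
    then have 4: "?e (winding_number p z) * exp (Lb z) = ?e (winding_number (F \<circ> p) (F z)) * exp (La z)"
      using ne(1) by (simp add: mult.commute mult.left_commute)
    have gen: "X / Y / (b / a) = 1" if "Y * b = X * a" "Y \<noteq> 0" "a \<noteq> 0" "b \<noteq> 0" for X Y a b :: complex
      using that by (cases "X = 0") (simp_all add: field_simps)
    have "?e (d z) = ?e (winding_number (F \<circ> p) (F z)) / ?e (winding_number p z) / ?e (l z)"
      by (simp add: d_def right_diff_distrib exp_diff)
    also have "\<dots> = 1"
      unfolding 3 by (rule gen[OF 4 ne(2)]) auto
    finally show "?e (d z) = 1" .
  qed
  moreover have "- path_image p \<noteq> {}"
    using p bounded_arc_image[of p] by (metis bounded_arc_image boundedI compl_bot_eq double_compl not_bounded_UNIV)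
  ultimately obtain c where c: "\<And>z. z \<in> - path_image p \<Longrightarrow> d z = c"
    using integer_valued_constant by metis
  show thesis
  proof
    show "continuous_on (- {?a, ?b}) (\<lambda>z. l z + c)" by (intro continuous_intros contl)
    show "winding_number (F \<circ> p) (F z) = winding_number p z + (l z + c)" if "z \<notin> path_image p" for z
      using c[of z] that by (simp add: d_def algebra_simps)
  qed
qed

lemma continuous_on_funpow:
  fixes F :: "'a::topological_space \<Rightarrow> 'a"
  assumes "continuous_on UNIV F"
  shows "continuous_on UNIV (F ^^ n)"
proof (induction n)
  case (Suc n)
  then have "continuous_on UNIV (\<lambda>z. F ((F ^^ n) z))"
    by (rule continuous_on_compose2[OF assms]) auto
  then show ?case by (simp add: o_def)
qed (simp add: id_def)

text \<open>Finitely many preimages of a nowhere dense closed set do not cover an open set.\<close>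

lemma orbit_avoiding_nowhere_dense:
  fixes F :: "'a::topological_space \<Rightarrow> 'a"
  assumes F: "homeomorphism UNIV UNIV F G" and E: "closed E" "interior E = {}" and V: "open V" "V \<noteq> {}"
  shows "open {z \<in> V. \<forall>j\<le>n. (F ^^ j) z \<notin> E} \<and> {z \<in> V. \<forall>j\<le>n. (F ^^ j) z \<notin> E} \<noteq> {}"
proof -
  have FG: "F (G z) = z" for z using F by (auto simp: homeomorphism_def)
  have contF: "continuous_on UNIV F" and contG: "continuous_on UNIV G" using F by (auto simp: homeomorphism_def)
  have cF: "continuous_on UNIV (F ^^ j)" and cG: "continuous_on UNIV (G ^^ j)" for j
    by (rule continuous_on_funpow[OF contF], rule continuous_on_funpow[OF contG])
  have FGj: "(F ^^ j) ((G ^^ j) z) = z" for j z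
    by (induction j arbitrary: z) (simp_all add: FG funpow_swap1)
  have GFj: "(G ^^ j) ((F ^^ j) z) = z" for j z
    using F by (induction j arbitrary: z) (simp_all add: homeomorphism_def funpow_swap1)
  have step: "open {z \<in> W. (F ^^ j) z \<notin> E} \<and> {z \<in> W. (F ^^ j) z \<notin> E} \<noteq> {}"
    if W: "open W" "W \<noteq> {}" for W j
  proof
    have "{z \<in> W. (F ^^ j) z \<notin> E} = W \<inter> (F ^^ j) -` (- E)" by auto
    then show "open {z \<in> W. (F ^^ j) z \<notin> E}"
      using W E(1) cF by (simp add: open_Int open_vimage open_Compl)
    have "(F ^^ j) ` W = (G ^^ j) -` W"
      using FGj GFj by (auto simp: image_iff) metis
    then have "open ((F ^^ j) ` W)" using cG W by (simp add: open_vimage)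
    moreover have "(F ^^ j) ` W \<noteq> {}" using W by simp
    ultimately have "\<not> (F ^^ j) ` W \<subseteq> E" using E(2) interior_maximal by blast
    then show "{z \<in> W. (F ^^ j) z \<notin> E} \<noteq> {}" by blast
  qed
  show ?thesis
  proof (induction n)
    case 0 then show ?case using step[OF V, of 0] by simp
  next
    case (Suc n)
    have eq: "{z \<in> V. \<forall>j\<le>Suc n. (F ^^ j) z \<notin> E} = {z \<in> {z \<in> V. \<forall>j\<le>n. (F ^^ j) z \<notin> E}. (F ^^ Suc n) z \<notin> E}"
      by (auto simp: le_Suc_eq)
    show ?case unfolding eq by (rule step[OF conjunct1[OF Suc] conjunct2[OF Suc]])
  qed
qed

text \<open>An orbit from \<open>V\<close> back to \<open>V\<close> gains height at its last step, although the height is constant on \<open>V\<close>.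
  As the height is only controlled off \<open>E\<close>, the orbit has to be chosen off \<open>E\<close>.\<close>

lemma no_height_function:
  fixes F :: "complex \<Rightarrow> complex"
  assumes F: "homeomorphism UNIV UNIV F G" and U: "F ` U = U"
    and rec: "\<And>V. open V \<Longrightarrow> V \<subseteq> U \<Longrightarrow> V \<noteq> {} \<Longrightarrow> \<exists>n\<ge>1. (F ^^ n) ` V \<inter> V \<noteq> {}"
    and E: "closed E" "interior E = {}"
    and V: "open V" "V \<noteq> {}" "V \<subseteq> U - E"
    and h: "\<And>z w. z \<in> V \<Longrightarrow> w \<in> V \<Longrightarrow> h z = h w"
    and mono: "\<And>z. z \<in> U \<Longrightarrow> z \<notin> E \<Longrightarrow> F z \<notin> E \<Longrightarrow> h z \<le> (h (F z) :: real)"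
    and strict: "\<And>z. z \<in> U \<Longrightarrow> z \<notin> E \<Longrightarrow> F z \<in> V \<Longrightarrow> h z < h (F z)"
  shows False
proof -
  obtain n where n: "n \<ge> 1" "(F ^^ n) ` V \<inter> V \<noteq> {}" using rec[OF V(1) _ V(2)] V(3) by blast
  have contF: "continuous_on UNIV F" using F by (simp add: homeomorphism_def)
  have cF: "continuous_on UNIV (F ^^ j)" for j
    by (rule continuous_on_funpow[OF contF])
  define W where "W = V \<inter> (F ^^ n) -` V"
  have "open W" "W \<noteq> {}" using n V cF by (auto simp: W_def open_Int open_vimage)
  then obtain z where z: "z \<in> W" "\<And>j. j \<le> n \<Longrightarrow> (F ^^ j) z \<notin> E"
    using orbit_avoiding_nowhere_dense[OF F E] by blast
  have zV: "z \<in> V" "(F ^^ n) z \<in> V" using z by (auto simp: W_def)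
  have orb: "(F ^^ j) z \<in> U" for j
    by (induction j) (use zV V U in auto)
  have incr: "h z \<le> h ((F ^^ j) z)" if "j \<le> n" for j
    using that
  proof (induction j)
    case (Suc j)
    then have "h ((F ^^ j) z) \<le> h (F ((F ^^ j) z))"
      using z(2)[of j] z(2)[of "Suc j"] orb by (intro mono) auto
    then show ?case using Suc by simp
  qed simp
  obtain m where m: "n = Suc m" using n(1) by (cases n) auto
  have "h ((F ^^ m) z) < h (F ((F ^^ m) z))"
    using zV z(2)[of m] orb m by (intro strict) auto
  then have "h z < h ((F ^^ n) z)" using incr[of m] m by simp
  then show False using h[OF zV] by simp
qed

section \<open>Crossing numbers along a free curve\<close>

text \<open>The two values of \<open>W\<close> are consecutive integers, so \<open>W - n\<close> takes only one sign; and \<open>n\<close> differs from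
  one of the two values.\<close>

lemma winding_sign_choice:
  fixes W :: "complex \<Rightarrow> complex" and n :: int
  assumes IO: "I \<union> E = - P"
    and out: "\<And>y. y \<in> E \<Longrightarrow> W y = 0"
    and inn: "(\<forall>y\<in>I. W y = 1) \<or> (\<forall>y\<in>I. W y = -1)"
  obtains \<epsilon> :: real and R where "R = I \<or> R = E"
    "\<And>y. y \<notin> P \<Longrightarrow> 0 \<le> \<epsilon> * Re (W y - of_int n)" "\<And>y. y \<in> R \<Longrightarrow> 0 < \<epsilon> * Re (W y - of_int n)"
proof -
  have cases: "y \<in> I \<or> y \<in> E" if "y \<notin> P" for y using that IO by blast
  from inn show thesis
  proof
    assume 1: "\<forall>y\<in>I. W y = 1"
    show thesis
    proof (cases "n \<le> 0")
      case True
      then show thesis using 1 out cases by (intro that[of I 1]) force+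
    next
      case False
      then have "1 \<le> real_of_int n" by linarith
      then show thesis using 1 out cases by (intro that[of E "-1"]) force+
    qed
  next
    assume 1: "\<forall>y\<in>I. W y = -1"
    show thesis
    proof (cases "n \<ge> 0")
      case True
      then have "0 \<le> real_of_int n" by linarith
      then show thesis using 1 out cases by (intro that[of I "-1"]) force+
    next
      case False
      then have "real_of_int n \<le> -1" by linarith
      then show thesis using 1 out cases by (intro that[of E 1]) force+
    qed
  qed
qed

text \<open>The winding number of the simple closed curve formed by two pieces of \<open>g\<close> and \<open>F \<circ> g\<close> and the two
  connecting arcs measures the change of an integer-valued height function on \<open>U\<close> along orbits.\<close>

theorem connecting_arcs_impossible:
  fixes g \<gamma>1 \<gamma>2 :: "real \<Rightarrow> complex"
  assumes F: "homeomorphism UNIV UNIV F G" and ori: "orientation_log F"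
    and U: "open U" "contractible U" "F ` U = U"
    and rec: "\<And>V. open V \<Longrightarrow> V \<subseteq> U \<Longrightarrow> V \<noteq> {} \<Longrightarrow> \<exists>n\<ge>1. (F ^^ n) ` V \<inter> V \<noteq> {}"
    and g: "simple_path g" "pathfinish g = pathstart g" "F ` path_image g \<inter> path_image g = {}"
    and s: "s1 \<in> {0..1}" "s2 \<in> {0..1}" "s1' \<in> {0..1}" "s2' \<in> {0..1}" "g s1 \<noteq> g s2" "g s1' \<noteq> g s2'"
    and seg: "g ` closed_segment s1 s1' \<inter> U = {}" "g ` closed_segment s2 s2' \<inter> U = {}"
    and \<gamma>1: "arc \<gamma>1" "pathstart \<gamma>1 = g s1" "pathfinish \<gamma>1 = F (g s1')" "path_image \<gamma>1 \<inter> U = {}"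
      "path_image \<gamma>1 \<inter> path_image g \<subseteq> {g s1}" "path_image \<gamma>1 \<inter> F ` path_image g \<subseteq> {F (g s1')}"
    and \<gamma>2: "arc \<gamma>2" "pathstart \<gamma>2 = g s2" "pathfinish \<gamma>2 = F (g s2')" "path_image \<gamma>2 \<inter> U = {}"
      "path_image \<gamma>2 \<inter> path_image g \<subseteq> {g s2}" "path_image \<gamma>2 \<inter> F ` path_image g \<subseteq> {F (g s2')}"
    and disj: "path_image \<gamma>1 \<inter> path_image \<gamma>2 = {}"
    and t: "t \<in> closed_segment s1 s2" "g t \<in> U"
  shows False
proof -
  define J where "J = path_image g"
  define E where "E = J \<union> F ` J"
  define P where "P = subpath s1 s2 g"
  define P' where "P' = subpath s1' s2' g"
  define S1 where "S1 = subpath s1 s1' g"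
  define S2 where "S2 = subpath s2 s2' g"
  have FG: "F (G z) = z" and GF: "G (F z) = z" for z using F by (auto simp: homeomorphism_def)
  have contF: "continuous_on UNIV F" and contG: "continuous_on UNIV G" using F by (auto simp: homeomorphism_def)
  have injF: "inj F" by (metis GF injI)
  have GU: "G z \<in> U" if "z \<in> U" for z using that U(3) GF by (metis image_iff)
  have FU: "F z \<in> U" if "z \<in> U" for z using that U(3) by blast
  have pg: "path g" using g(1) by (rule simple_path_imp_path)
  have JJ: "F ` J \<inter> J = {}" using g(3) by (simp add: J_def)
  have arcP: "arc P" "arc P'" unfolding P_def P'_def using g(1) s by (auto intro: arc_simple_path_subpath)
  have arcF: "arc (F \<circ> P')"
    unfolding arc_def
  proof
    show "path (F \<circ> P')"
      using arc_imp_path[OF arcP(2)] contF by (auto intro!: path_continuous_image intro: continuous_on_subset)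
    show "inj_on (F \<circ> P') {0..1}"
      using arcP(2) injF by (auto simp: arc_def intro: comp_inj_on inj_on_subset)
  qed
  have imP: "path_image P \<subseteq> J" "path_image P' \<subseteq> J" "path_image S1 \<subseteq> J" "path_image S2 \<subseteq> J"
    unfolding P_def P'_def S1_def S2_def J_def using s by (simp_all add: path_image_subpath_subset)
  have imF: "path_image (F \<circ> P') = F ` path_image P'" by (rule path_image_compose)
  have imFJ: "path_image (F \<circ> P') \<subseteq> F ` J" unfolding imF using imP(2) by (rule image_mono)
  have ends: "pathstart P = g s1" "pathfinish P = g s2" "pathstart P' = g s1'" "pathfinish P' = g s2'"
    "pathstart (F \<circ> P') = F (g s1')" "pathfinish (F \<circ> P') = F (g s2')"
    by (simp_all add: P_def P'_def pathstart_compose pathfinish_compose)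
  have paths: "path P" "path P'" "path (F \<circ> P')" "path \<gamma>1" "path \<gamma>2" "path S1" "path S2"
    using arcP arcF \<gamma>1(1) \<gamma>2(1) pg s by (auto simp: arc_imp_path S1_def S2_def path_subpath)

  define A where "A = P +++ \<gamma>2"
  define B where "B = \<gamma>1 +++ (F \<circ> P')"
  \<comment> \<open>Out along \<open>P\<close> and \<open>\<gamma>2\<close>, back along \<open>F \<circ> P'\<close> and \<open>\<gamma>1\<close>.\<close>
  define \<Gamma> where "\<Gamma> = A +++ reversepath B"
  have imA: "path_image A = path_image P \<union> path_image \<gamma>2"
    unfolding A_def using ends \<gamma>2 by (simp add: path_image_join)
  have imB: "path_image B = path_image \<gamma>1 \<union> path_image (F \<circ> P')"
    unfolding B_def using ends \<gamma>1 by (simp add: path_image_join)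
  have arcA: "arc A"
    unfolding A_def by (rule arc_join) (use arcP \<gamma>2 ends imP J_def in auto)
  have arcB: "arc B"
    unfolding B_def
  proof (rule arc_join[OF \<gamma>1(1) arcF])
    show "pathfinish \<gamma>1 = pathstart (F \<circ> P')" using ends \<gamma>1 by simp
    have "path_image \<gamma>1 \<inter> path_image (F \<circ> P') \<subseteq> path_image \<gamma>1 \<inter> F ` path_image g"
      using imFJ unfolding J_def by (rule Int_mono[OF order_refl])
    then show "path_image \<gamma>1 \<inter> path_image (F \<circ> P') \<subseteq> {pathstart (F \<circ> P')}"
      using \<gamma>1(6) ends(5) by (metis order_trans)
  qed
  have endsAB: "pathstart A = g s1" "pathfinish A = F (g s2')" "pathstart B = g s1" "pathfinish B = F (g s2')"
    by (simp_all add: A_def B_def ends \<gamma>1 \<gamma>2)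
  have meet: "path_image A \<inter> path_image B \<subseteq> {g s1, F (g s2')}"
  proof -
    have "path_image P \<inter> path_image \<gamma>1 \<subseteq> {g s1}" using imP(1) \<gamma>1(5) unfolding J_def by blast
    moreover have "path_image P \<inter> path_image (F \<circ> P') = {}" using imP(1) imFJ JJ by (metis disjoint_iff subsetD)
    moreover have "path_image \<gamma>2 \<inter> path_image (F \<circ> P') \<subseteq> {F (g s2')}"
      using imFJ \<gamma>2(6) unfolding J_def by (meson Int_mono order_refl order_trans)
    ultimately show ?thesis using disj unfolding imA imB by blast
  qed
  have simple: "simple_path \<Gamma>" and loop: "pathfinish \<Gamma> = pathstart \<Gamma>"
  proof -
    show "simple_path \<Gamma>"
      unfolding \<Gamma>_def
    proof (rule simple_path_join_loop[OF arcA arc_reversepath[OF arcB]])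
      show "path_image A \<inter> path_image (reversepath B) \<subseteq> {pathstart A, pathstart (reversepath B)}"
        using meet by (simp add: endsAB)
    qed (simp_all add: endsAB)
    show "pathfinish \<Gamma> = pathstart \<Gamma>" by (simp add: \<Gamma>_def endsAB)
  qed
  have im\<Gamma>: "path_image \<Gamma> = path_image P \<union> path_image \<gamma>2 \<union> path_image \<gamma>1 \<union> path_image (F \<circ> P')"
    unfolding \<Gamma>_def using endsAB by (simp add: path_image_join imA imB Un_assoc)
  have notin: "z \<notin> path_image \<Gamma>" "z \<notin> path_image P" "z \<notin> path_image P'" "z \<notin> path_image \<gamma>2"
    "z \<notin> path_image \<gamma>1" "z \<notin> path_image (F \<circ> P')" "z \<notin> path_image S1" "z \<notin> path_image S2" "z \<notin> J"
    if "z \<in> U" "z \<notin> E" for z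
  proof -
    have E: "z \<notin> J" "z \<notin> F ` J" using that(2) by (simp_all add: E_def)
    show "z \<notin> path_image P" "z \<notin> path_image P'" "z \<notin> path_image (F \<circ> P')" "z \<notin> path_image S1" "z \<notin> path_image S2" "z \<notin> J"
      using imP imFJ E by (meson subsetD)+
    show "z \<notin> path_image \<gamma>1" "z \<notin> path_image \<gamma>2" using that(1) \<gamma>1(4) \<gamma>2(4) by blast+
    then show "z \<notin> path_image \<Gamma>" using \<open>z \<notin> path_image P\<close> \<open>z \<notin> path_image (F \<circ> P')\<close> by (simp add: im\<Gamma>)
  qed
  have W_eq: "winding_number \<Gamma> z = winding_number P z + winding_number \<gamma>2 z - (winding_number \<gamma>1 z + winding_number (F \<circ> P') z)"
    if "z \<in> U" "z \<notin> E" for z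
  proof -
    note n = notin[OF that]
    have a: "winding_number A z = winding_number P z + winding_number \<gamma>2 z"
      unfolding A_def by (rule winding_number_join) (use n paths ends \<gamma>2 in auto)
    have b: "winding_number B z = winding_number \<gamma>1 z + winding_number (F \<circ> P') z"
      unfolding B_def by (rule winding_number_join) (use n paths ends \<gamma>1 in auto)
    have nAB: "z \<notin> path_image A" "z \<notin> path_image B" using n by (simp_all add: imA imB)
    have "winding_number \<Gamma> z = winding_number A z + winding_number (reversepath B) z"
      unfolding \<Gamma>_def by (rule winding_number_join)
        (use nAB arcA arcB endsAB in \<open>auto simp: arc_imp_path\<close>)
    also have "winding_number (reversepath B) z = - winding_number B z"
      by (rule winding_number_reversepath) (use nAB arcB arc_imp_path in auto)
    finally show ?thesis using a b by simp
  qed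
  \<comment> \<open>Off \<open>J\<close>, the arcs \<open>P\<close> and \<open>P'\<close> differ only by \<open>S1\<close> and \<open>S2\<close>, which do not enter \<open>U\<close>.\<close>
  have P_eq: "winding_number P z = winding_number P' z + (winding_number S1 z - winding_number S2 z)" if "z \<notin> J" for z
  proof -
    have z: "z \<notin> path_image g" using that by (simp add: J_def)
    have "winding_number S1 z + winding_number P' z = winding_number (subpath s1 s2' g) z"
      unfolding S1_def P'_def by (rule winding_number_subpath_combine[OF pg z s(1,3,4)])
    moreover have "winding_number P z + winding_number S2 z = winding_number (subpath s1 s2' g) z"
      unfolding S2_def P_def by (rule winding_number_subpath_combine[OF pg z s(1,2,4)])
    ultimately show ?thesis by (simp add: algebra_simps)
  qed
  have SU: "path_image S1 \<inter> U = {}" "path_image S2 \<inter> U = {}"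
    using seg by (simp_all add: S1_def S2_def path_image_subpath_gen)
  have ends_notU: "g s1' \<notin> U" "g s2' \<notin> U" using seg by auto
  obtain \<mu> where \<mu>: "continuous_on (- {g s1', g s2'}) \<mu>"
    "\<And>z. z \<notin> path_image P' \<Longrightarrow> winding_number (F \<circ> P') (F z) = winding_number P' z + \<mu> z"
    using winding_number_image_arc[OF F ori arcP(2)] unfolding ends by metis

  have qc: "continuous_on U (\<lambda>z. (g s2' - z) / (g s1' - z))"
    using ends_notU by (intro continuous_intros) auto
  have qn: "(g s2' - z) / (g s1' - z) \<noteq> 0" if "z \<in> U" for z using that ends_notU by auto
  obtain l where l: "continuous_on U l" "\<And>z. z \<in> U \<Longrightarrow> (g s2' - z) / (g s1' - z) = exp (l z)"
    using continuous_logarithm_on_contractible[OF qc U(2) qn] by blast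
  \<comment> \<open>On \<open>U\<close>, a continuous logarithm of the function of which the winding number of \<open>P'\<close> is a logarithm off \<open>P'\<close>.\<close>
  define lg where "lg z = l z / (2 * of_real pi * \<i>)" for z
  have lg: "continuous_on U lg" unfolding lg_def by (intro continuous_intros l(1)) auto
  \<comment> \<open>The height function on \<open>U\<close>.\<close>
  define k where "k z = winding_number P' z - lg z" for z
  have k_int: "k z \<in> \<int>" if "z \<in> U" "z \<notin> J" for z
  proof (rule exp_2pi_eq_1_imp_Ints)
    have z: "z \<notin> path_image P'" using that imP by blast
    have w: "g s2' - z = exp (2 * of_real pi * \<i> * winding_number P' z) * (g s1' - z)"
      using winding_number_exp_2pi[OF paths(2) z] by (simp add: ends)
    have ne: "g s1' - z \<noteq> 0" using that ends_notU by auto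
    have "exp (2 * of_real pi * \<i> * lg z) = (g s2' - z) / (g s1' - z)"
      using l(2)[OF that(1)] by (simp add: lg_def)
    also have "\<dots> = exp (2 * of_real pi * \<i> * winding_number P' z)"
      unfolding w using ne by simp
    finally show "exp (2 * of_real pi * \<i> * k z) = 1"
      unfolding k_def by (simp add: right_diff_distrib exp_diff)
  qed
  have k_cont: "continuous_on (U - J) k"
    unfolding k_def
    by (intro continuous_intros continuous_on_subset[OF lg] continuous_on_subset[OF continuous_on_winding_number[OF paths(2)]])
      (use imP in auto)
  define \<theta> where "\<theta> z = lg z + (winding_number S1 z - winding_number S2 z) + winding_number \<gamma>2 z - winding_number \<gamma>1 z
      - lg (G z) - \<mu> (G z)" for z
  have \<theta>_cont: "continuous_on U \<theta>"
    unfolding \<theta>_def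
  proof (intro continuous_intros lg)
    show "continuous_on U (winding_number S1)" "continuous_on U (winding_number S2)"
      "continuous_on U (winding_number \<gamma>1)" "continuous_on U (winding_number \<gamma>2)"
      using SU \<gamma>1(4) \<gamma>2(4) paths by (auto intro!: continuous_on_subset[OF continuous_on_winding_number])
    show "continuous_on U (\<lambda>z. lg (G z))"
      by (rule continuous_on_compose2[OF lg continuous_on_subset[OF contG]]) (use GU in auto)
    have Gn: "G z \<in> - {g s1', g s2'}" if "z \<in> U" for z
      using GU[OF that] ends_notU by auto
    show "continuous_on U (\<lambda>z. \<mu> (G z))"
      by (rule continuous_on_compose2[OF \<mu>(1) continuous_on_subset[OF contG]]) (use Gn in auto)
  qed
  \<comment> \<open>Up to the continuous function \<open>\<theta>\<close>, \<open>\<Gamma>\<close> measures the change of height from \<open>G z\<close> to \<open>z\<close>.\<close>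
  have key: "winding_number \<Gamma> z = k z - k (G z) + \<theta> z" if z: "z \<in> U" "z \<notin> E" for z
  proof -
    have GJ: "G z \<notin> J" using z(2) FG by (metis E_def UnI2 imageI)
    then have "G z \<notin> path_image P'" using imP by blast
    then have "winding_number (F \<circ> P') z = winding_number P' (G z) + \<mu> (G z)"
      using \<mu>(2)[of "G z"] by (simp add: FG)
    then show ?thesis
      using W_eq[OF z] P_eq[OF notin(9)[OF z]] by (simp add: k_def \<theta>_def algebra_simps)
  qed

  have Jc: "closed J" using g(1) by (simp add: J_def closed_simple_path_image)
  have FJc: "closed (F ` J)"
  proof -
    have "compact J" using g(1) by (simp add: J_def compact_simple_path_image)
    then show ?thesis using contF by (meson compact_continuous_image compact_imp_closed continuous_on_subset subset_UNIV)
  qed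
  have Ji: "interior J = {}" unfolding J_def using g by (intro interior_simple_closed_curve)
  have FJi: "interior (F ` J) = {}"
  proof -
    define W where "W = F -` interior (F ` J)"
    have "open W" unfolding W_def using contF by (simp add: open_vimage)
    moreover have "W \<subseteq> J"
    proof
      fix z assume "z \<in> W"
      then have "F z \<in> F ` J" using interior_subset unfolding W_def by blast
      then show "z \<in> J" using injF by (simp add: inj_image_mem_iff)
    qed
    ultimately have "W = {}" using Ji interior_maximal by blast
    then show ?thesis unfolding W_def using FG by (metis empty_iff equals0I vimageI)
  qed
  \<comment> \<open>As \<open>E\<close> is nowhere dense, \<open>\<theta>\<close> is an integer on all of the connected set \<open>U\<close>.\<close>
  have Ec: "closed E" and Ei: "interior E = {}"
    using Jc FJc Ji FJi interior_closed_Un_empty_interior[OF Jc FJi] by (auto simp: E_def)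
  have dense: "\<not> V \<subseteq> E" if "open V" "V \<noteq> {}" for V using that Ei interior_maximal by blast
  have WL: "winding_number \<Gamma> z \<in> \<int>" if "z \<notin> path_image \<Gamma>" for z
    using integer_winding_number[OF simple_path_imp_path[OF simple] loop that] .
  have Une: "U \<noteq> {}" using t by auto
  have "\<theta> z \<in> \<int>" if "z \<in> U" for z
  proof (rule integer_valued_closure[OF \<theta>_cont _ _ _ that])
    show "U \<subseteq> closure (U - E)"
    proof
      fix z assume z: "z \<in> U"
      show "z \<in> closure (U - E)"
        unfolding closure_iff_nhds_not_empty
      proof (intro allI impI)
        fix A S assume S: "z \<in> S" "open S" "S \<subseteq> A"
        have "\<not> S \<inter> U \<subseteq> E" using S z U(1) by (intro dense) auto
        then show "(U - E) \<inter> A \<noteq> {}" using S by blast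
      qed
    qed
    fix z assume "z \<in> U - E"
    then have z: "z \<in> U" "z \<notin> E" by auto
    have "G z \<notin> J" using z(2) FG by (metis E_def UnI2 imageI)
    then have "k (G z) \<in> \<int>" "k z \<in> \<int>" using k_int GU z notin(9)[OF z] by auto
    moreover have "\<theta> z = winding_number \<Gamma> z - (k z - k (G z))" using key[OF z] by simp
    ultimately show "\<theta> z \<in> \<int>" using WL[OF notin(1)[OF z]] by simp
  qed auto
  then obtain c where c: "c \<in> \<int>" "\<And>z. z \<in> U \<Longrightarrow> \<theta> z = c"
    using integer_valued_constant[OF contractible_imp_connected[OF U(2)] \<theta>_cont _ Une] by metis
  obtain n where n: "c = of_int n" using c(1) by (auto elim: Ints_cases)
  let ?I = "inside (path_image \<Gamma>)" and ?O = "outside (path_image \<Gamma>)"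
  note jordan = Jordan_inside_outside[OF simple loop]
  have inn: "(\<forall>y\<in>?I. winding_number \<Gamma> y = 1) \<or> (\<forall>y\<in>?I. winding_number \<Gamma> y = -1)"
    using simple_closed_path_winding_number_inside[OF simple] by metis
  obtain \<epsilon> :: real and R where R: "R = ?I \<or> R = ?O"
    "\<And>y. y \<notin> path_image \<Gamma> \<Longrightarrow> 0 \<le> \<epsilon> * Re (winding_number \<Gamma> y - of_int n)"
    "\<And>y. y \<in> R \<Longrightarrow> 0 < \<epsilon> * Re (winding_number \<Gamma> y - of_int n)"
  proof (rule winding_sign_choice[of ?I ?O "path_image \<Gamma>" "winding_number \<Gamma>" n])
    show "?I \<union> ?O = - path_image \<Gamma>" using jordan by simp
    show "winding_number \<Gamma> y = 0" if "y \<in> ?O" for y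
      using winding_number_zero_in_outside[OF simple_path_imp_path[OF simple] loop that] .
  qed (use inn in auto)
  have Ropen: "open R" and Rfr: "frontier R = path_image \<Gamma>" using R(1) jordan by auto
  have "g t \<in> path_image \<Gamma>"
    using t(1) by (auto simp: im\<Gamma> P_def path_image_subpath_gen)
  then have "g t \<in> closure R" using Rfr by (auto simp: frontier_def)
  then have "U \<inter> R \<noteq> {}" using t(2) U(1) open_Int_closure_eq_empty[of U R] by blast
  then have "\<not> U \<inter> R \<subseteq> E" using U(1) Ropen by (intro dense) auto
  then obtain v where v: "v \<in> U \<inter> R - E" by blast
  have "open (U \<inter> R - E)" using U(1) Ropen Ec by auto
  then obtain r where r: "r > 0" "ball v r \<subseteq> U \<inter> R - E" using v open_contains_ball by blast
  define V where "V = ball v r"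
  have VU: "V \<subseteq> U - E" "V \<subseteq> R" using r by (auto simp: V_def)
  have VJ: "V \<subseteq> U - J" using VU by (auto simp: E_def)
  obtain b where b: "\<And>z. z \<in> V \<Longrightarrow> k z = b"
  proof (rule integer_valued_constant[of V k])
    show "continuous_on V k" by (rule continuous_on_subset[OF k_cont VJ])
  qed (use r VJ k_int in \<open>auto simp: V_def\<close>)
  have step: "\<epsilon> * Re (k (F z)) = \<epsilon> * Re (k z) + \<epsilon> * Re (winding_number \<Gamma> (F z) - of_int n)"
    if "z \<in> U" "F z \<notin> E" for z
  proof -
    have eqn: "k (F z) = k z + (winding_number \<Gamma> (F z) - of_int n)"
      using key[OF FU[OF that(1)] that(2)] c(2)[OF FU[OF that(1)]] n by (simp add: GF algebra_simps)
    show ?thesis unfolding eqn by (simp add: distrib_left)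
  qed
  show False
  proof (rule no_height_function[OF F U(3) rec Ec Ei, of V "\<lambda>z. \<epsilon> * Re (k z)"])
    show "open V" "V \<noteq> {}" "V \<subseteq> U - E" using r VU by (auto simp: V_def)
    show "\<epsilon> * Re (k z) = \<epsilon> * Re (k w)" if "z \<in> V" "w \<in> V" for z w using b that by simp
    show "\<epsilon> * Re (k z) \<le> \<epsilon> * Re (k (F z))" if "z \<in> U" "z \<notin> E" "F z \<notin> E" for z
      using step[OF that(1,3)] R(2)[OF notin(1)[OF FU[OF that(1)] that(3)]] by simp
    show "\<epsilon> * Re (k z) < \<epsilon> * Re (k (F z))" if "z \<in> U" "z \<notin> E" "F z \<in> V" for z
    proof -
      have "F z \<notin> E" "F z \<in> R" using that(3) VU by auto
      then show ?thesis using step[OF that(1)] R(3)[of "F z"] by simp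
    qed
  qed auto
qed

section \<open>The degree of maps of the 2-sphere\<close>

definition S2 :: "(complex \<times> real) set" where "S2 = sphere 0 1"

definition to_S2 :: "(nat \<Rightarrow> real) \<Rightarrow> complex \<times> real" where
  "to_S2 x = (Complex (x 0) (x 1), x 2)"

definition of_S2 :: "complex \<times> real \<Rightarrow> nat \<Rightarrow> real" where
  "of_S2 p = (\<lambda>n. if n = 0 then Re (fst p) else if n = 1 then Im (fst p) else if n = 2 then snd p else 0)"

lemma mem_S2: "p \<in> S2 \<longleftrightarrow> (norm (fst p))\<^sup>2 + (snd p)\<^sup>2 = 1"
proof -
  have "norm p = sqrt ((norm (fst p))\<^sup>2 + (snd p)\<^sup>2)"
    by (cases p) (simp add: norm_Pair)
  then show ?thesis by (simp add: S2_def)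
qed

lemma sum_le_2: "(\<Sum>i\<le>(2::nat). f i) = f 0 + f 1 + (f 2 :: real)"
  by (simp add: numeral_2_eq_2)

lemma topspace_nsphere2: "x \<in> topspace (nsphere 2) \<longleftrightarrow> (x 0)\<^sup>2 + (x 1)\<^sup>2 + (x 2)\<^sup>2 = 1 \<and> (\<forall>i>2. x i = 0)"
  by (simp add: nsphere sum_le_2)

lemma to_of_S2: "to_S2 (of_S2 p) = p"
  by (simp add: to_S2_def of_S2_def)

lemma of_to_S2: "x \<in> topspace (nsphere 2) \<Longrightarrow> of_S2 (to_S2 x) = x"
proof (rule ext)
  fix n :: nat assume x: "x \<in> topspace (nsphere 2)"
  consider "n = 0" | "n = 1" | "n = 2" | "n > 2" by linarith
  then show "of_S2 (to_S2 x) n = x n"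
    using x by cases (simp_all add: to_S2_def of_S2_def topspace_nsphere2)
qed

lemma to_S2_in: "x \<in> topspace (nsphere 2) \<Longrightarrow> to_S2 x \<in> S2"
  by (simp add: mem_S2 to_S2_def topspace_nsphere2 cmod_power2)

lemma of_S2_in: "p \<in> S2 \<Longrightarrow> of_S2 p \<in> topspace (nsphere 2)"
  by (simp add: mem_S2 of_S2_def topspace_nsphere2 cmod_power2)

lemma continuous_to_S2: "continuous_map (nsphere 2) (top_of_set S2) to_S2"
proof -
  have "continuous_map (nsphere 2) (prod_topology euclideanreal (prod_topology euclideanreal euclideanreal))
     (\<lambda>x. (x 0, (x 1, x 2)))"
    by (intro continuous_map_pairedI continuous_map_nsphere_projection)
  then have 1: "continuous_map (nsphere 2) euclidean (\<lambda>x. (x 0, (x 1, x 2)))"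
    by simp
  have "continuous_on UNIV (\<lambda>q::real \<times> real \<times> real. (of_real (fst q) + \<i> * of_real (fst (snd q)), snd (snd q)))"
    by (intro continuous_intros)
  then have 2: "continuous_map euclidean euclidean (\<lambda>q::real \<times> real \<times> real. (of_real (fst q) + \<i> * of_real (fst (snd q)), snd (snd q)))"
    by simp
  have "to_S2 = (\<lambda>q. (of_real (fst q) + \<i> * of_real (fst (snd q)), snd (snd q))) \<circ> (\<lambda>x. (x 0, (x 1, x 2)))"
    by (auto simp: to_S2_def fun_eq_iff complex_eq_iff)
  then have "continuous_map (nsphere 2) euclidean to_S2"
    using continuous_map_compose[OF 1 2] by simp
  then show ?thesis by (auto simp: continuous_map_in_subtopology to_S2_in)
qed

lemma continuous_of_S2: "continuous_map (top_of_set S2) (nsphere 2) of_S2"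
proof -
  have "continuous_map (top_of_set S2) euclideanreal (\<lambda>p. of_S2 p n)" for n
  proof -
    have "continuous_on S2 (\<lambda>p. of_S2 p n)"
      unfolding of_S2_def by (cases "n = 0"; cases "n = 1"; cases "n = 2") (auto intro!: continuous_intros)
    then show ?thesis by simp
  qed
  moreover have "of_S2 p \<in> {x. (\<Sum>i\<le>2. x i ^ 2) = 1 \<and> (\<forall>i>2. x i = 0)}" if "p \<in> S2" for p
    using of_S2_in[OF that] by (simp add: nsphere)
  ultimately show ?thesis
    unfolding nsphere by (auto simp: continuous_map_in_subtopology continuous_map_componentwise_UNIV)
qed

definition S2_map :: "(complex \<times> real \<Rightarrow> complex \<times> real) \<Rightarrow> bool" where
  "S2_map h \<longleftrightarrow> continuous_on S2 h \<and> h ` S2 \<subseteq> S2"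

definition sphere_degree :: "(complex \<times> real \<Rightarrow> complex \<times> real) \<Rightarrow> int" where
  "sphere_degree h = Brouwer_degree2 2 (of_S2 \<circ> h \<circ> to_S2)"

lemma S2_map_continuous_map: "S2_map h \<Longrightarrow> continuous_map (nsphere 2) (nsphere 2) (of_S2 \<circ> h \<circ> to_S2)"
  unfolding S2_map_def
  by (intro continuous_map_compose[OF continuous_to_S2] continuous_map_compose[OF _ continuous_of_S2])
    (auto simp: image_subset_iff_funcset)

lemma S2_map_compose: "S2_map h \<Longrightarrow> S2_map k \<Longrightarrow> S2_map (k \<circ> h)"
  unfolding S2_map_def by (auto intro!: continuous_on_compose2[of S2 k S2 h])

lemma sphere_degree_cong: "(\<And>p. p \<in> S2 \<Longrightarrow> h p = k p) \<Longrightarrow> sphere_degree h = sphere_degree k"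
  unfolding sphere_degree_def by (rule Brouwer_degree2_eq) (simp add: to_S2_in)

lemma sphere_degree_id: "sphere_degree (\<lambda>p. p) = 1"
proof -
  have "sphere_degree (\<lambda>p. p) = Brouwer_degree2 2 id"
    unfolding sphere_degree_def by (rule Brouwer_degree2_eq) (simp add: of_to_S2)
  then show ?thesis by simp
qed

lemma sphere_degree_compose:
  assumes "S2_map h" "S2_map k"
  shows "sphere_degree (k \<circ> h) = sphere_degree k * sphere_degree h"
proof -
  have "sphere_degree (k \<circ> h) = Brouwer_degree2 2 ((of_S2 \<circ> k \<circ> to_S2) \<circ> (of_S2 \<circ> h \<circ> to_S2))"
    unfolding sphere_degree_def by (rule Brouwer_degree2_eq) (simp add: to_of_S2)
  also have "\<dots> = sphere_degree k * sphere_degree h"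
    unfolding sphere_degree_def by (intro Brouwer_degree2_compose S2_map_continuous_map assms)
  finally show ?thesis .
qed

lemma sphere_degree_homotopic:
  assumes "continuous_on ({0..1} \<times> S2) H" "H ` ({0..1} \<times> S2) \<subseteq> S2"
  shows "sphere_degree (\<lambda>p. H (0::real, p)) = sphere_degree (\<lambda>p. H (1, p))"
proof -
  have "homotopic_with (\<lambda>x. True) (top_of_set S2) (top_of_set S2) (\<lambda>p. H (0, p)) (\<lambda>p. H (1, p))"
    unfolding homotopic_with_def
  proof (intro exI[of _ H] conjI)
    show "continuous_map (prod_topology (top_of_set {0..1}) (top_of_set S2)) (top_of_set S2) H"
      using assms by (simp add: image_subset_iff_funcset)
  qed auto
  then have "homotopic_with (\<lambda>x. True) (top_of_set S2) (nsphere 2) (of_S2 \<circ> (\<lambda>p. H (0, p))) (of_S2 \<circ> (\<lambda>p. H (1, p)))"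
    by (rule homotopic_with_compose_continuous_map_left[OF _ continuous_of_S2]) simp
  then have "homotopic_with (\<lambda>x. True) (nsphere 2) (nsphere 2) ((of_S2 \<circ> (\<lambda>p. H (0, p))) \<circ> to_S2) ((of_S2 \<circ> (\<lambda>p. H (1, p))) \<circ> to_S2)"
    by (rule homotopic_with_compose_continuous_map_right[OF _ continuous_to_S2]) simp
  then show ?thesis unfolding sphere_degree_def by (rule Brouwer_degree2_homotopic)
qed

definition flip :: "complex \<times> real \<Rightarrow> complex \<times> real" where
  "flip p = (- cnj (fst p), snd p)"

lemma sphere_degree_flip: "sphere_degree flip = -1"
proof -
  have "sphere_degree flip = Brouwer_degree2 2 (\<lambda>x i. if i = 0 then - x i else x i)"
    unfolding sphere_degree_def
  proof (rule Brouwer_degree2_eq)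
    fix x assume x: "x \<in> topspace (nsphere 2)"
    have "(of_S2 \<circ> flip \<circ> to_S2) x i = (if i = 0 then - x i else x i)" for i
    proof -
      have "of_S2 (to_S2 x) i = x i" using of_to_S2[OF x] by simp
      then show ?thesis by (auto simp: of_S2_def to_S2_def flip_def split: if_splits)
    qed
    then show "(of_S2 \<circ> flip \<circ> to_S2) x = (\<lambda>i. if i = 0 then - x i else x i)" by blast
  qed
  then show ?thesis by (simp add: Brouwer_degree2_reflection)
qed

lemma sphere_degree_conjugate:
  assumes "S2_map h" "S2_map Q" "S2_map Q'" "\<And>p. p \<in> S2 \<Longrightarrow> Q (Q' p) = p"
  shows "sphere_degree (Q \<circ> h \<circ> Q') = sphere_degree h"
proof -
  have "sphere_degree (Q \<circ> h \<circ> Q') = sphere_degree Q * sphere_degree h * sphere_degree Q'"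
    using assms by (simp add: sphere_degree_compose S2_map_compose)
  moreover have "sphere_degree Q * sphere_degree Q' = sphere_degree (\<lambda>p. p)"
    using assms by (metis sphere_degree_compose sphere_degree_cong comp_apply)
  ultimately show ?thesis by (simp add: sphere_degree_id mult.commute mult.left_commute)
qed

lemma S2_map_flip: "S2_map flip"
  unfolding S2_map_def flip_def by (auto intro!: continuous_intros simp: mem_S2)

text \<open>The antipodal map is the product of the reflections in the three coordinates, which are conjugate.\<close>

lemma sphere_degree_antipodal: "sphere_degree uminus = -1"
proof -
  \<comment> \<open>\<open>R\<close> and \<open>T\<close> move the first coordinate to the second and to the third place.\<close>
  define R where "R p = (\<i> * fst p, snd p)" for p :: "complex \<times> real"
  define R' where "R' p = (- \<i> * fst p, snd p)" for p :: "complex \<times> real"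
  define T where "T p = (Complex (snd p) (Im (fst p)), Re (fst p))" for p :: "complex \<times> real"
  have T_alt: "T = (\<lambda>p. (of_real (snd p) + \<i> * of_real (Im (fst p)), Re (fst p)))"
    by (auto simp: T_def fun_eq_iff complex_eq_iff)
  have maps: "S2_map R" "S2_map R'" "S2_map T"
    unfolding S2_map_def R_def R'_def T_alt
    by (auto intro!: continuous_intros simp: mem_S2 norm_mult cmod_power2)
  have 1: "sphere_degree (R \<circ> flip \<circ> R') = -1"
    using sphere_degree_conjugate[OF S2_map_flip maps(1,2)] sphere_degree_flip
    by (simp add: R_def R'_def)
  have 2: "sphere_degree (T \<circ> flip \<circ> T) = -1"
    using sphere_degree_conjugate[OF S2_map_flip maps(3,3)] sphere_degree_flip
    by (simp add: T_def)
  have "uminus = flip \<circ> (R \<circ> flip \<circ> R') \<circ> (T \<circ> flip \<circ> T)"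
    by (auto simp: fun_eq_iff flip_def R_def R'_def T_def complex_eq_iff)
  moreover have "S2_map (R \<circ> flip \<circ> R')" "S2_map (T \<circ> flip \<circ> T)"
    by (intro S2_map_compose maps S2_map_flip)+
  ultimately have "sphere_degree uminus = sphere_degree flip * sphere_degree (R \<circ> flip \<circ> R') * sphere_degree (T \<circ> flip \<circ> T)"
    by (metis S2_map_compose S2_map_flip sphere_degree_compose)
  then show ?thesis using 1 2 sphere_degree_flip by simp
qed

text \<open>If \<open>h p\<close> is never \<open>p\<close>, then the segment from \<open>h p\<close> to \<open>-p\<close> avoids the origin, and \<open>h\<close> is homotopic to
  the antipodal map.\<close>

theorem degree_one_fixed_point:
  assumes h: "S2_map h" and deg: "sphere_degree h = 1"
  shows "\<exists>p\<in>S2. h p = p"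
proof (rule ccontr)
  assume "\<not> ?thesis"
  then have nofix: "h p \<noteq> p" if "p \<in> S2" for p using that by blast
  \<comment> \<open>The segment from \<open>h p\<close> to \<open>-p\<close>.\<close>
  define K where "K q = (1 - fst q) *\<^sub>R h (snd q) - fst q *\<^sub>R snd q" for q :: "real \<times> complex \<times> real"
  have K0: "K (t, p) \<noteq> 0" if "t \<in> {0..1}" "p \<in> S2" for t p
  proof
    assume "K (t, p) = 0"
    then have eq: "(1 - t) *\<^sub>R h p = t *\<^sub>R p" by (simp add: K_def)
    have "h p \<in> S2" using h that(2) unfolding S2_map_def by blast
    then have n: "norm (h p) = 1" "norm p = 1" using that(2) by (simp_all add: S2_def)
    have "norm ((1 - t) *\<^sub>R h p) = norm (t *\<^sub>R p)" using eq by simp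
    then have "\<bar>1 - t\<bar> = \<bar>t\<bar>" using n by simp
    then have "t = 1 / 2" using that(1) by auto
    then have "h p = p" using eq unfolding \<open>t = 1 / 2\<close> by simp
    then show False using nofix[OF that(2)] by simp
  qed
  define H where "H q = K q /\<^sub>R norm (K q)" for q
  have hs: "continuous_on S2 h" using h by (simp add: S2_map_def)
  have "continuous_on ({0..1} \<times> S2) K"
    unfolding K_def by (intro continuous_intros continuous_on_compose2[OF hs]) auto
  then have "continuous_on ({0..1} \<times> S2) H"
    unfolding H_def using K0 by (intro continuous_intros) auto
  moreover have "H ` ({0..1} \<times> S2) \<subseteq> S2"
    using K0 by (auto simp: H_def S2_def)
  ultimately have "sphere_degree (\<lambda>p. H (0, p)) = sphere_degree (\<lambda>p. H (1, p))"
    by (rule sphere_degree_homotopic)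
  moreover have "sphere_degree (\<lambda>p. H (0, p)) = sphere_degree h"
  proof (rule sphere_degree_cong)
    fix p assume "p \<in> S2"
    then have "h p \<in> S2" using h unfolding S2_map_def by blast
    then show "H (0, p) = h p" by (simp add: H_def K_def S2_def)
  qed
  moreover have "sphere_degree (\<lambda>p. H (1, p)) = sphere_degree uminus"
    by (intro sphere_degree_cong) (auto simp: H_def K_def S2_def)
  ultimately show False using deg sphere_degree_antipodal by simp
qed

definition north :: "complex \<times> real" where "north = (0, 1)"

definition stereo :: "complex \<times> real \<Rightarrow> complex" where
  "stereo p = fst p / of_real (1 - snd p)"

definition stereo_inv :: "complex \<Rightarrow> complex \<times> real" where
  "stereo_inv z = (2 * z / of_real (1 + (norm z)\<^sup>2), ((norm z)\<^sup>2 - 1) / ((norm z)\<^sup>2 + 1))"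

lemma one_plus_norm: "1 + (norm z)\<^sup>2 > 0" "1 + (norm z)\<^sup>2 \<noteq> 0" "(norm z)\<^sup>2 + 1 \<noteq> 0"
  for z :: complex
proof -
  show "1 + (norm z)\<^sup>2 > 0" by (rule add_pos_nonneg) auto
  then show "1 + (norm z)\<^sup>2 \<noteq> 0" "(norm z)\<^sup>2 + 1 \<noteq> 0" by linarith+
qed

lemma stereo_inv_in: "stereo_inv z \<in> S2"
proof -
  define r where "r = (norm z)\<^sup>2"
  have r: "1 + r \<noteq> 0" using one_plus_norm by (simp add: r_def)
  have "norm (1 + of_real r :: complex) = 1 + r"
    using one_plus_norm[of z] by (metis norm_of_real abs_of_pos of_real_1 of_real_add r_def)
  then have "(norm (fst (stereo_inv z)))\<^sup>2 = 4 * r / (1 + r)\<^sup>2"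
    by (simp add: stereo_inv_def norm_divide norm_mult power_divide power_mult_distrib r_def)
  moreover have "(snd (stereo_inv z))\<^sup>2 = (r - 1)\<^sup>2 / (1 + r)\<^sup>2"
    by (simp add: stereo_inv_def r_def power_divide add.commute)
  moreover have "4 * r / (1 + r)\<^sup>2 + (r - 1)\<^sup>2 / (1 + r)\<^sup>2 = 1"
  proof -
    have "4 * r + (r - 1)\<^sup>2 = (1 + r)\<^sup>2" by (simp add: power2_eq_square algebra_simps)
    then have "4 * r / (1 + r)\<^sup>2 + (r - 1)\<^sup>2 / (1 + r)\<^sup>2 = (1 + r)\<^sup>2 / (1 + r)\<^sup>2"
      by (simp only: add_divide_distrib[symmetric])
    then show ?thesis using r by simp
  qed
  ultimately show ?thesis by (simp add: mem_S2)
qed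

lemma stereo_stereo_inv: "stereo (stereo_inv z) = z"
proof -
  define q :: complex where "q = of_real (1 + (norm z)\<^sup>2)"
  have q: "q \<noteq> 0" unfolding q_def using one_plus_norm(2) by (metis of_real_eq_0_iff)
  have eq: "1 - snd (stereo_inv z) = 2 / (1 + (norm z)\<^sup>2)"
    using one_plus_norm[of z] by (simp add: stereo_inv_def field_simps)
  have "of_real (2 / (1 + (norm z)\<^sup>2)) = 2 / q" by (simp add: q_def)
  then have "stereo (stereo_inv z) = (2 * z / q) / (2 / q)"
    unfolding stereo_def eq by (simp add: stereo_inv_def q_def)
  then show ?thesis using q by simp
qed

lemma S2_north: "p \<in> S2 \<Longrightarrow> snd p = 1 \<longleftrightarrow> p = north"
  by (cases p) (auto simp: mem_S2 north_def)

lemma north_in: "north \<in> S2" by (simp add: north_def mem_S2)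

lemma stereo_inv_not_north: "stereo_inv z \<noteq> north"
  using one_plus_norm[of z] by (auto simp: stereo_inv_def north_def)

lemma stereo_inv_stereo:
  assumes p: "p \<in> S2" "p \<noteq> north" shows "stereo_inv (stereo p) = p"
proof -
  obtain w t where wt: "p = (w, t)" by (cases p)
  have t1: "t \<noteq> 1" using S2_north[OF p(1)] p(2) wt by auto
  have eq: "(norm w)\<^sup>2 = 1 - t\<^sup>2" using p wt by (simp add: mem_S2)
  have n: "(norm (stereo p))\<^sup>2 = (1 - t\<^sup>2) / (1 - t)\<^sup>2"
    using eq by (simp add: wt stereo_def norm_divide power_divide norm_of_real del: of_real_diff of_real_1)
  also have "\<dots> = (1 + t) / (1 - t)"
  proof -
    have "1 - t\<^sup>2 = (1 - t) * (1 + t)" by (simp add: power2_eq_square algebra_simps)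
    then show ?thesis using t1 by (simp only: power2_eq_square) simp
  qed
  finally have n: "(norm (stereo p))\<^sup>2 = (1 + t) / (1 - t)" .
  have a: "1 + (norm (stereo p))\<^sup>2 = 2 / (1 - t)" "(norm (stereo p))\<^sup>2 - 1 = 2 * t / (1 - t)"
    unfolding n using t1 by (auto simp: field_simps)
  have "((norm (stereo p))\<^sup>2 - 1) / ((norm (stereo p))\<^sup>2 + 1) = t"
    using a t1 by (simp add: add.commute)
  moreover have "2 * stereo p / of_real (1 + (norm (stereo p))\<^sup>2) = w"
    unfolding a(1) using t1 by (simp add: stereo_def wt del: of_real_diff of_real_1) 
  ultimately show ?thesis by (simp add: stereo_inv_def wt)
qed

lemma continuous_stereo_inv: "continuous_on UNIV stereo_inv"
proof -
  have "of_real (1 + (norm z)\<^sup>2) \<noteq> (0::complex)" for z :: complex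
    using one_plus_norm(2) by (metis of_real_eq_0_iff)
  then show ?thesis
    unfolding stereo_inv_def using one_plus_norm by (intro continuous_intros) auto
qed

lemma continuous_stereo: "continuous_on (S2 - {north}) stereo"
proof -
  have "of_real (1 - snd p) \<noteq> (0::complex)" if "p \<in> S2 - {north}" for p
    using that S2_north by (metis Diff_iff eq_iff_diff_eq_0 insertI1 of_real_eq_0_iff)
  then show ?thesis
    unfolding stereo_def by (intro continuous_intros) auto
qed

lemma homeomorphism_stereo: "homeomorphism (S2 - {north}) UNIV stereo stereo_inv"
  unfolding homeomorphism_def
  using continuous_stereo_inv continuous_stereo stereo_inv_in stereo_inv_not_north stereo_stereo_inv stereo_inv_stereo
  by (auto simp: image_iff) (metis DiffI stereo_inv_in stereo_inv_not_north singletonD stereo_stereo_inv)+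

lemma dist_stereo_inv_north: "dist (stereo_inv z) north = 2 / sqrt (1 + (norm z)\<^sup>2)"
proof -
  define r where "r = (norm z)\<^sup>2"
  have r: "1 + r > 0" using one_plus_norm by (simp add: r_def)
  have nr: "norm (1 + of_real r :: complex) = 1 + r"
    using r by (metis norm_of_real abs_of_pos of_real_1 of_real_add)
  have "(dist (stereo_inv z) north)\<^sup>2 = (norm (fst (stereo_inv z)))\<^sup>2 + (snd (stereo_inv z) - 1)\<^sup>2"
    by (simp add: dist_norm north_def norm_Pair stereo_inv_def)
  also have "(norm (fst (stereo_inv z)))\<^sup>2 = 4 * r / (1 + r)\<^sup>2"
    using nr by (simp add: stereo_inv_def norm_divide norm_mult power_divide power_mult_distrib r_def)
  also have "snd (stereo_inv z) - 1 = - 2 / (1 + r)"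
    using r by (simp add: stereo_inv_def r_def[symmetric] field_simps)
  also have "4 * r / (1 + r)\<^sup>2 + (- 2 / (1 + r))\<^sup>2 = 4 / (1 + r)"
  proof -
    have "4 * r / (1 + r)\<^sup>2 + (- 2 / (1 + r))\<^sup>2 = (4 * (1 + r)) / (1 + r)\<^sup>2"
      by (simp add: power_divide add_divide_distrib[symmetric])
    also have "\<dots> = 4 / (1 + r)"
      using r unfolding power2_eq_square by (intro nonzero_mult_divide_mult_cancel_right) simp
    finally show ?thesis .
  qed
  finally have "(dist (stereo_inv z) north)\<^sup>2 = (2 / sqrt (1 + r))\<^sup>2"
    using r by (simp add: power_divide)
  then show ?thesis using r by (simp add: r_def power2_eq_iff_nonneg)
qed

definition sphere_ext :: "(complex \<Rightarrow> complex) \<Rightarrow> complex \<times> real \<Rightarrow> complex \<times> real" where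
  "sphere_ext H p = (if p = north then north else stereo_inv (H (stereo p)))"

definition proper_plane_map :: "(complex \<Rightarrow> complex) \<Rightarrow> bool" where
  "proper_plane_map H \<longleftrightarrow> continuous_on UNIV H \<and> (\<forall>R. \<exists>R'. \<forall>z. R' \<le> norm z \<longrightarrow> R \<le> norm (H z))"

lemma sphere_ext_in: "sphere_ext H p \<in> S2"
  by (simp add: sphere_ext_def stereo_inv_in north_in)

text \<open>The distance of a point from the north pole is a function of the modulus of its stereographic
  projection. Therefore uniform properness is continuity at the pole.\<close>

lemma continuous_sphere_ext_homotopy:
  fixes H :: "real \<times> complex \<Rightarrow> complex"
  assumes cont: "continuous_on ({0..1} \<times> UNIV) H"
    and proper: "\<And>R. \<exists>R'. \<forall>t\<in>{0..1}. \<forall>z. R' \<le> norm z \<longrightarrow> R \<le> norm (H (t, z))"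
  shows "continuous_on ({0..1} \<times> S2) (\<lambda>q. sphere_ext (\<lambda>z. H (fst q, z)) (snd q))"
    (is "continuous_on ?D ?h")
proof -
  have "continuous (at q within ?D) ?h" if q: "q \<in> ?D" for q
  proof (cases "snd q = north")
    case False
    have "continuous_on ({0..1} \<times> (S2 - {north})) (\<lambda>q. stereo_inv (H (fst q, stereo (snd q))))"
      by (intro continuous_on_compose2[OF continuous_stereo_inv] continuous_on_compose2[OF cont]
          continuous_on_compose2[OF continuous_stereo] continuous_intros) auto
    then have "continuous_on ({0..1} \<times> (S2 - {north})) ?h"
      by (rule continuous_on_eq) (auto simp: sphere_ext_def)
    moreover have qq: "q \<in> {0..1} \<times> (S2 - {north})" using q False by (cases q) auto
    moreover have "at q within ?D = at q within {0..1} \<times> (S2 - {north})"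
    proof (rule at_within_nhd)
      show "q \<in> UNIV \<times> (- {north})" using False by (cases q) auto
      show "open (UNIV \<times> (- {north}) :: (real \<times> complex \<times> real) set)"
        by (intro open_Times) auto
    qed auto
    ultimately show ?thesis by (metis (no_types, lifting) continuous_on_eq_continuous_within)
  next
    case True
    show ?thesis
      unfolding continuous_within_eps_delta
    proof (intro allI impI)
      fix e :: real assume e: "e > 0"
      define R where "R = 2 / e"
      obtain R1 where R1: "\<forall>t\<in>{0..1}. \<forall>z. R1 \<le> norm z \<longrightarrow> R \<le> norm (H (t, z))" using proper by blast
      define d where "d = 2 / sqrt (1 + R1\<^sup>2)"
      have R1p: "1 + R1\<^sup>2 > 0" by (rule add_pos_nonneg) auto
      then have d: "d > 0" by (simp add: d_def)
      have "dist (?h q') (?h q) < e" if q': "q' \<in> ?D" "dist q' q < d" for q'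
      proof (cases "snd q' = north")
        case True
        then show ?thesis using \<open>snd q = north\<close> e by (simp add: sphere_ext_def)
      next
        case False
        define z where "z = stereo (snd q')"
        have "stereo_inv z = snd q'" using q' False by (cases q') (auto simp: z_def stereo_inv_stereo)
        then have "dist (stereo_inv z) north \<le> dist q' q" using True by (metis dist_snd_le)
        then have "2 / sqrt (1 + (norm z)\<^sup>2) < 2 / sqrt (1 + R1\<^sup>2)"
          using q'(2) by (simp add: dist_stereo_inv_north d_def)
        then have "sqrt (1 + R1\<^sup>2) < sqrt (1 + (norm z)\<^sup>2)"
          using R1p one_plus_norm[of z] by (simp add: divide_simps split: if_splits)
        then have "R1\<^sup>2 < (norm z)\<^sup>2" by simp
        then have "R1 \<le> norm z" by (metis abs_le_square_iff abs_norm_cancel abs_ge_self less_imp_le order_trans)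
        then have R: "R \<le> norm (H (fst q', z))" using R1 q' by (cases q') auto
        have Rp: "R > 0" using e by (simp add: R_def)
        have "dist (?h q') (?h q) = 2 / sqrt (1 + (norm (H (fst q', z)))\<^sup>2)"
          using True False by (simp add: sphere_ext_def z_def dist_stereo_inv_north)
        also have "\<dots> < 2 / R"
        proof (rule divide_strict_left_mono)
          have "R\<^sup>2 \<le> (norm (H (fst q', z)))\<^sup>2" using R Rp by (simp add: power_mono)
          then have "R\<^sup>2 < 1 + (norm (H (fst q', z)))\<^sup>2" by simp
          then show "R < sqrt (1 + (norm (H (fst q', z)))\<^sup>2)" using Rp by (simp add: real_less_rsqrt)
          then show "0 < sqrt (1 + (norm (H (fst q', z)))\<^sup>2) * R"
            using Rp by (metis less_trans mult_pos_pos)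
        qed simp
        also have "2 / R = e" using e by (simp add: R_def)
        finally show ?thesis .
      qed
      then show "\<exists>d>0. \<forall>x'\<in>?D. dist x' q < d \<longrightarrow> dist (?h x') (?h q) < e" using d by blast
    qed
  qed
  then show ?thesis by (simp add: continuous_on_eq_continuous_within)
qed

lemma S2_map_sphere_ext:
  assumes "proper_plane_map H"
  shows "S2_map (sphere_ext H)"
proof -
  have cH: "continuous_on UNIV H" using assms by (simp add: proper_plane_map_def)
  have "continuous_on ({0..1::real} \<times> S2) (\<lambda>q. sphere_ext (\<lambda>z. (H \<circ> snd) (fst q, z)) (snd q))"
  proof (rule continuous_sphere_ext_homotopy[of "H \<circ> snd"])
    show "continuous_on ({0..1} \<times> UNIV) (H \<circ> snd)"
      unfolding comp_def by (intro continuous_on_compose2[OF cH] continuous_intros) auto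
    show "\<exists>R'. \<forall>t\<in>{0..1}. \<forall>z. R' \<le> norm z \<longrightarrow> R \<le> norm ((H \<circ> snd) (t::real, z))" for R
      using assms by (simp add: proper_plane_map_def)
  qed
  then have "continuous_on S2 ((\<lambda>q. sphere_ext (\<lambda>z. (H \<circ> snd) (fst q, z)) (snd q)) \<circ> (\<lambda>p. (0::real, p)))"
    by (intro continuous_on_compose continuous_intros) (auto elim: continuous_on_subset)
  then have "continuous_on S2 (sphere_ext H)" by (simp add: comp_def)
  then show ?thesis by (auto simp: S2_map_def sphere_ext_in)
qed

lemma degree_sphere_ext_homotopic:
  fixes H :: "real \<times> complex \<Rightarrow> complex"
  assumes "continuous_on ({0..1} \<times> UNIV) H"
    and "\<And>R. \<exists>R'. \<forall>t\<in>{0..1}. \<forall>z. R' \<le> norm z \<longrightarrow> R \<le> norm (H (t, z))"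
  shows "sphere_degree (sphere_ext (\<lambda>z. H (0, z))) = sphere_degree (sphere_ext (\<lambda>z. H (1, z)))"
  using sphere_degree_homotopic[OF continuous_sphere_ext_homotopy[OF assms]] by (simp add: sphere_ext_in image_subset_iff)

lemma degree_sphere_ext_compose:
  assumes "proper_plane_map H" "proper_plane_map K"
  shows "sphere_degree (sphere_ext (K \<circ> H)) = sphere_degree (sphere_ext K) * sphere_degree (sphere_ext H)"
proof -
  have "sphere_ext (K \<circ> H) = sphere_ext K \<circ> sphere_ext H"
    by (auto simp: fun_eq_iff sphere_ext_def stereo_inv_not_north stereo_stereo_inv)
  then show ?thesis using sphere_degree_compose[OF S2_map_sphere_ext S2_map_sphere_ext] assms by simp
qed

lemma degree_sphere_ext_id: "sphere_degree (sphere_ext (\<lambda>z. z)) = 1"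
  using sphere_degree_cong[of "sphere_ext (\<lambda>z. z)" "\<lambda>p. p"] stereo_inv_stereo
  by (auto simp: sphere_ext_def sphere_degree_id)

lemma degree_sphere_ext_flip: "sphere_degree (sphere_ext (\<lambda>z. - cnj z)) = -1"
proof -
  have "sphere_ext (\<lambda>z. - cnj z) p = flip p" if "p \<in> S2" for p
  proof (cases "p = north")
    case False
    have "flip (stereo_inv z) = stereo_inv (- cnj z)" for z by (simp add: flip_def stereo_inv_def)
    then show ?thesis using stereo_inv_stereo[OF that False] False by (metis sphere_ext_def)
  qed (simp add: sphere_ext_def flip_def north_def)
  then show ?thesis using sphere_degree_cong sphere_degree_flip by metis
qed

lemma proper_plane_map_translation: "proper_plane_map (\<lambda>z. z + v)"
  unfolding proper_plane_map_def
proof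
  show "\<forall>R. \<exists>R'. \<forall>z. R' \<le> norm z \<longrightarrow> R \<le> norm (z + v)"
  proof
    fix R :: real
    have "R \<le> norm (z + v)" if "R + norm v \<le> norm z" for z
      using that norm_triangle_ineq2[of z "- v"] by simp
    then show "\<exists>R'. \<forall>z. R' \<le> norm z \<longrightarrow> R \<le> norm (z + v)" by blast
  qed
qed (intro continuous_intros)

lemma degree_translation: "sphere_degree (sphere_ext (\<lambda>z. z + v)) = 1"
proof -
  define H :: "real \<times> complex \<Rightarrow> complex" where "H q = snd q + of_real (fst q) * v" for q
  have "sphere_degree (sphere_ext (\<lambda>z. H (0, z))) = sphere_degree (sphere_ext (\<lambda>z. H (1, z)))"
  proof (rule degree_sphere_ext_homotopic)
    show "continuous_on ({0..1} \<times> UNIV) H" unfolding H_def by (intro continuous_intros)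
    fix R :: real
    have "R \<le> norm (H (t, z))" if "t \<in> {0..1}" "R + norm v \<le> norm z" for t z
    proof -
      have "norm (of_real t * v) \<le> norm v" using that(1) by (simp add: norm_mult mult_left_le_one_le)
      then show ?thesis using that(2) norm_triangle_ineq2[of z "- (of_real t * v)"] by (simp add: H_def)
    qed
    then show "\<exists>R'. \<forall>t\<in>{0..1}. \<forall>z. R' \<le> norm z \<longrightarrow> R \<le> norm (H (t, z))" by blast
  qed
  then show ?thesis by (simp add: H_def degree_sphere_ext_id)
qed

section \<open>Degree one and orientation in the plane\<close>

text \<open>A map of the punctured plane in logarithmic coordinates; \<open>m\<close> is its degree on circles around \<open>0\<close>.\<close>

lemma exp_lift:
  fixes F :: "complex \<Rightarrow> complex"
  assumes "continuous_on UNIV F" "\<And>z. z \<noteq> 0 \<Longrightarrow> F z \<noteq> 0"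
  obtains \<Phi> m where "continuous_on UNIV \<Phi>" "\<And>\<zeta>. F (exp \<zeta>) = exp (\<Phi> \<zeta>)" "m \<in> \<int>"
    "\<And>\<zeta>. \<Phi> (\<zeta> + 2 * of_real pi * \<i>) = \<Phi> \<zeta> + 2 * of_real pi * \<i> * m"
proof -
  have "continuous_on UNIV (\<lambda>\<zeta>. F (exp \<zeta>))"
    by (intro continuous_on_compose2[OF assms(1)] continuous_intros) auto
  then obtain \<Phi> where \<Phi>: "continuous_on UNIV \<Phi>" "\<And>\<zeta>. F (exp \<zeta>) = exp (\<Phi> \<zeta>)"
    using continuous_logarithm_on_contractible[of UNIV "\<lambda>\<zeta>. F (exp \<zeta>)"] assms(2) contractible_UNIV
    by (metis UNIV_I exp_not_eq_zero)
  define d where "d \<zeta> = (\<Phi> (\<zeta> + 2 * of_real pi * \<i>) - \<Phi> \<zeta>) / (2 * of_real pi * \<i>)" for \<zeta>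
  have "continuous_on UNIV d"
    unfolding d_def by (intro continuous_intros continuous_on_compose2[OF \<Phi>(1)] \<Phi>(1)) auto
  moreover have "d \<zeta> \<in> \<int>" for \<zeta>
  proof (rule exp_2pi_eq_1_imp_Ints)
    have "exp (\<zeta> + 2 * of_real pi * \<i>) = exp \<zeta>" by (simp add: exp_add)
    then have e: "exp (\<Phi> (\<zeta> + 2 * of_real pi * \<i>)) = exp (\<Phi> \<zeta>)" using \<Phi>(2) by metis
    have "2 * of_real pi * \<i> * d \<zeta> = \<Phi> (\<zeta> + 2 * of_real pi * \<i>) - \<Phi> \<zeta>" by (simp add: d_def)
    then show "exp (2 * of_real pi * \<i> * d \<zeta>) = 1" using e by (simp add: exp_diff)
  qed
  ultimately obtain m where m: "m \<in> \<int>" "\<And>\<zeta>. d \<zeta> = m"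
    using integer_valued_constant[of UNIV d] by auto
  have "\<Phi> (\<zeta> + 2 * of_real pi * \<i>) = \<Phi> \<zeta> + 2 * of_real pi * \<i> * m" for \<zeta>
    using m(2)[of \<zeta>] by (simp add: d_def field_simps)
  then show thesis using that \<Phi> m by blast
qed

lemma add_int_periods:
  fixes \<Phi> :: "complex \<Rightarrow> complex"
  assumes "\<And>\<zeta>. \<Phi> (\<zeta> + p) = \<Phi> \<zeta> + c"
  shows "\<Phi> (\<zeta> + of_int n * p) = \<Phi> \<zeta> + of_int n * c"
proof -
  have pos: "\<Phi> (\<zeta> + of_nat k * p) = \<Phi> \<zeta> + of_nat k * c" for k \<zeta>
  proof (induction k)
    case (Suc k)
    have "\<Phi> (\<zeta> + of_nat (Suc k) * p) = \<Phi> ((\<zeta> + of_nat k * p) + p)" by (simp add: algebra_simps)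
    also have "\<dots> = \<Phi> (\<zeta> + of_nat k * p) + c" by (rule assms)
    also have "\<dots> = \<Phi> \<zeta> + of_nat k * c + c" using Suc by simp
    finally show ?case by (simp add: algebra_simps)
  qed simp
  show ?thesis
  proof (cases "n \<ge> 0")
    case True then show ?thesis using pos[of \<zeta> "nat n"] by simp
  next
    case False
    then obtain k where k: "n = - int k" by (metis int_cases2 nle_le of_nat_0_le_iff)
    have "\<Phi> \<zeta> = \<Phi> (\<zeta> + of_int n * p) + of_nat k * c"
      using pos[of "\<zeta> + of_int n * p" k] by (simp add: k)
    then show ?thesis by (simp add: k)
  qed
qed

text \<open>\<open>L = q \<circ> Ln\<close>. Near the negative axis \<open>Ln\<close> may be replaced by a branch that is continuous there, since
  two branches differ by periods of \<open>q\<close>.\<close>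

lemma periodic_descends:
  fixes q :: "complex \<Rightarrow> complex"
  assumes q: "continuous_on UNIV q" "\<And>\<zeta>. q (\<zeta> + 2 * of_real pi * \<i>) = q \<zeta>"
  obtains L where "continuous_on (- {0}) L" "\<And>\<zeta>. L (exp \<zeta>) = q \<zeta>"
proof -
  define L where "L z = q (Ln z)" for z
  have L: "L (exp \<zeta>) = q \<zeta>" for \<zeta>
  proof -
    have "exp (Ln (exp \<zeta>)) = exp \<zeta>" by (intro exp_Ln) auto
    then obtain n :: int where n: "Ln (exp \<zeta>) = \<zeta> + of_real (of_int (2 * n) * pi) * \<i>"
      unfolding exp_eq by blast
    have "q (\<zeta> + of_int n * (2 * of_real pi * \<i>)) = q \<zeta> + of_int n * 0"
      by (rule add_int_periods) (use q(2) in simp)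
    moreover have "\<zeta> + of_int n * (2 * of_real pi * \<i>) = Ln (exp \<zeta>)" unfolding n by simp
    ultimately show ?thesis by (simp add: L_def)
  qed
  have qc: "isCont q \<zeta>" for \<zeta> using q(1) by (simp add: continuous_on_eq_continuous_at)
  have "isCont L z" if "z \<noteq> 0" for z
  proof (cases "z \<in> \<real>\<^sub>\<le>\<^sub>0")
    case False
    then have "isCont Ln z" by (rule continuous_at_Ln)
    then show ?thesis unfolding L_def by (rule isCont_o2[OF _ qc])
  next
    case True
    have "- z \<notin> \<real>\<^sub>\<le>\<^sub>0" using True that by (auto simp: complex_nonpos_Reals_iff complex_eq_iff)
    then have "isCont (\<lambda>w. Ln (- w)) z"
      by (intro isCont_o2[of z uminus Ln]) (auto intro: continuous_intros continuous_at_Ln)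
    then have "isCont (\<lambda>w. Ln (- w) + of_real pi * \<i>) z"
      by (intro continuous_add continuous_const)
    then have "isCont (\<lambda>w. q (Ln (- w) + of_real pi * \<i>)) z"
      by (rule isCont_o2[OF _ qc])
    moreover have "\<forall>\<^sub>F w in nhds z. q (Ln (- w) + of_real pi * \<i>) = L w"
    proof (rule eventually_nhds_in_open[THEN eventually_mono, of "-{0}"])
      fix w :: complex assume "w \<in> - {0}"
      then have "exp (Ln (- w) + of_real pi * \<i>) = w" by (simp add: exp_add)
      then show "q (Ln (- w) + of_real pi * \<i>) = L w" using L by metis
    qed (use that in auto)
    ultimately show ?thesis using isCont_cong by metis
  qed
  then have "continuous_on (- {0}) L" by (intro continuous_at_imp_continuous_on) auto
  then show thesis using that L by blast
qed

lemma proper_plane_map_homeomorphism: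
  assumes "homeomorphism UNIV UNIV F G"
  shows "proper_plane_map F"
  unfolding proper_plane_map_def
proof
  show "continuous_on UNIV F" using assms by (simp add: homeomorphism_def)
  have G: "continuous_on UNIV G" "\<And>z. G (F z) = z" using assms by (auto simp: homeomorphism_def)
  show "\<forall>R. \<exists>R'. \<forall>z. R' \<le> norm z \<longrightarrow> R \<le> norm (F z)"
  proof
    fix R :: real
    have "compact (G ` cball 0 R)" by (intro compact_continuous_image continuous_on_subset[OF G(1)]) auto
    then obtain B where B: "\<And>z. z \<in> G ` cball 0 R \<Longrightarrow> norm z \<le> B"
      using compact_imp_bounded bounded_iff by metis
    have "R \<le> norm (F z)" if "B + 1 \<le> norm z" for z
    proof (rule ccontr)
      assume "\<not> R \<le> norm (F z)"
      then have "G (F z) \<in> G ` cball 0 R" by (intro imageI) simp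
      then show False using B that G(2) by force
    qed
    then show "\<exists>R'. \<forall>z. R' \<le> norm z \<longrightarrow> R \<le> norm (F z)" by blast
  qed
qed

text \<open>Move \<open>u\<close> linearly to the constant \<open>\<pi> \<i>\<close>. The modulus of the deformed map stays between \<open>\<bar>z\<bar>\<close> and \<open>\<bar>F z\<bar>\<close>,
  which keeps the homotopy continuous at \<open>0\<close> and proper at infinity. It ends with a reflection.\<close>

lemma degree_reversing:
  fixes F u :: "complex \<Rightarrow> complex"
  assumes F: "proper_plane_map F" "F 0 = 0"
    and u: "continuous_on (- {0}) u" "\<And>z. z \<noteq> 0 \<Longrightarrow> F z = cnj z * exp (u z)"
  shows "sphere_degree (sphere_ext F) = -1"
proof -
  define H :: "real \<times> complex \<Rightarrow> complex" where
    "H q = (if snd q = 0 then 0 else cnj (snd q) * exp (of_real (1 - fst q) * u (snd q) + of_real (fst q) * (of_real pi * \<i>)))" for q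
  have bounds: "norm (H (t, z)) \<le> max (norm z) (norm (F z))" "min (norm z) (norm (F z)) \<le> norm (H (t, z))"
    if t: "t \<in> {0..1}" for t z
  proof -
    have "norm (H (t, z)) \<le> max (norm z) (norm (F z)) \<and> min (norm z) (norm (F z)) \<le> norm (H (t, z))"
    proof (cases "z = 0")
      case True then show ?thesis by (simp add: H_def F)
    next
      case False
      define x where "x = Re (u z)"
      have nH: "norm (H (t, z)) = norm z * exp ((1 - t) * x)"
        using False by (simp add: H_def norm_mult x_def)
      have nF: "norm (F z) = norm z * exp x"
        using False u(2) by (simp add: norm_mult x_def)
      show ?thesis
      proof (cases "x \<ge> 0")
        case True
        then have "0 \<le> (1 - t) * x" "(1 - t) * x \<le> x" using t by (auto simp: mult_left_le_one_le)
        then have "norm z * 1 \<le> norm z * exp ((1 - t) * x)" "norm z * exp ((1 - t) * x) \<le> norm z * exp x"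
          by (auto intro!: mult_left_mono simp del: mult_1_right)
        then show ?thesis unfolding nH nF by (auto simp: le_max_iff_disj min_le_iff_disj)
      next
        case False
        have "(1 - t) * x \<le> 0" using False t by (simp add: mult_nonneg_nonpos)
        moreover have "x \<le> (1 - t) * x"
        proof -
          have "(1 - t) * (- x) \<le> - x" using False t by (intro mult_left_le_one_le) auto
          then show ?thesis by simp
        qed
        ultimately have "norm z * exp ((1 - t) * x) \<le> norm z * 1" "norm z * exp x \<le> norm z * exp ((1 - t) * x)"
          by (auto intro!: mult_left_mono simp del: mult_1_right)
        then show ?thesis unfolding nH nF by (auto simp: le_max_iff_disj min_le_iff_disj)
      qed
    qed
    then show "norm (H (t, z)) \<le> max (norm z) (norm (F z))" "min (norm z) (norm (F z)) \<le> norm (H (t, z))"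
      by auto
  qed
  have cF: "continuous_on UNIV F" using F by (simp add: proper_plane_map_def)
  have "sphere_degree (sphere_ext (\<lambda>z. H (0, z))) = sphere_degree (sphere_ext (\<lambda>z. H (1, z)))"
  proof (rule degree_sphere_ext_homotopic)
    fix R :: real
    obtain R' where R': "\<And>z. R' \<le> norm z \<Longrightarrow> R \<le> norm (F z)" using F(1) by (auto simp: proper_plane_map_def)
    have "R \<le> norm (H (t, z))" if "t \<in> {0..1}" "max R R' \<le> norm z" for t z
      using bounds(2)[OF that(1), of z] R'[of z] that(2) by (auto simp: min_def split: if_splits)
    then show "\<exists>R'. \<forall>t\<in>{0..1}. \<forall>z. R' \<le> norm z \<longrightarrow> R \<le> norm (H (t, z))" by blast
  next
    have "continuous (at q within {0..1} \<times> UNIV) H" if q: "q \<in> {0..1} \<times> UNIV" for q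
    proof (cases "snd q = 0")
      case False
      have "continuous_on (UNIV \<times> (- {0})) (\<lambda>q. cnj (snd q) * exp (of_real (1 - fst q) * u (snd q) + of_real (fst q) * (of_real pi * \<i>)))"
        by (intro continuous_intros continuous_on_compose2[OF u(1)]) auto
      then have "continuous_on (UNIV \<times> (- {0})) H"
        by (rule continuous_on_eq) (auto simp: H_def)
      moreover have "open (UNIV \<times> (- {0}) :: (real \<times> complex) set)" by (intro open_Times) auto
      moreover have "q \<in> UNIV \<times> (- {0})" using False by (cases q) auto
      ultimately have "isCont H q" using continuous_on_eq_continuous_at by blast
      then show ?thesis by (rule continuous_at_imp_continuous_at_within)
    next
      case True
      show ?thesis
        unfolding continuous_within_eps_delta
      proof (intro allI impI)
        fix e :: real assume e: "e > 0"
        have "isCont F 0" using cF by (simp add: continuous_on_eq_continuous_at)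
        then obtain d where d: "d > 0" "\<And>z. dist z 0 < d \<Longrightarrow> dist (F z) (F 0) < e"
          using e unfolding continuous_at_eps_delta by blast
        have "dist (H x) (H q) < e" if x: "x \<in> {0..1} \<times> UNIV" "dist x q < min d e" for x
        proof -
          obtain t z where tz: "x = (t, z)" "t \<in> {0..1}" using x by auto
          have "dist z (snd q) \<le> dist x q" unfolding tz by (metis dist_snd_le snd_conv)
          then have "norm z < min d e" using x True by simp
          then have "norm z < e" "norm (F z) < e" using d(2)[of z] F(2) by auto
          moreover have "norm (H x) \<le> max (norm z) (norm (F z))" using bounds(1) tz by simp
          moreover have "H q = 0" using True by (simp add: H_def)
          ultimately show ?thesis by auto
        qed
        then show "\<exists>d>0. \<forall>x'\<in>{0..1} \<times> UNIV. dist x' q < d \<longrightarrow> dist (H x') (H q) < e"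
          using d e by (intro exI[of _ "min d e"]) auto
      qed
    qed
    then show "continuous_on ({0..1} \<times> UNIV) H" by (simp add: continuous_on_eq_continuous_within)
  qed
  moreover have "(\<lambda>z. H (0, z)) = F" using u(2) F(2) by (auto simp: H_def fun_eq_iff)
  moreover have "(\<lambda>z. H (1, z)) = (\<lambda>z. - cnj z)"
    by (auto simp: H_def fun_eq_iff exp_pi_i mult.commute)
  ultimately show ?thesis by (simp add: degree_sphere_ext_flip)
qed

text \<open>The degrees of \<open>F\<close> and \<open>G\<close> on circles around \<open>0\<close> are inverse to each other, hence \<open>1\<close> or \<open>-1\<close>. In the
  second case \<open>F z\<close> is \<open>1 / z\<close>, or equally \<open>cnj z\<close>, times an exponential.\<close>

lemma homeomorphism_fixing_0:
  assumes F: "homeomorphism UNIV UNIV F G" "F 0 = 0" and deg: "sphere_degree (sphere_ext F) = 1"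
  obtains L where "continuous_on (- {0}) L" "\<And>z. z \<noteq> 0 \<Longrightarrow> F z = z * exp (L z)"
proof -
  have cont: "continuous_on UNIV F" "continuous_on UNIV G" using F by (auto simp: homeomorphism_def)
  have GF: "G (F z) = z" and FG: "F (G z) = z" for z using F by (auto simp: homeomorphism_def)
  have nz: "F z \<noteq> 0" "G z \<noteq> 0" if "z \<noteq> 0" for z using that F(2) GF FG by metis+
  let ?p = "2 * of_real pi * \<i> :: complex"
  obtain \<Phi> m where \<Phi>: "continuous_on UNIV \<Phi>" "\<And>\<zeta>. F (exp \<zeta>) = exp (\<Phi> \<zeta>)" "m \<in> \<int>"
    "\<And>\<zeta>. \<Phi> (\<zeta> + ?p) = \<Phi> \<zeta> + ?p * m"
    using exp_lift[OF cont(1) nz(1)] by metis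
  obtain \<Psi> m' where \<Psi>: "continuous_on UNIV \<Psi>" "\<And>\<zeta>. G (exp \<zeta>) = exp (\<Psi> \<zeta>)" "m' \<in> \<int>"
    "\<And>\<zeta>. \<Psi> (\<zeta> + ?p) = \<Psi> \<zeta> + ?p * m'"
    using exp_lift[OF cont(2) nz(2)] by metis
  obtain i j where ij: "m = of_int i" "m' = of_int j" using \<Phi>(3) \<Psi>(3) by (auto elim!: Ints_cases)
  define d where "d \<zeta> = (\<Psi> (\<Phi> \<zeta>) - \<zeta>) / ?p" for \<zeta>
  have "continuous_on UNIV d"
    unfolding d_def by (intro continuous_intros continuous_on_compose2[OF \<Psi>(1)] \<Phi>(1)) auto
  moreover have "d \<zeta> \<in> \<int>" for \<zeta>
  proof (rule exp_2pi_eq_1_imp_Ints)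
    have "exp (\<Psi> (\<Phi> \<zeta>)) = exp \<zeta>" using \<Phi>(2) \<Psi>(2) GF by metis
    moreover have "2 * of_real pi * \<i> * d \<zeta> = \<Psi> (\<Phi> \<zeta>) - \<zeta>" by (simp add: d_def)
    ultimately show "exp (2 * of_real pi * \<i> * d \<zeta>) = 1" by (simp add: exp_diff)
  qed
  ultimately obtain c where "c \<in> \<int>" "\<And>\<zeta>. d \<zeta> = c" using integer_valued_constant[of UNIV d] by auto
  then have PP: "\<Psi> (\<Phi> \<zeta>) = \<zeta> + ?p * c" for \<zeta> by (simp add: d_def field_simps)
  have "\<Psi> (\<Phi> 0 + of_int i * ?p) = \<Psi> (\<Phi> 0) + of_int i * (?p * m')"
    by (rule add_int_periods) (rule \<Psi>(4))
  moreover have "\<Phi> 0 + of_int i * ?p = \<Phi> (0 + ?p)" unfolding \<Phi>(4) ij by simp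
  ultimately have "0 + ?p + ?p * c = 0 + ?p * c + of_int i * (?p * m')" using PP by metis
  then have "?p * 1 = ?p * (of_int i * of_int j)" by (simp add: ij mult.commute mult.left_commute)
  then have "(of_int (i * j) :: complex) = 1" by simp
  then have "i * j = 1" by (metis of_int_eq_1_iff)
  then have "i = 1 \<or> i = -1" by (metis zmult_eq_1_iff)
  then show thesis
  proof
    assume "i = 1"
    then have q: "\<And>\<zeta>. \<Phi> (\<zeta> + ?p) - (\<zeta> + ?p) = \<Phi> \<zeta> - \<zeta>" using \<Phi>(4) ij by simp
    obtain L where L: "continuous_on (- {0}) L" "\<And>\<zeta>. L (exp \<zeta>) = \<Phi> \<zeta> - \<zeta>"
      using periodic_descends[of "\<lambda>\<zeta>. \<Phi> \<zeta> - \<zeta>", OF continuous_on_diff[OF \<Phi>(1) continuous_on_id] q] by metis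
    have "F z = z * exp (L z)" if "z \<noteq> 0" for z
    proof -
      have z: "exp (Ln z) = z" using that by simp
      have "F z = exp (\<Phi> (Ln z))" using \<Phi>(2) z by metis
      also have "\<Phi> (Ln z) = L z + Ln z" using L(2)[of "Ln z"] z by simp
      finally show ?thesis using z by (simp add: exp_add)
    qed
    then show thesis using that L by blast
  next
    assume "i = -1"
    then have q: "\<And>\<zeta>. \<Phi> (\<zeta> + ?p) + (\<zeta> + ?p) = \<Phi> \<zeta> + \<zeta>" using \<Phi>(4) ij by simp
    obtain L where L: "continuous_on (- {0}) L" "\<And>\<zeta>. L (exp \<zeta>) = \<Phi> \<zeta> + \<zeta>"
      using periodic_descends[of "\<lambda>\<zeta>. \<Phi> \<zeta> + \<zeta>", OF continuous_on_add[OF \<Phi>(1) continuous_on_id] q] by metis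
    define u where "u z = L z - of_real (ln ((norm z)\<^sup>2))" for z
    have "continuous_on (- {0}) u"
      unfolding u_def by (intro continuous_intros L(1)) auto
    moreover have "F z = cnj z * exp (u z)" if "z \<noteq> 0" for z
    proof -
      have z: "exp (Ln z) = z" using that by simp
      have "F z = exp (\<Phi> (Ln z))" using \<Phi>(2) z by metis
      also have "\<Phi> (Ln z) = L z - Ln z" using L(2)[of "Ln z"] z by simp
      finally have Fz: "F z = exp (L z) / z" using z by (simp add: exp_diff)
      have "exp (of_real (ln ((norm z)\<^sup>2))) = (of_real ((norm z)\<^sup>2) :: complex)"
        using that by (simp add: exp_of_real del: of_real_power)
      also have "\<dots> = z * cnj z" by (rule complex_norm_square)
      finally have "cnj z * exp (u z) = cnj z * (exp (L z) / (z * cnj z))" by (simp add: u_def exp_diff)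
      then show ?thesis using Fz that by simp
    qed
    ultimately have "sphere_degree (sphere_ext F) = -1"
      using degree_reversing[OF proper_plane_map_homeomorphism[OF F(1)] F(2)] by blast
    then show thesis using deg by simp
  qed
qed

text \<open>Translations have degree one, so that \<open>w\<close> and \<open>F w\<close> may be moved to \<open>0\<close>.\<close>

theorem degree_one_orientation_log:
  assumes F: "homeomorphism UNIV UNIV F G" and deg: "sphere_degree (sphere_ext F) = 1"
  shows "orientation_log F"
  unfolding orientation_log_def
proof
  fix w
  define F0 where "F0 z = F (z + w) + - F w" for z
  define G0 where "G0 z = G (z + F w) + - w" for z
  have cont: "continuous_on UNIV F" "continuous_on UNIV G" using F by (auto simp: homeomorphism_def)
  have GF: "G (F z) = z" and FG: "F (G z) = z" for z using F by (auto simp: homeomorphism_def)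
  have "homeomorphism UNIV UNIV F0 G0"
  proof (rule homeomorphismI)
    show "continuous_on UNIV F0" "continuous_on UNIV G0"
      unfolding F0_def G0_def
      by (intro continuous_intros continuous_on_compose2[OF cont(1)] continuous_on_compose2[OF cont(2)]; simp)+
  qed (auto simp: F0_def G0_def GF FG)
  moreover have "F0 0 = 0" by (simp add: F0_def)
  moreover have "sphere_degree (sphere_ext F0) = 1"
  proof -
    have F0: "F0 = (\<lambda>z. z + - F w) \<circ> (F \<circ> (\<lambda>z. z + w))" by (simp add: F0_def fun_eq_iff)
    have "proper_plane_map (F \<circ> (\<lambda>z. z + w))"
    proof (rule proper_plane_map_homeomorphism)
      show "homeomorphism UNIV UNIV (F \<circ> (\<lambda>z. z + w)) ((\<lambda>z. z - w) \<circ> G)"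
      proof (rule homeomorphismI)
        show "continuous_on UNIV (F \<circ> (\<lambda>z. z + w))" "continuous_on UNIV ((\<lambda>z. z - w) \<circ> G)"
          unfolding comp_def by (intro continuous_intros continuous_on_compose2[OF cont(1)] cont(2); simp)+
      qed (auto simp: GF FG)
    qed
    then show ?thesis
      unfolding F0 using deg
      by (simp add: degree_sphere_ext_compose proper_plane_map_translation proper_plane_map_homeomorphism[OF F] degree_translation del: add_uminus_conv_diff)
  qed
  ultimately obtain L where L: "continuous_on (- {0}) L" "\<And>z. z \<noteq> 0 \<Longrightarrow> F0 z = z * exp (L z)"
    using homeomorphism_fixing_0 by metis
  have "continuous_on (- {w}) (\<lambda>z. L (z - w))"
    by (rule continuous_on_compose2[OF L(1)]) (auto intro!: continuous_intros)
  moreover have "F z - F w = (z - w) * exp (L (z - w))" if "z \<noteq> w" for z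
    using L(2)[of "z - w"] that by (simp add: F0_def)
  ultimately show "\<exists>L. continuous_on (- {w}) L \<and> (\<forall>z. z \<noteq> w \<longrightarrow> F z - F w = (z - w) * exp (L z))"
    by blast
qed

section \<open>Crosscuts of an invariant disk in the sphere\<close>

lemma exists_complementary_interval:
  fixes K :: "real set"
  assumes K: "closed K" "0 \<in> K" "1 \<in> K" and t: "t \<in> {0..1}" "t \<notin> K"
  obtains a b where "0 \<le> a" "a < t" "t < b" "b \<le> 1" "a \<in> K" "b \<in> K" "{a<..<b} \<inter> K = {}"
proof -
  have "compact (K \<inter> {0..t})" "compact (K \<inter> {t..1})" using K(1) by (simp_all add: closed_Int_compact)
  moreover have "0 \<in> K \<inter> {0..t}" "1 \<in> K \<inter> {t..1}" using K t by auto
  ultimately obtain a b where a: "a \<in> K \<inter> {0..t}" "\<And>x. x \<in> K \<inter> {0..t} \<Longrightarrow> x \<le> a"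
    and b: "b \<in> K \<inter> {t..1}" "\<And>x. x \<in> K \<inter> {t..1} \<Longrightarrow> b \<le> x"
    using compact_attains_sup[of "K \<inter> {0..t}"] compact_attains_inf[of "K \<inter> {t..1}"] by (metis emptyE)
  have "a \<noteq> t" "b \<noteq> t" using a(1) b(1) t(2) by blast+
  moreover have "{a<..<b} \<inter> K = {}"
  proof (rule equals0I)
    fix x assume x: "x \<in> {a<..<b} \<inter> K"
    show False
    proof (cases "x \<le> t")
      case True
      then have "x \<in> K \<inter> {0..t}" using x a(1) by auto
      then show False using a(2) x by force
    next
      case False
      then have "x \<in> K \<inter> {t..1}" using x b(1) by auto
      then show False using b(2) x by force
    qed
  qed
  ultimately show thesis using a(1) b(1) by (intro that[of a b]) auto
qed

text \<open>A homeomorphism of the sphere without wandering points whose fixed point sits at the north pole.\<close>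

locale sphere_system =
  fixes f f' :: "complex \<times> real \<Rightarrow> complex \<times> real"
  assumes hom: "homeomorphism S2 S2 f f'"
    and fix_north: "f north = north"
    and rec: "\<And>V. openin (top_of_set S2) V \<Longrightarrow> V \<noteq> {} \<Longrightarrow> \<exists>n\<ge>1. (f ^^ n) ` V \<inter> V \<noteq> {}"
begin

definition F :: "complex \<Rightarrow> complex" where "F z = stereo (f (stereo_inv z))"
definition G :: "complex \<Rightarrow> complex" where "G z = stereo (f' (stereo_inv z))"

lemma f_in: "p \<in> S2 \<Longrightarrow> f p \<in> S2" and f'_in: "p \<in> S2 \<Longrightarrow> f' p \<in> S2"
  and f'f: "p \<in> S2 \<Longrightarrow> f' (f p) = p" and ff': "p \<in> S2 \<Longrightarrow> f (f' p) = p"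
  using hom unfolding homeomorphism_def by blast+

lemma fix_north': "f' north = north"
  using f'f[OF north_in] fix_north by simp

lemma f_north: "p \<in> S2 \<Longrightarrow> f p = north \<longleftrightarrow> p = north"
  by (metis f'f fix_north fix_north')

lemma f'_north: "p \<in> S2 \<Longrightarrow> f' p = north \<longleftrightarrow> p = north"
  by (metis ff' fix_north fix_north')

lemma stereo_inv_F: "stereo_inv (F z) = f (stereo_inv z)"
  unfolding F_def by (rule stereo_inv_stereo) (simp_all add: f_in stereo_inv_in f_north stereo_inv_not_north)

lemma stereo_inv_G: "stereo_inv (G z) = f' (stereo_inv z)"
  unfolding G_def by (rule stereo_inv_stereo) (simp_all add: f'_in stereo_inv_in f'_north stereo_inv_not_north)

lemma stereo_inv_inj: "stereo_inv z = stereo_inv w \<longleftrightarrow> z = w"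
  by (metis stereo_stereo_inv)

lemma stereo_inv_Fn: "stereo_inv ((F ^^ n) z) = (f ^^ n) (stereo_inv z)"
  by (induction n) (simp_all add: stereo_inv_F)

lemma homeomorphism_F: "homeomorphism UNIV UNIV F G"
proof (rule homeomorphismI)
  have c: "continuous_on S2 f" "continuous_on S2 f'" using hom by (auto simp: homeomorphism_def)
  have "f (stereo_inv z) \<in> S2 - {north}" "f' (stereo_inv z) \<in> S2 - {north}" for z
    by (simp_all add: f_in f'_in stereo_inv_in f_north f'_north stereo_inv_not_north)
  then have im: "(\<lambda>z. f (stereo_inv z)) ` UNIV \<subseteq> S2 - {north}" "(\<lambda>z. f' (stereo_inv z)) ` UNIV \<subseteq> S2 - {north}" "stereo_inv ` UNIV \<subseteq> S2"
    using stereo_inv_in by (simp_all add: image_subset_iff)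
  show "continuous_on UNIV F"
    unfolding F_def
    by (rule continuous_on_compose2[OF continuous_stereo continuous_on_compose2[OF c(1) continuous_stereo_inv im(3)] im(1)])
  show "continuous_on UNIV G"
    unfolding G_def
    by (rule continuous_on_compose2[OF continuous_stereo continuous_on_compose2[OF c(2) continuous_stereo_inv im(3)] im(2)])
  show "G (F z) = z" for z by (simp add: G_def stereo_inv_F f'f stereo_inv_in stereo_stereo_inv)
  show "F (G z) = z" for z by (simp add: F_def stereo_inv_G ff' stereo_inv_in stereo_stereo_inv)
qed auto

lemma open_preimage: "openin (top_of_set S2) V \<Longrightarrow> open (stereo_inv -` V)"
proof -
  assume "openin (top_of_set S2) V"
  then obtain T where "open T" "V = S2 \<inter> T" by (metis openin_open)
  moreover have "stereo_inv -` (S2 \<inter> T) = stereo_inv -` T" using stereo_inv_in by blast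
  ultimately show ?thesis using continuous_stereo_inv by (simp add: open_vimage)
qed

lemma open_image: "open V \<Longrightarrow> openin (top_of_set S2) (stereo_inv ` V)"
proof -
  assume V: "open V"
  have "stereo_inv ` V = (S2 - {north}) \<inter> stereo -` V"
  proof (intro equalityI subsetI)
    fix p assume "p \<in> stereo_inv ` V"
    then obtain z where "z \<in> V" "p = stereo_inv z" by blast
    then show "p \<in> (S2 - {north}) \<inter> stereo -` V" using stereo_inv_in stereo_inv_not_north stereo_stereo_inv by simp
  next
    fix p assume p: "p \<in> (S2 - {north}) \<inter> stereo -` V"
    then have "stereo_inv (stereo p) = p" using stereo_inv_stereo by blast
    then show "p \<in> stereo_inv ` V" using p by (metis IntD2 imageI vimageD)
  qed
  moreover have "openin (top_of_set (S2 - {north})) ((S2 - {north}) \<inter> stereo -` V)"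
    using continuous_stereo V by (rule continuous_openin_preimage_gen)
  moreover have "openin (top_of_set S2) (S2 - {north})" by (simp add: openin_delete)
  ultimately show ?thesis using openin_trans by metis
qed

lemma recurrent_F: "recurrent F"
  unfolding recurrent_def
proof (intro allI impI)
  fix V :: "complex set" assume V: "open V \<and> V \<noteq> {}"
  then obtain n p where n: "n \<ge> 1" "p \<in> stereo_inv ` V" "(f ^^ n) p \<in> stereo_inv ` V"
    using rec[OF open_image] by blast
  then obtain z w where "z \<in> V" "p = stereo_inv z" "w \<in> V" "(f ^^ n) p = stereo_inv w" by blast
  then have "(F ^^ n) z = w" using stereo_inv_Fn stereo_inv_inj by metis
  then show "\<exists>n\<ge>1. (F ^^ n) ` V \<inter> V \<noteq> {}" using n \<open>z \<in> V\<close> \<open>w \<in> V\<close> by blast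
qed

lemma F_preimage:
  assumes "U \<subseteq> S2" "f ` U = U"
  shows "F ` (stereo_inv -` U) = stereo_inv -` U"
proof -
  have f': "f' p \<in> U" if "p \<in> U" for p
  proof -
    have "p \<in> f ` U" using that assms(2) by simp
    then obtain q where q: "q \<in> U" "p = f q" by blast
    then have "f' p = q" using f'f[OF subsetD[OF assms(1) q(1)]] by simp
    then show ?thesis using q(1) by simp
  qed
  have "F z \<in> stereo_inv -` U" if "z \<in> stereo_inv -` U" for z using that assms by (auto simp: stereo_inv_F)
  moreover have "z \<in> F ` (stereo_inv -` U)" if "z \<in> stereo_inv -` U" for z
  proof -
    have "z = F (G z)" using homeomorphism_F by (simp add: homeomorphism_def)
    moreover have "G z \<in> stereo_inv -` U" using that f' by (simp add: stereo_inv_G)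
    ultimately show ?thesis by blast
  qed
  ultimately show ?thesis by blast
qed

end

text \<open>An invariant disk \<open>U\<close> with a chart \<open>\<psi>\<close> onto the plane, and a free closed curve \<open>g\<close> in stereographic
  coordinates that starts outside \<open>U\<close>. The disk may contain the north pole.\<close>

locale disk_and_curve = sphere_system +
  fixes U :: "(complex \<times> real) set" and \<psi> :: "complex \<times> real \<Rightarrow> complex" and \<psi>' :: "complex \<Rightarrow> complex \<times> real"
    and g :: "real \<Rightarrow> complex"
  assumes U: "openin (top_of_set S2) U" "f ` U = U" and \<psi>: "homeomorphism U UNIV \<psi> \<psi>'"
    and g: "simple_path g" "pathfinish g = pathstart g" "F ` path_image g \<inter> path_image g = {}"
    and base: "stereo_inv (g 0) \<notin> U" and meets: "\<exists>t\<in>{0..1}. stereo_inv (g t) \<in> U"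
begin

definition D :: "complex set" where "D = stereo_inv -` U"

definition K :: "real set" where "K = {t \<in> {0..1}. g t \<notin> D}"

text \<open>The parameter intervals of the crosscuts. The curve starts outside \<open>U\<close>, so none of them wraps around.\<close>

definition \<I> :: "(real \<times> real) set" where
  "\<I> = {(a, b). 0 \<le> a \<and> a < b \<and> b \<le> 1 \<and> a \<in> K \<and> b \<in> K \<and> {a<..<b} \<inter> K = {}}"

text \<open>The curve as seen in the chart of the disk.\<close>

definition c :: "real \<Rightarrow> complex" where "c t = \<psi> (stereo_inv (g t))"

definition Fm :: "complex \<Rightarrow> complex" where "Fm w = \<psi> (f (\<psi>' w))"
definition Gm :: "complex \<Rightarrow> complex" where "Gm w = \<psi> (f' (\<psi>' w))"

definition \<C> :: "complex set set" where "\<C> = (\<lambda>(a, b). c ` {a<..<b}) ` \<I>"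

lemma U_sub: "U \<subseteq> S2" using openin_imp_subset[OF U(1)] .

lemma psi: "p \<in> U \<Longrightarrow> \<psi>' (\<psi> p) = p" "\<psi> (\<psi>' w) = w" "\<psi>' w \<in> U"
  using \<psi> unfolding homeomorphism_def by blast+

lemma fU: "p \<in> U \<Longrightarrow> f p \<in> U"
  by (metis U(2) imageI)

lemma f'U: "p \<in> U \<Longrightarrow> f' p \<in> U"
proof -
  assume "p \<in> U"
  then have "p \<in> f ` U" using U(2) by simp
  then obtain q where q: "q \<in> U" "p = f q" by blast
  then have "f' p = q" using f'f[OF subsetD[OF U_sub q(1)]] by simp
  then show "f' p \<in> U" using q(1) by simp
qed

lemma open_D: "open D" unfolding D_def by (rule open_preimage[OF U(1)])

lemma cont_g: "continuous_on {0..1} g" using g(1) by (simp add: simple_path_def path_def)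

lemma closed_K: "closed K"
proof -
  have "K = {0..1} \<inter> g -` (- D)" by (auto simp: K_def)
  moreover have "closed ({0..1} \<inter> g -` (- D))"
    using open_D by (intro continuous_closed_preimage cont_g) auto
  ultimately show ?thesis by simp
qed

lemma ends_K: "0 \<in> K" "1 \<in> K"
  using base g(2) by (auto simp: K_def D_def pathfinish_def pathstart_def)

lemma cover:
  assumes "t \<in> {0..1}" "g t \<in> D"
  obtains a b where "(a, b) \<in> \<I>" "t \<in> {a<..<b}"
proof -
  have "t \<notin> K" using assms by (simp add: K_def)
  then obtain a b where "0 \<le> a" "a < t" "t < b" "b \<le> 1" "a \<in> K" "b \<in> K" "{a<..<b} \<inter> K = {}"
    using exists_complementary_interval[OF closed_K ends_K assms(1)] by metis
  then show thesis by (intro that[of a b]) (auto simp: \<I>_def)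
qed

lemma interval:
  assumes "(a, b) \<in> \<I>"
  shows "0 \<le> a" "a < b" "b \<le> 1" "g a \<notin> D" "g b \<notin> D"
    "\<And>t. t \<in> {a<..<b} \<Longrightarrow> g t \<in> D" "\<And>t. t \<in> {a<..<b} \<Longrightarrow> t \<in> {0<..<1}"
  using assms by (force simp: \<I>_def K_def)+

lemma interval_unique:
  assumes 1: "(a, b) \<in> \<I>" and 2: "(a', b') \<in> \<I>" and t: "t \<in> {a<..<b}" "t \<in> {a'<..<b'}"
  shows "a = a' \<and> b = b'"
proof -
  have "a \<notin> {a'<..<b'}" "b \<notin> {a'<..<b'}" "a' \<notin> {a<..<b}" "b' \<notin> {a<..<b}"
    using 1 2 unfolding \<I>_def by blast+
  then show ?thesis using t by auto
qed

lemma g_inj: "s \<in> {0<..<1} \<Longrightarrow> t \<in> {0..1} \<Longrightarrow> g s = g t \<Longrightarrow> s = t"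
  using g(1) unfolding simple_path_def loop_free_def by force

lemma c_inj:
  assumes "g s \<in> D" "g t \<in> D" "c s = c t" shows "g s = g t"
  using assms psi(1) by (metis D_def c_def stereo_inv_inj vimageD)

lemma homeomorphism_Fm: "homeomorphism UNIV UNIV Fm Gm"
proof (rule homeomorphismI)
  have c: "continuous_on S2 f" "continuous_on S2 f'" using hom by (auto simp: homeomorphism_def)
  have p: "continuous_on U \<psi>" "continuous_on UNIV \<psi>'" using \<psi> by (auto simp: homeomorphism_def)
  have S: "\<psi>' w \<in> S2" for w using psi(3) U_sub by (rule subsetD[rotated])
  have im: "range (\<lambda>w. f (\<psi>' w)) \<subseteq> U" "range (\<lambda>w. f' (\<psi>' w)) \<subseteq> U" "range \<psi>' \<subseteq> S2"
    using fU[OF psi(3)] f'U[OF psi(3)] S by (simp_all add: image_subset_iff)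
  show "continuous_on UNIV Fm"
    unfolding Fm_def
    by (rule continuous_on_compose2[OF p(1) continuous_on_compose2[OF c(1) p(2) im(3)] im(1)])
  show "continuous_on UNIV Gm"
    unfolding Gm_def
    by (rule continuous_on_compose2[OF p(1) continuous_on_compose2[OF c(2) p(2) im(3)] im(2)])
  show "Gm (Fm w) = w" for w by (simp add: Gm_def Fm_def psi fU f'f[OF S])
  show "Fm (Gm w) = w" for w by (simp add: Gm_def Fm_def psi f'U ff'[OF S])
qed auto

lemma Fm_n: "(Fm ^^ n) w = \<psi> ((f ^^ n) (\<psi>' w)) \<and> (f ^^ n) (\<psi>' w) \<in> U"
  by (induction n) (simp_all add: psi Fm_def fU)

lemma recurrent_Fm: "recurrent Fm"
  unfolding recurrent_def
proof (intro allI impI)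
  fix V :: "complex set" assume V: "open V \<and> V \<noteq> {}"
  have "\<psi>' ` V = U \<inter> \<psi> -` V" using psi by (auto simp: image_iff) metis
  moreover have "openin (top_of_set U) (U \<inter> \<psi> -` V)"
    using \<psi> V by (intro continuous_openin_preimage_gen) (auto simp: homeomorphism_def)
  ultimately have "openin (top_of_set S2) (\<psi>' ` V)" using openin_trans U(1) by metis
  then obtain n p where n: "n \<ge> 1" "p \<in> \<psi>' ` V" "(f ^^ n) p \<in> \<psi>' ` V"
    using rec V by blast
  then obtain z w where "z \<in> V" "p = \<psi>' z" "w \<in> V" "(f ^^ n) p = \<psi>' w" by blast
  then have "(Fm ^^ n) z = w" using Fm_n psi(2) by metis
  then show "\<exists>n\<ge>1. (Fm ^^ n) ` V \<inter> V \<noteq> {}" using n \<open>z \<in> V\<close> \<open>w \<in> V\<close> by blast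
qed

lemma cont_c:
  assumes "(a, b) \<in> \<I>" shows "continuous_on {a<..<b} c"
proof -
  have p: "continuous_on U \<psi>" using \<psi> by (auto simp: homeomorphism_def)
  have "{a<..<b} \<subseteq> {0..1}" using interval[OF assms] by auto
  moreover have "stereo_inv (g t) \<in> U" if "t \<in> {a<..<b}" for t using interval(6)[OF assms that] by (simp add: D_def)
  ultimately show ?thesis
    unfolding c_def
    by (intro continuous_on_compose2[OF p] continuous_on_compose2[OF continuous_stereo_inv] continuous_on_subset[OF cont_g]) auto
qed

text \<open>The set is closed because the preimage of \<open>A\<close> is compact in the sphere, not only in \<open>U\<close>. This makes
  crosscuts proper lines and their family locally finite.\<close>

lemma compact_time:
  assumes "compact A" shows "compact {t \<in> {0..1}. g t \<in> D \<and> c t \<in> A}"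
proof -
  have "compact (\<psi>' ` A)"
    using assms \<psi> by (intro compact_continuous_image) (auto simp: homeomorphism_def intro: continuous_on_subset)
  then have cl: "closed (\<psi>' ` A)" by (rule compact_imp_closed)
  have "continuous_on {0..1} (\<lambda>t. stereo_inv (g t))"
    by (intro continuous_on_compose2[OF continuous_stereo_inv] cont_g) auto
  then have c: "closed ({0..1} \<inter> (\<lambda>t. stereo_inv (g t)) -` (\<psi>' ` A))"
    using cl by (intro continuous_closed_preimage) auto
  have eq: "{t \<in> {0..1}. g t \<in> D \<and> c t \<in> A} = {0..1} \<inter> (\<lambda>t. stereo_inv (g t)) -` (\<psi>' ` A)"
  proof -
    have "g t \<in> D \<and> c t \<in> A \<longleftrightarrow> stereo_inv (g t) \<in> \<psi>' ` A" for t
    proof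
      assume "g t \<in> D \<and> c t \<in> A"
      then have "stereo_inv (g t) = \<psi>' (c t)" "c t \<in> A" using psi(1) by (simp_all add: D_def c_def)
      then show "stereo_inv (g t) \<in> \<psi>' ` A" by (metis imageI)
    next
      assume "stereo_inv (g t) \<in> \<psi>' ` A"
      then obtain w where "w \<in> A" "stereo_inv (g t) = \<psi>' w" by (metis imageE)
      then show "g t \<in> D \<and> c t \<in> A" by (simp add: D_def c_def psi)
    qed
    then show ?thesis by blast
  qed
  have "bounded ({0..1} \<inter> (\<lambda>t. stereo_inv (g t)) -` (\<psi>' ` A))"
    by (rule bounded_subset[OF bounded_closed_interval[of 0 "1::real"]]) auto
  then show ?thesis unfolding eq compact_eq_bounded_closed using c by (rule conjI)
qed

lemma crosscut_line:
  assumes ab: "(a, b) \<in> \<I>"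
  shows "connected (c ` {a<..<b})" "\<not> bounded (c ` {a<..<b})" "\<exists>A B. two_sides (c ` {a<..<b}) A B"
proof -
  note i = interval[OF ab]
  have inj: "inj_on c {a<..<b}"
  proof (rule inj_onI)
    fix s t assume st: "s \<in> {a<..<b}" "t \<in> {a<..<b}" "c s = c t"
    then have "g s = g t" using c_inj i(6) by blast
    then show "s = t" using g_inj[of s t] i(7)[OF st(1)] i(7)[OF st(2)] by auto
  qed
  have "D \<noteq> {}" using meets by (auto simp: D_def)
  then have "\<not> D \<subseteq> path_image g"
    using interior_simple_closed_curve[OF g(1,2)] open_D interior_maximal by blast
  then obtain d where d: "d \<in> D" "d \<notin> path_image g" by blast
  have e: "\<psi> (stereo_inv d) \<notin> c ` {a<..<b}"
  proof
    assume "\<psi> (stereo_inv d) \<in> c ` {a<..<b}"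
    then obtain t where t: "t \<in> {a<..<b}" "\<psi> (stereo_inv d) = \<psi> (stereo_inv (g t))" by (auto simp: c_def)
    then have "d = g t" using d(1) i(6)[OF t(1)] psi(1) by (metis D_def stereo_inv_inj vimageD)
    then show False using d(2) i(7)[OF t(1)] by (auto simp: path_image_def)
  qed
  have proper: "\<exists>a' b'. a < a' \<and> b' < b \<and> (\<forall>t\<in>{a<..<b}. norm (c t) \<le> r \<longrightarrow> a' \<le> t \<and> t \<le> b')" for r
  proof -
    define T where "T = {t \<in> {0..1}. g t \<in> D \<and> c t \<in> cball 0 r} \<inter> {a..b}"
    have T: "compact T" unfolding T_def by (intro compact_Int compact_time) auto
    have mem: "t \<in> T" if "t \<in> {a<..<b}" "norm (c t) \<le> r" for t
      using that i(6)[OF that(1)] i(7)[OF that(1)] by (auto simp: T_def)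
    have T': "T \<subseteq> {a<..<b}"
    proof
      fix t assume "t \<in> T"
      then have "t \<noteq> a" "t \<noteq> b" "t \<in> {a..b}" using i(4,5) by (auto simp: T_def)
      then show "t \<in> {a<..<b}" by auto
    qed
    show ?thesis
    proof (cases "T = {}")
      case True
      then have "\<not> norm (c t) \<le> r" if "t \<in> {a<..<b}" for t using mem[OF that] by blast
      then show ?thesis using i(2) by (intro exI[of _ "b"] exI[of _ a]) auto
    next
      case False
      obtain a' where a': "a' \<in> T" "\<And>t. t \<in> T \<Longrightarrow> a' \<le> t" using compact_attains_inf[OF T False] by blast
      obtain b' where b': "b' \<in> T" "\<And>t. t \<in> T \<Longrightarrow> t \<le> b'" using compact_attains_sup[OF T False] by blast
      have "a < a'" "b' < b" using a'(1) b'(1) T' by auto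
      then show ?thesis using a'(2) b'(2) mem by blast
    qed
  qed
  show "connected (c ` {a<..<b})" "\<not> bounded (c ` {a<..<b})" "\<exists>A B. two_sides (c ` {a<..<b}) A B"
    by (rule two_sides_proper_line[OF i(2) cont_c[OF ab] inj proper e])+
qed

lemma Fm_c: "g t \<in> D \<Longrightarrow> Fm (c t) = \<psi> (stereo_inv (F (g t)))"
  by (simp add: Fm_def c_def D_def psi stereo_inv_F)

lemma crosscut_family: "crosscut_family Fm Gm \<C>"
proof
  show "homeomorphism UNIV UNIV Fm Gm" by (rule homeomorphism_Fm)
  show "recurrent Fm" by (rule recurrent_Fm)
  obtain t where t: "t \<in> {0..1}" "g t \<in> D" using meets by (auto simp: D_def)
  obtain a b where "(a, b) \<in> \<I>" using cover[OF t] by metis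
  then show "\<C> \<noteq> {}" unfolding \<C>_def by blast
next
  fix C assume "C \<in> \<C>"
  then obtain a b where ab: "(a, b) \<in> \<I>" "C = c ` {a<..<b}" by (auto simp: \<C>_def)
  show "connected C" "\<not> bounded C" "\<exists>A B. two_sides C A B"
    unfolding ab(2) by (rule crosscut_line[OF ab(1)])+
  fix C' assume "C' \<in> \<C>"
  then obtain a' b' where ab': "(a', b') \<in> \<I>" "C' = c ` {a'<..<b'}" by (auto simp: \<C>_def)
  show "C \<inter> C' = {}" if "C \<noteq> C'"
  proof (rule equals0I)
    fix z assume "z \<in> C \<inter> C'"
    then obtain s t where st: "s \<in> {a<..<b}" "z = c s" "t \<in> {a'<..<b'}" "z = c t" unfolding ab(2) ab'(2) by blast
    have "g s = g t" using c_inj[OF interval(6)[OF ab(1) st(1)] interval(6)[OF ab'(1) st(3)]] st by simp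
    then have "s = t" using g_inj[of s t] interval(7)[OF ab(1) st(1)] interval(7)[OF ab'(1) st(3)] by auto
    then have "a = a'" "b = b'" using interval_unique[OF ab(1) ab'(1)] st by auto
    then show False using that ab(2) ab'(2) by simp
  qed
  show "Fm ` C \<inter> C' = {}"
  proof (rule equals0I)
    fix z assume "z \<in> Fm ` C \<inter> C'"
    then obtain s t where st: "s \<in> {a<..<b}" "z = Fm (c s)" "t \<in> {a'<..<b'}" "z = c t" unfolding ab(2) ab'(2) by blast
    have s: "g s \<in> D" "s \<in> {0<..<1}" and t: "g t \<in> D" "t \<in> {0<..<1}"
      using interval(6,7)[OF ab(1) st(1)] interval(6,7)[OF ab'(1) st(3)] by auto
    have "\<psi> (stereo_inv (F (g s))) = \<psi> (stereo_inv (g t))" using Fm_c[OF s(1)] st by (simp add: c_def)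
    moreover have "stereo_inv (F (g s)) \<in> U" "stereo_inv (g t) \<in> U" using s(1) t(1) by (auto simp: D_def stereo_inv_F fU)
    ultimately have "F (g s) = g t" using psi(1) stereo_inv_inj by metis
    moreover have "g s \<in> path_image g" "g t \<in> path_image g" using s t by (auto simp: path_image_def)
    ultimately show False using g(3) by (metis IntI emptyE imageI)
  qed
next
  fix A :: "complex set" assume A: "compact A"
  define T where "T = {t \<in> {0..1}. g t \<in> D \<and> c t \<in> A}"
  have T: "compact T" unfolding T_def by (rule compact_time[OF A])
  have cov: "T \<subseteq> \<Union>((\<lambda>(a, b). {a<..<b}) ` \<I>)"
  proof
    fix t assume "t \<in> T"
    then have "t \<in> {0..1}" "g t \<in> D" by (auto simp: T_def)
    then obtain a b where "(a, b) \<in> \<I>" "t \<in> {a<..<b}" using cover by metis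
    then show "t \<in> \<Union>((\<lambda>(a, b). {a<..<b}) ` \<I>)" by blast
  qed
  have op: "open B" if "B \<in> (\<lambda>(a, b). {a<..<b}) ` \<I>" for B
    using that by auto
  obtain \<T> where \<T>: "\<T> \<subseteq> (\<lambda>(a, b). {a<..<b}) ` \<I>" "finite \<T>" "T \<subseteq> \<Union>\<T>"
    by (rule compactE[OF T cov op])
  have "{C \<in> \<C>. C \<inter> A \<noteq> {}} \<subseteq> (\<lambda>I. c ` I) ` \<T>"
  proof
    fix C assume "C \<in> {C \<in> \<C>. C \<inter> A \<noteq> {}}"
    then have C: "C \<in> \<C>" "C \<inter> A \<noteq> {}" by simp_all
    obtain a b where ab0: "(a, b) \<in> \<I>" "C = c ` {a<..<b}" using C(1) by (auto simp: \<C>_def)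
    obtain t where t: "t \<in> {a<..<b}" "c t \<in> A" using C(2) unfolding ab0(2) by blast
    note ab = ab0 t
    have "t \<in> T" using ab interval(6,7)[OF ab(1,3)] by (auto simp: T_def)
    then obtain I where I: "I \<in> \<T>" "t \<in> I" using \<T>(3) by (metis UnionE subsetD)
    have "I \<in> (\<lambda>(a, b). {a<..<b}) ` \<I>" by (rule subsetD[OF \<T>(1) I(1)])
    then obtain a' b' where "(a', b') \<in> \<I>" "I = {a'<..<b'}" by auto
    then have ab': "(a', b') \<in> \<I>" "{a'<..<b'} \<in> \<T>" "t \<in> {a'<..<b'}" using I by simp_all
    then have "a = a'" "b = b'" using interval_unique[OF ab(1) ab'(1) ab(3)] by auto
    then show "C \<in> (\<lambda>I. c ` I) ` \<T>" using ab ab' by blast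
  qed
  then show "finite {C \<in> \<C>. C \<inter> A \<noteq> {}}" using \<T>(2) finite_subset by blast
qed

text \<open>The north pole is a fixed point, so the connecting arc in the chart can be made to avoid it and then be
  projected to the plane.\<close>

theorem exists_good_crosscut:
  obtains a b s s' \<gamma> where "0 \<le> a" "a < b" "b \<le> 1" "g a \<notin> stereo_inv -` U" "g b \<notin> stereo_inv -` U"
    "\<And>t. t \<in> {a<..<b} \<Longrightarrow> g t \<in> stereo_inv -` U" "s \<in> {a<..<b}" "s' \<in> {a<..<b}" "arc \<gamma>" "path_image \<gamma> \<subseteq> stereo_inv -` U"
    "pathstart \<gamma> = g s" "pathfinish \<gamma> = F (g s')" "path_image \<gamma> \<inter> path_image g \<subseteq> {g s}"
    "path_image \<gamma> \<inter> F ` path_image g \<subseteq> {F (g s')}"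
proof -
  interpret cc: crosscut_family Fm Gm \<C> by (rule crosscut_family)
  \<comment> \<open>The north pole in the chart, if it lies in the disk.\<close>
  define Z where "Z = (if north \<in> U then {\<psi> north} else {})"
  have "finite Z" "\<And>z. z \<in> Z \<Longrightarrow> Fm z = z"
    by (auto simp: Z_def Fm_def psi fix_north split: if_splits)
  then obtain C \<beta> where \<beta>: "C \<in> \<C>" "arc \<beta>" "pathstart \<beta> \<in> C" "pathfinish \<beta> \<in> Fm ` C" "path_image \<beta> \<inter> Z = {}"
    "\<And>E. E \<in> \<C> \<Longrightarrow> path_image \<beta> \<inter> E \<subseteq> {pathstart \<beta>}"
    "\<And>E. E \<in> \<C> \<Longrightarrow> path_image \<beta> \<inter> Fm ` E \<subseteq> {pathfinish \<beta>}"
    using cc.exists_connecting_arc by metis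
  obtain a b where ab: "(a, b) \<in> \<I>" "C = c ` {a<..<b}" using \<beta>(1) by (auto simp: \<C>_def)
  note i = interval[OF ab(1)]
  obtain s where s: "s \<in> {a<..<b}" "pathstart \<beta> = c s" using \<beta>(3) ab(2) by blast
  obtain s' where s': "s' \<in> {a<..<b}" "pathfinish \<beta> = Fm (c s')" using \<beta>(4) ab(2) by blast
  define \<gamma> where "\<gamma> = (\<lambda>w. stereo (\<psi>' w)) \<circ> \<beta>"
  have notN: "\<psi>' w \<in> S2 - {north}" if "w \<in> path_image \<beta>" for w
  proof -
    have "\<psi>' w \<noteq> north"
    proof
      assume e: "\<psi>' w = north"
      then have "north \<in> U" using psi(3) by metis
      moreover have "w = \<psi> north" using e psi(2) by metis
      ultimately have "w \<in> Z" by (simp add: Z_def)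
      then show False using that \<beta>(5) by blast
    qed
    then show ?thesis using psi(3) U_sub by blast
  qed
  have sg: "stereo_inv (stereo (\<psi>' w)) = \<psi>' w" if "w \<in> path_image \<beta>" for w
    using notN[OF that] stereo_inv_stereo by blast
  have im: "path_image \<gamma> = (\<lambda>w. stereo (\<psi>' w)) ` path_image \<beta>"
    by (simp add: \<gamma>_def path_image_def image_comp)
  have start: "pathstart \<gamma> = g s"
  proof -
    have "\<psi>' (c s) = stereo_inv (g s)" unfolding c_def using i(6)[OF s(1)] by (intro psi(1)) (simp add: D_def)
    then show ?thesis using s(2) by (simp add: \<gamma>_def pathstart_def stereo_stereo_inv)
  qed
  have finish: "pathfinish \<gamma> = F (g s')"
  proof -
    have d: "g s' \<in> D" by (rule i(6)[OF s'(1)])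
    have "\<psi>' (Fm (c s')) = stereo_inv (F (g s'))"
      unfolding Fm_c[OF d] using d by (intro psi(1)) (simp add: D_def stereo_inv_F fU)
    then show ?thesis using s'(2) by (simp add: \<gamma>_def pathfinish_def stereo_stereo_inv)
  qed
  show thesis
  proof
    show "0 \<le> a" "a < b" "b \<le> 1" "g a \<notin> stereo_inv -` U" "g b \<notin> stereo_inv -` U" "s \<in> {a<..<b}" "s' \<in> {a<..<b}"
      using i s s' by (auto simp: D_def)
    show "g t \<in> stereo_inv -` U" if "t \<in> {a<..<b}" for t using i(6)[OF that] by (simp add: D_def)
    show "arc \<gamma>"
      unfolding arc_def
    proof
      show "path \<gamma>"
        unfolding \<gamma>_def
      proof (rule path_continuous_image[OF arc_imp_path[OF \<beta>(2)]])
        show "continuous_on (path_image \<beta>) (\<lambda>w. stereo (\<psi>' w))"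
        proof (rule continuous_on_compose2[OF continuous_stereo])
          show "continuous_on (path_image \<beta>) \<psi>'"
            using \<psi> by (auto simp: homeomorphism_def intro: continuous_on_subset)
          show "\<psi>' ` path_image \<beta> \<subseteq> S2 - {north}" using notN by (intro image_subsetI)
        qed
      qed
      have "inj_on (\<lambda>w. stereo (\<psi>' w)) (path_image \<beta>)"
        by (rule inj_onI) (metis sg psi(2))
      then show "inj_on \<gamma> {0..1}"
        unfolding \<gamma>_def using \<beta>(2) by (intro comp_inj_on) (auto simp: arc_def path_image_def)
    qed
    show "path_image \<gamma> \<subseteq> stereo_inv -` U" using sg psi(3) by (auto simp: im)
    show "pathstart \<gamma> = g s" "pathfinish \<gamma> = F (g s')" by (rule start, rule finish)
    show "path_image \<gamma> \<inter> path_image g \<subseteq> {g s}"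
    proof
      fix z assume "z \<in> path_image \<gamma> \<inter> path_image g"
      then have z: "z \<in> (\<lambda>w. stereo (\<psi>' w)) ` path_image \<beta>" "z \<in> g ` {0..1}"
        unfolding im by (simp_all add: path_image_def)
      obtain w where w: "w \<in> path_image \<beta>" "z = stereo (\<psi>' w)" using z(1) by blast
      obtain t where t: "z = g t" "t \<in> {0..1}" using z(2) by blast
      have sz: "stereo_inv (g t) = \<psi>' w" using sg[OF w(1)] w t by simp
      then have d: "g t \<in> D" using psi(3) by (simp add: D_def)
      obtain a' b' where ab': "(a', b') \<in> \<I>" "t \<in> {a'<..<b'}" using cover[OF t(2) d] by metis
      have "w = c t" using sz psi(2) by (simp add: c_def)
      then have "w \<in> c ` {a'<..<b'}" using ab'(2) by blast
      moreover have "c ` {a'<..<b'} \<in> \<C>" using ab'(1) by (auto simp: \<C>_def)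
      ultimately have "w = pathstart \<beta>" using \<beta>(6) w(1) by blast
      then show "z \<in> {g s}" using start w(2) by (simp add: \<gamma>_def pathstart_def)
    qed
    show "path_image \<gamma> \<inter> F ` path_image g \<subseteq> {F (g s')}"
    proof
      fix z assume "z \<in> path_image \<gamma> \<inter> F ` path_image g"
      then have z: "z \<in> (\<lambda>w. stereo (\<psi>' w)) ` path_image \<beta>" "z \<in> (\<lambda>t. F (g t)) ` {0..1}"
        unfolding im by (simp_all add: path_image_def image_image)
      obtain w where w: "w \<in> path_image \<beta>" "z = stereo (\<psi>' w)" using z(1) by blast
      obtain t where t: "z = F (g t)" "t \<in> {0..1}" using z(2) by blast
      have sz: "f (stereo_inv (g t)) = \<psi>' w" using sg[OF w(1)] w t by (simp add: stereo_inv_F[symmetric])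
      then have "f' (f (stereo_inv (g t))) \<in> U" using f'U psi(3) by metis
      then have d: "g t \<in> D" by (simp add: D_def f'f stereo_inv_in)
      obtain a' b' where ab': "(a', b') \<in> \<I>" "t \<in> {a'<..<b'}" using cover[OF t(2) d] by metis
      have "w = Fm (c t)" using sz psi(2) Fm_c[OF d] by (simp add: stereo_inv_F)
      then have "w \<in> Fm ` c ` {a'<..<b'}" using ab'(2) by blast
      moreover have "c ` {a'<..<b'} \<in> \<C>" using ab'(1) by (auto simp: \<C>_def)
      ultimately have "w = pathfinish \<beta>" using \<beta>(7) w(1) by blast
      then show "z \<in> {F (g s')}" using finish w(2) by (simp add: \<gamma>_def pathfinish_def)
    qed
  qed
qed

end

section \<open>Three invariant disks\<close>

text \<open>Points of the open disk can be moved at will by homeomorphisms. So a circle can be deformed into a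
  curve through one point of each set.\<close>

lemma simple_loop_through_three_sets:
  fixes h :: "complex \<Rightarrow> complex"
  assumes h: "continuous_on (cball 0 1) h" "inj_on h (cball 0 1)"
    and W: "open W1" "open W2" "open W3" "W1 \<inter> W2 = {}" "W1 \<inter> W3 = {}" "W2 \<inter> W3 = {}"
    and ne: "h ` cball 0 1 \<inter> W1 \<noteq> {}" "h ` cball 0 1 \<inter> W2 \<noteq> {}" "h ` cball 0 1 \<inter> W3 \<noteq> {}"
  obtains g where "simple_path g" "pathfinish g = pathstart g" "path_image g \<subseteq> h ` cball 0 1"
    "path_image g \<inter> W1 \<noteq> {}" "path_image g \<inter> W2 \<noteq> {}" "path_image g \<inter> W3 \<noteq> {}"
proof -
  have inner: "\<exists>y\<in>ball 0 1. h y \<in> W" if W: "open W" "h ` cball 0 1 \<inter> W \<noteq> {}" for W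
  proof -
    obtain T where T: "open T" "T \<inter> cball 0 1 = h -` W \<inter> cball 0 1"
      using h(1) W(1) by (metis continuous_on_open_invariant)
    obtain x where "x \<in> cball 0 1" "h x \<in> W" using W(2) by blast
    then have "x \<in> T \<inter> cball 0 1" unfolding T(2) by simp
    then have "x \<in> T" "x \<in> closure (ball 0 (1::real))" by auto
    then have "T \<inter> ball 0 1 \<noteq> {}" using T(1) open_Int_closure_eq_empty[of T "ball 0 1"] by blast
    then obtain y where y: "y \<in> T" "y \<in> ball 0 1" by blast
    then have "y \<in> T \<inter> cball 0 1" by auto
    then show ?thesis using y unfolding T(2) by blast
  qed
  obtain y1 y2 y3 where y: "y1 \<in> ball 0 1" "y2 \<in> ball 0 1" "y3 \<in> ball 0 1" "h y1 \<in> W1" "h y2 \<in> W2" "h y3 \<in> W3"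
    using inner W(1,2,3) ne by metis
  define x :: "nat \<Rightarrow> complex" where "x i = (if i = 0 then 1/2 else if i = 1 then - 1/2 else \<i>/2)" for i
  define y' where "y' i = (if i = 0 then y1 else if i = 1 then y2 else y3)" for i :: nat
  have xs: "x i \<in> sphere 0 (1/2)" for i by (simp add: x_def norm_divide)
  obtain k k' where k: "homeomorphism (ball 0 1) (ball 0 1) k k'" "\<And>i. i \<in> {0,1,2} \<Longrightarrow> k (x i) = y' i"
  proof (rule homeomorphism_moving_points_exists[of "ball (0::complex) 1" "ball 0 1" "{0,1,2::nat}" x y'])
    show "x i \<in> ball 0 1 \<and> y' i \<in> ball 0 1" for i
      using xs[of i] y by (auto simp: y'_def)
    show "pairwise (\<lambda>i j. x i \<noteq> x j \<and> y' i \<noteq> y' j) {0, 1, 2}"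
    proof -
      have "y1 \<noteq> y2" "y1 \<noteq> y3" "y2 \<noteq> y3" using y(4-6) W(4-6) by (metis IntI emptyE)+
      then show ?thesis
        by (auto simp: pairwise_def x_def y'_def; simp add: complex_eq_iff)
    qed
    show "ball 0 1 \<subseteq> affine hull (ball (0::complex) 1)" by (rule hull_subset)
  qed (use that in auto)
  define p where "p = circlepath (0::complex) (1/2)"
  have p: "simple_path p" "path_image p = sphere 0 (1/2)" "pathfinish p = pathstart p"
    by (simp_all add: p_def simple_path_circlepath)
  have sub: "sphere (0::complex) (1/2) \<subseteq> ball 0 1" by auto
  have kk: "k z \<in> ball 0 1" if "z \<in> ball 0 1" for z using k(1) that unfolding homeomorphism_def by blast
  have k_inj: "inj_on k (ball 0 1)" using k(1) unfolding homeomorphism_def by (metis inj_on_inverseI)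
  define g where "g = (h \<circ> k) \<circ> p"
  have im: "path_image g = (h \<circ> k) ` sphere 0 (1/2)"
    by (simp add: g_def path_image_compose p(2))
  show thesis
  proof
    show "simple_path g"
      unfolding g_def
    proof (rule simple_path_continuous_image[OF p(1)])
      have kc: "continuous_on (path_image p) k"
        using k(1) sub unfolding p(2) homeomorphism_def by (metis continuous_on_subset)
      have ki: "k ` path_image p \<subseteq> cball 0 1" unfolding p(2) using kk sub by fastforce
      show "continuous_on (path_image p) (h \<circ> k)"
        by (rule continuous_on_compose[OF kc continuous_on_subset[OF h(1) ki]])
      show "inj_on (h \<circ> k) (path_image p)"
        by (rule comp_inj_on[OF inj_on_subset[OF k_inj] inj_on_subset[OF h(2) ki]]) (use sub p(2) in simp)
    qed
    show "pathfinish g = pathstart g" using p(3) by (simp add: g_def pathfinish_compose pathstart_compose)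
    show "path_image g \<subseteq> h ` cball 0 1" unfolding im using kk sub by fastforce
    have mem: "h (y' i) \<in> path_image g" if "i \<in> {0,1,2}" for i
      unfolding im using k(2)[OF that] xs[of i] by (metis comp_apply imageI)
    have "h y1 \<in> path_image g" "h y2 \<in> path_image g" "h y3 \<in> path_image g"
      using mem[of 0] mem[of 1] mem[of 2] by (simp_all add: y'_def)
    then show "path_image g \<inter> W1 \<noteq> {}" "path_image g \<inter> W2 \<noteq> {}" "path_image g \<inter> W3 \<noteq> {}"
      using y by blast+
  qed
qed

context sphere_system
begin

text \<open>The order of the three crosscuts along the curve decides which disk is crossed, namely \<open>DM\<close>.\<close>

lemma three_good_crosscuts_impossible:
  assumes deg: "orientation_log F"
    and g: "simple_path g" "pathfinish g = pathstart g" "F ` path_image g \<inter> path_image g = {}"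
    and DM: "open DM" "contractible DM" "F ` DM = DM"
    and disj: "DA \<inter> DM = {}" "DC \<inter> DM = {}" "DA \<inter> DC = {}"
    and A: "0 \<le> a" "b \<le> 1" "\<And>t. t \<in> {a<..<b} \<Longrightarrow> g t \<in> DA" "s \<in> {a<..<b}" "s' \<in> {a<..<b}"
      "arc \<gamma>" "path_image \<gamma> \<subseteq> DA" "pathstart \<gamma> = g s" "pathfinish \<gamma> = F (g s')"
      "path_image \<gamma> \<inter> path_image g \<subseteq> {g s}" "path_image \<gamma> \<inter> F ` path_image g \<subseteq> {F (g s')}"
    and M: "b \<le> am" "am < bm" "bm \<le> c" "\<And>t. t \<in> {am<..<bm} \<Longrightarrow> g t \<in> DM"
    and C: "d \<le> 1" "\<And>t. t \<in> {c<..<d} \<Longrightarrow> g t \<in> DC" "r \<in> {c<..<d}" "r' \<in> {c<..<d}"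
      "arc \<delta>" "path_image \<delta> \<subseteq> DC" "pathstart \<delta> = g r" "pathfinish \<delta> = F (g r')"
      "path_image \<delta> \<inter> path_image g \<subseteq> {g r}" "path_image \<delta> \<inter> F ` path_image g \<subseteq> {F (g r')}"
  shows False
proof -
  have segA: "closed_segment s s' \<subseteq> {a<..<b}" using A(4,5) by (auto simp: closed_segment_eq_real_ivl split: if_splits)
  have segC: "closed_segment r r' \<subseteq> {c<..<d}" using C(3,4) by (auto simp: closed_segment_eq_real_ivl split: if_splits)
  define t where "t = (am + bm) / 2"
  have t: "t \<in> {am<..<bm}" using M(2) by (auto simp: t_def)
  show False
  proof (rule connecting_arcs_impossible[OF homeomorphism_F deg DM, of g s r s' r' \<gamma> \<delta> t])
    show "\<exists>n\<ge>1. (F ^^ n) ` V \<inter> V \<noteq> {}" if "open V" "V \<noteq> {}" for V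
      using recurrent_F that unfolding recurrent_def by blast
    show "s \<in> {0..1}" "r \<in> {0..1}" "s' \<in> {0..1}" "r' \<in> {0..1}" using A M C by auto
    have "g s \<in> DA" "g r \<in> DC" "g s' \<in> DA" "g r' \<in> DC" using A(3-5) C(2-4) by auto
    then show "g s \<noteq> g r" "g s' \<noteq> g r'" using disj(3) by force+
    show "g ` closed_segment s s' \<inter> DM = {}" "g ` closed_segment r r' \<inter> DM = {}"
      using segA segC A(3) C(2) disj by blast+
    show "path_image \<gamma> \<inter> DM = {}" "path_image \<delta> \<inter> DM = {}" "path_image \<gamma> \<inter> path_image \<delta> = {}"
      using A(7) C(6) disj by blast+
    show "t \<in> closed_segment s r" using t A(4) C(3) M(1,3) by (auto simp: closed_segment_eq_real_ivl)
    show "g t \<in> DM" using M(4)[OF t] .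
  qed (use g A C in auto)
qed

lemma exists_crosscut_with_connecting_arc:
  assumes "openin (top_of_set S2) U" "f ` U = U" "U homeomorphic (UNIV :: complex set)"
    and "simple_path g" "pathfinish g = pathstart g" "F ` path_image g \<inter> path_image g = {}"
    and "stereo_inv (g 0) \<notin> U" "path_image g \<inter> stereo_inv -` U \<noteq> {}"
  obtains a b s s' \<gamma> where "0 \<le> a" "a < b" "b \<le> 1" "g a \<notin> stereo_inv -` U" "g b \<notin> stereo_inv -` U"
    "\<And>t. t \<in> {a<..<b} \<Longrightarrow> g t \<in> stereo_inv -` U" "s \<in> {a<..<b}" "s' \<in> {a<..<b}" "arc \<gamma>" "path_image \<gamma> \<subseteq> stereo_inv -` U"
    "pathstart \<gamma> = g s" "pathfinish \<gamma> = F (g s')" "path_image \<gamma> \<inter> path_image g \<subseteq> {g s}"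
    "path_image \<gamma> \<inter> F ` path_image g \<subseteq> {F (g s')}"
proof -
  obtain \<psi> \<psi>' where "homeomorphism U (UNIV :: complex set) \<psi> \<psi>'" using assms(3) unfolding homeomorphic_def by blast
  then interpret disk_and_curve f f' U \<psi> \<psi>' g
    using assms by unfold_locales (auto simp: path_image_def)
  show thesis by (rule exists_good_crosscut) (rule that)
qed

lemma contractible_preimage:
  assumes U: "openin (top_of_set S2) U" "U homeomorphic (UNIV :: complex set)" and N: "north \<notin> U"
  shows "contractible (stereo_inv -` U)"
proof -
  have sub: "U \<subseteq> S2 - {north}" using openin_imp_subset[OF U(1)] N by blast
  have "homeomorphism U (stereo_inv -` U) stereo stereo_inv"
  proof (rule homeomorphism_of_subsets[OF homeomorphism_stereo sub])
    show "stereo ` U = stereo_inv -` U"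
    proof (intro equalityI subsetI)
      fix z assume "z \<in> stereo ` U"
      then show "z \<in> stereo_inv -` U" using sub stereo_inv_stereo by fastforce
    next
      fix z assume "z \<in> stereo_inv -` U"
      then show "z \<in> stereo ` U" by (metis imageI stereo_stereo_inv vimageD)
    qed
  qed auto
  then have "stereo_inv -` U homeomorphic (UNIV :: complex set)"
    using U(2) homeomorphic_sym homeomorphic_trans unfolding homeomorphic_def by metis
  then show ?thesis using homeomorphic_contractible contractible_UNIV homeomorphic_sym by blast
qed

text \<open>The crossed disk must not contain the north pole. Restarting the curve at the end of a crosscut of
  \<open>U1\<close> makes this crosscut the last one, so that one of the other disks lies in the middle.\<close>

lemma no_free_loop_through_three_disks:
  assumes deg: "orientation_log F"
    and U: "openin (top_of_set S2) U1" "openin (top_of_set S2) U2" "openin (top_of_set S2) U3"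
    and homU: "U1 homeomorphic (UNIV :: complex set)" "U2 homeomorphic (UNIV :: complex set)" "U3 homeomorphic (UNIV :: complex set)"
    and inv: "f ` U1 = U1" "f ` U2 = U2" "f ` U3 = U3"
    and disj: "U1 \<inter> U2 = {}" "U1 \<inter> U3 = {}" "U2 \<inter> U3 = {}"
    and N: "north \<notin> U2" "north \<notin> U3"
    and g: "simple_path g" "pathfinish g = pathstart g" "F ` path_image g \<inter> path_image g = {}"
    and meets: "path_image g \<inter> stereo_inv -` U1 \<noteq> {}" "path_image g \<inter> stereo_inv -` U2 \<noteq> {}" "path_image g \<inter> stereo_inv -` U3 \<noteq> {}"
  shows False
proof -
  define D1 D2 D3 where D: "D1 = stereo_inv -` U1" "D2 = stereo_inv -` U2" "D3 = stereo_inv -` U3"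
  have Dopen: "open D1" "open D2" "open D3" unfolding D by (intro open_preimage U)+
  have Ddisj: "D1 \<inter> D2 = {}" "D1 \<inter> D3 = {}" "D2 \<inter> D3 = {}" using disj unfolding D by blast+
  have Dinv: "F ` D2 = D2" "F ` D3 = D3"
    unfolding D by (intro F_preimage openin_imp_subset[OF U(2)] openin_imp_subset[OF U(3)] inv)+
  have Dcon: "contractible D2" "contractible D3" unfolding D by (intro contractible_preimage U homU N)+
  have mem: "stereo_inv z \<in> U1 \<longleftrightarrow> z \<in> D1" "stereo_inv z \<in> U2 \<longleftrightarrow> z \<in> D2" "stereo_inv z \<in> U3 \<longleftrightarrow> z \<in> D3" for z by (simp_all add: D)
  have "\<not> path_image g \<subseteq> D1 \<union> (D2 \<union> D3)"
  proof
    assume sub: "path_image g \<subseteq> D1 \<union> (D2 \<union> D3)"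
    have "D1 \<inter> path_image g = {} \<or> (D2 \<union> D3) \<inter> path_image g = {}"
      by (rule connectedD[OF connected_simple_path_image[OF g(1)] Dopen(1) open_Un[OF Dopen(2,3)] _ sub])
        (use Ddisj in blast)
    then show False using meets D by blast
  qed
  then obtain z0 where "z0 \<in> g ` {0..1}" "z0 \<notin> D1 \<union> (D2 \<union> D3)" unfolding path_image_def by blast
  then obtain t0 where t0: "t0 \<in> {0..1}" "g t0 \<notin> D1 \<union> (D2 \<union> D3)" by blast
  define g1 where "g1 = shiftpath t0 g"
  have g1: "simple_path g1" "pathfinish g1 = pathstart g1" "path_image g1 = path_image g"
    unfolding g1_def using g t0 by (simp_all add: simple_path_shiftpath closed_shiftpath path_image_shiftpath)
  have "g1 0 = g t0" using t0 by (simp add: g1_def shiftpath_def)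
  then have base1: "stereo_inv (g1 0) \<notin> U1" using t0 mem by simp
  have free1: "F ` path_image g1 \<inter> path_image g1 = {}" "path_image g1 \<inter> stereo_inv -` U1 \<noteq> {}"
    using g(3) meets g1(3) by simp_all
  obtain a b s s' \<gamma> where 1: "0 \<le> a" "a < b" "b \<le> 1" "g1 a \<notin> D1" "g1 b \<notin> D1"
    "\<And>t. t \<in> {a<..<b} \<Longrightarrow> g1 t \<in> D1" "s \<in> {a<..<b}" "s' \<in> {a<..<b}" "arc \<gamma>" "path_image \<gamma> \<subseteq> D1"
    "pathstart \<gamma> = g1 s" "pathfinish \<gamma> = F (g1 s')" "path_image \<gamma> \<inter> path_image g1 \<subseteq> {g1 s}"
    "path_image \<gamma> \<inter> F ` path_image g1 \<subseteq> {F (g1 s')}"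
    using exists_crosscut_with_connecting_arc[OF U(1) inv(1) homU(1) g1(1,2) free1(1) base1 free1(2)] unfolding D by blast
  have b01: "b \<in> {0..1}" using 1 by auto
  \<comment> \<open>The point \<open>g1 b\<close> is a limit of points of \<open>D1\<close>.\<close>
  have b_out: "g1 b \<notin> W" if W: "open W" "D1 \<inter> W = {}" for W
  proof
    assume "g1 b \<in> W"
    have c: "continuous_on {a..b} g1"
      using g1(1) 1(1,3) by (auto simp: simple_path_def path_def intro: continuous_on_subset)
    have cl: "closure {a<..<b} = {a..b}" using 1(2) by simp
    have "g1 ` closure {a<..<b} \<subseteq> closure (g1 ` {a<..<b})"
      using c cl by (intro image_closure_subset closed_closure closure_subset) auto
    then have "g1 b \<in> closure (g1 ` {a<..<b})" using cl 1(2) by auto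
    then have "g1 b \<in> closure D1" using closure_mono[of "g1 ` {a<..<b}" D1] 1(6) by blast
    then show False using \<open>g1 b \<in> W\<close> W open_Int_closure_eq_empty[of W D1] by blast
  qed
  define g2 where "g2 = shiftpath b g1"
  have g2: "simple_path g2" "pathfinish g2 = pathstart g2" "path_image g2 = path_image g1"
    unfolding g2_def using g1 b01 by (simp_all add: simple_path_shiftpath closed_shiftpath path_image_shiftpath)
  have free2: "F ` path_image g2 \<inter> path_image g2 = {}" using free1 g2(3) by simp
  have g20: "g2 0 = g1 b" using 1(3) by (simp add: g2_def shiftpath_def)
  have base2: "stereo_inv (g2 0) \<notin> U2" "stereo_inv (g2 0) \<notin> U3"
    using b_out[OF Dopen(2) Ddisj(1)] b_out[OF Dopen(3) Ddisj(2)] by (simp_all add: g20 mem)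
  have meet2: "path_image g2 \<inter> stereo_inv -` U2 \<noteq> {}" "path_image g2 \<inter> stereo_inv -` U3 \<noteq> {}"
    using meets g2(3) g1(3) by simp_all
  \<comment> \<open>In the new parametrization, the crosscut of the first disk is the interval from \<open>\<alpha>\<close> to \<open>1\<close>.\<close>
  define \<alpha> where "\<alpha> = a - b + 1"
  have shift: "g2 (t - b + 1) = g1 t" if "t \<in> {a<..<b}" for t
    using that 1(1) by (simp add: g2_def shiftpath_def)
  have sh: "t + b - 1 \<in> {a<..<b}" if "t \<in> {\<alpha><..<1}" for t using that by (auto simp: \<alpha>_def)
  have 11: "g2 t \<in> D1" if "t \<in> {\<alpha><..<1}" for t
    using shift[OF sh[OF that]] 1(6)[OF sh[OF that]] by simp
  have ss: "s - b + 1 \<in> {\<alpha><..<1}" "s' - b + 1 \<in> {\<alpha><..<1}" using 1(7,8) by (auto simp: \<alpha>_def)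
  have \<alpha>: "\<alpha> < 1" using 1(2) by (simp add: \<alpha>_def)
  have \<gamma>g: "pathstart \<gamma> = g2 (s - b + 1)" "pathfinish \<gamma> = F (g2 (s' - b + 1))"
    "path_image \<gamma> \<inter> path_image g2 \<subseteq> {g2 (s - b + 1)}"
    "path_image \<gamma> \<inter> F ` path_image g2 \<subseteq> {F (g2 (s' - b + 1))}"
    using 1(11-14) shift[OF 1(7)] shift[OF 1(8)] g2(3) by simp_all
  obtain a2 b2 s2 s2' \<gamma>2 where 2: "0 \<le> a2" "a2 < b2" "b2 \<le> 1" "g2 a2 \<notin> D2" "g2 b2 \<notin> D2"
    "\<And>t. t \<in> {a2<..<b2} \<Longrightarrow> g2 t \<in> D2" "s2 \<in> {a2<..<b2}" "s2' \<in> {a2<..<b2}" "arc \<gamma>2" "path_image \<gamma>2 \<subseteq> D2"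
    "pathstart \<gamma>2 = g2 s2" "pathfinish \<gamma>2 = F (g2 s2')" "path_image \<gamma>2 \<inter> path_image g2 \<subseteq> {g2 s2}"
    "path_image \<gamma>2 \<inter> F ` path_image g2 \<subseteq> {F (g2 s2')}"
    using exists_crosscut_with_connecting_arc[OF U(2) inv(2) homU(2) g2(1,2) free2 base2(1) meet2(1)] unfolding D by blast
  obtain a3 b3 s3 s3' \<gamma>3 where 3: "0 \<le> a3" "a3 < b3" "b3 \<le> 1" "g2 a3 \<notin> D3" "g2 b3 \<notin> D3"
    "\<And>t. t \<in> {a3<..<b3} \<Longrightarrow> g2 t \<in> D3" "s3 \<in> {a3<..<b3}" "s3' \<in> {a3<..<b3}" "arc \<gamma>3" "path_image \<gamma>3 \<subseteq> D3"
    "pathstart \<gamma>3 = g2 s3" "pathfinish \<gamma>3 = F (g2 s3')" "path_image \<gamma>3 \<inter> path_image g2 \<subseteq> {g2 s3}"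
    "path_image \<gamma>3 \<inter> F ` path_image g2 \<subseteq> {F (g2 s3')}"
    using exists_crosscut_with_connecting_arc[OF U(3) inv(3) homU(3) g2(1,2) free2 base2(2) meet2(2)] unfolding D by blast
  have apart: "y \<le> u \<or> v \<le> x"
    if "x < y" "u < v" "\<And>t. t \<in> {x<..<y} \<Longrightarrow> g2 t \<in> P" "\<And>t. t \<in> {u<..<v} \<Longrightarrow> g2 t \<in> Q" "P \<inter> Q = {}" for x y u v P Q
  proof (rule ccontr)
    assume "\<not> ?thesis"
    then have "(max x u + min y v) / 2 \<in> {x<..<y}" "(max x u + min y v) / 2 \<in> {u<..<v}"
      using that(1,2) by (auto simp: max_def min_def)
    then show False using that(3-5) by blast
  qed
  have b2: "b2 \<le> \<alpha>" using apart[OF 2(2) \<alpha> 2(6) 11] Ddisj 2(1-3) by fastforce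
  have b3: "b3 \<le> \<alpha>" using apart[OF 3(2) \<alpha> 3(6) 11] Ddisj 3(1-3) by fastforce
  have "b2 \<le> a3 \<or> b3 \<le> a2" using apart[OF 2(2) 3(2) 2(6) 3(6) Ddisj(3)] by blast
  then show False
  proof
    assume "b2 \<le> a3"
    show False
      by (rule three_good_crosscuts_impossible[OF deg g2(1,2) free2 Dopen(3) Dcon(2) Dinv(2) Ddisj(3,2) _
            2(1,3,6,7,8,9,10,11,12,13,14) \<open>b2 \<le> a3\<close> 3(2) b3 3(6) order_refl 11 ss 1(9,10) \<gamma>g])
        (use Ddisj in auto)
  next
    assume "b3 \<le> a2"
    show False
      by (rule three_good_crosscuts_impossible[OF deg g2(1,2) free2 Dopen(2) Dcon(1) Dinv(1) _ Ddisj(1) _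
            3(1,3,6,7,8,9,10,11,12,13,14) \<open>b3 \<le> a2\<close> 2(2) b2 2(6) order_refl 11 ss 1(9,10) \<gamma>g])
        (use Ddisj in auto)
  qed
qed

theorem disk_meets_image:
  assumes deg: "sphere_degree f = 1"
    and B: "B \<subseteq> S2" "B homeomorphic cball (0::complex) 1"
    and U: "openin (top_of_set S2) U1" "openin (top_of_set S2) U2" "openin (top_of_set S2) U3"
    and homU: "U1 homeomorphic (UNIV :: complex set)" "U2 homeomorphic (UNIV :: complex set)" "U3 homeomorphic (UNIV :: complex set)"
    and inv: "f ` U1 = U1" "f ` U2 = U2" "f ` U3 = U3"
    and disj: "U1 \<inter> U2 = {}" "U1 \<inter> U3 = {}" "U2 \<inter> U3 = {}"
    and meets: "B \<inter> U1 \<noteq> {}" "B \<inter> U2 \<noteq> {}" "B \<inter> U3 \<noteq> {}"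
  shows "f ` B \<inter> B \<noteq> {}"
proof
  assume free: "f ` B \<inter> B = {}"
  have NB: "north \<notin> B" using free fix_north by (metis IntI emptyE imageI)
  have ori: "orientation_log F"
  proof (rule degree_one_orientation_log[OF homeomorphism_F])
    have "sphere_ext F p = f p" if "p \<in> S2" for p
      using that by (cases "p = north") (simp_all add: sphere_ext_def fix_north stereo_inv_F stereo_inv_stereo)
    then show "sphere_degree (sphere_ext F) = 1" using sphere_degree_cong deg by metis
  qed
  obtain \<beta> \<beta>' where \<beta>: "homeomorphism (cball (0::complex) 1) B \<beta> \<beta>'"
    using B(2) homeomorphic_sym homeomorphic_def by metis
  define h where "h z = stereo (\<beta> z)" for z
  have \<beta>B: "\<beta> z \<in> B" if "z \<in> cball 0 1" for z using \<beta> that unfolding homeomorphism_def by blast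
  have sh: "stereo_inv (h z) = \<beta> z" if "z \<in> cball 0 1" for z
    unfolding h_def using \<beta>B[OF that] B(1) NB by (intro stereo_inv_stereo) auto
  have hc: "continuous_on (cball 0 1) h"
    unfolding h_def
    by (rule continuous_on_compose2[OF continuous_stereo]) (use \<beta> \<beta>B B(1) NB in \<open>auto simp: homeomorphism_def\<close>)
  have hi: "inj_on h (cball 0 1)"
  proof (rule inj_onI)
    fix z w assume "z \<in> cball 0 1" "w \<in> cball 0 1" "h z = h w"
    then show "z = w" using sh \<beta> unfolding homeomorphism_def by metis
  qed
  have hm: "h ` cball 0 1 \<inter> stereo_inv -` U \<noteq> {}" if BU: "B \<inter> U \<noteq> {}" for U
  proof -
    obtain p where p: "p \<in> B" "p \<in> U" using BU by blast
    then obtain z where z: "z \<in> cball 0 1" "p = \<beta> z" using \<beta> unfolding homeomorphism_def by blast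
    then have "h z \<in> stereo_inv -` U" using sh p by simp
    then show ?thesis using z by blast
  qed
  obtain g where g: "simple_path g" "pathfinish g = pathstart g" "path_image g \<subseteq> h ` cball 0 1"
    "path_image g \<inter> stereo_inv -` U1 \<noteq> {}" "path_image g \<inter> stereo_inv -` U2 \<noteq> {}" "path_image g \<inter> stereo_inv -` U3 \<noteq> {}"
  proof (rule simple_loop_through_three_sets[OF hc hi open_preimage[OF U(1)] open_preimage[OF U(2)] open_preimage[OF U(3)]])
    show "stereo_inv -` U1 \<inter> stereo_inv -` U2 = {}" "stereo_inv -` U1 \<inter> stereo_inv -` U3 = {}" "stereo_inv -` U2 \<inter> stereo_inv -` U3 = {}"
      using disj by blast+
  qed (use hm meets in blast)+
  have gfree: "F ` path_image g \<inter> path_image g = {}"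
  proof (rule equals0I)
    fix z assume "z \<in> F ` path_image g \<inter> path_image g"
    then obtain w where w: "w \<in> path_image g" "z = F w" "z \<in> path_image g" by blast
    have s: "stereo_inv v \<in> B" if v: "v \<in> path_image g" for v
    proof -
      obtain y where y: "y \<in> cball 0 1" "v = h y" using subsetD[OF g(3) v] by blast
      then show ?thesis using sh[OF y(1)] \<beta>B[OF y(1)] by simp
    qed
    have "stereo_inv z = f (stereo_inv w)" using w stereo_inv_F by simp
    then show False using s w free by (metis IntI emptyE imageI)
  qed
  consider "north \<in> U2" | "north \<in> U3" | "north \<notin> U2" "north \<notin> U3" by blast
  then show False
  proof cases
    case 1
    then have "north \<notin> U1" "north \<notin> U3" using disj by blast+
    then show False
      using no_free_loop_through_three_disks[OF ori U(2,1,3) homU(2,1,3) inv(2,1,3) _ disj(3,2) _ _ g(1,2) gfree g(5,4,6)] disj by blast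
  next
    case 2
    then have "north \<notin> U1" "north \<notin> U2" using disj by blast+
    then show False
      using no_free_loop_through_three_disks[OF ori U(3,1,2) homU(3,1,2) inv(3,1,2) _ _ disj(1) _ _ g(1,2) gfree g(6,4,5)] disj by blast
  next
    case 3
    then show False
      using no_free_loop_through_three_disks[OF ori U homU inv disj _ _ g(1,2) gfree g(4,5,6)] by blast
  qed
qed

end

section \<open>Disks in the standard sphere\<close>

lemma homeomorphic_space_imp_homeomorphic:
  assumes "top_of_set A homeomorphic_space top_of_set T"
  shows "A homeomorphic T"
proof -
  obtain h k where hk: "homeomorphic_maps (top_of_set A) (top_of_set T) h k"
    using assms unfolding homeomorphic_space_def by blast
  have "homeomorphism A T h k"
    using hk unfolding homeomorphic_maps_def
    by (intro homeomorphismI) (auto simp: image_subset_iff_funcset)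
  then show ?thesis by (auto simp: homeomorphic_def)
qed

lemma homeomorphic_chart_image:
  assumes \<tau>: "homeomorphic_maps X (top_of_set S) \<tau> \<tau>'" and A: "A \<subseteq> topspace X"
    and hom: "subtopology X A homeomorphic_space top_of_set T"
  shows "\<tau> ` A homeomorphic T"
proof -
  have sub: "\<tau> ` A \<subseteq> S"
    using \<tau> A unfolding homeomorphic_maps_def continuous_map_def by fastforce
  have "homeomorphic_maps (subtopology X A) (subtopology (top_of_set S) (\<tau> ` A)) \<tau> \<tau>'"
    by (rule homeomorphic_maps_subtopologies[OF \<tau>]) (use A sub in \<open>auto simp: Int_absorb1\<close>)
  moreover have "subtopology (top_of_set S) (\<tau> ` A) = top_of_set (\<tau> ` A)"
    using sub by (simp add: subtopology_subtopology Int_absorb1)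
  ultimately have "subtopology X A homeomorphic_space top_of_set (\<tau> ` A)"
    unfolding homeomorphic_space_def by metis
  then have "top_of_set (\<tau> ` A) homeomorphic_space top_of_set T"
    using hom homeomorphic_space_sym homeomorphic_space_trans by blast
  then show ?thesis by (rule homeomorphic_space_imp_homeomorphic)
qed

lemma plane_models:
  "(UNIV :: (real^2) set) homeomorphic (UNIV :: complex set)"
  "cball (0 :: real^2) 1 homeomorphic cball (0 :: complex) 1"
proof -
  obtain h :: "real^2 \<Rightarrow> complex" and k where hk: "linear h" "linear k" "\<And>x. norm (h x) = norm x" "\<And>y. norm (k y) = norm y"
    "\<And>x. k (h x) = x" "\<And>y. h (k y) = y"
    using isomorphisms_UNIV_UNIV[where 'M = "real^2" and 'N = complex] by auto
  have c: "continuous_on A h" "continuous_on B k" for A B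
    using hk(1,2) by (simp_all add: linear_continuous_on linear_conv_bounded_linear)
  have "homeomorphism (UNIV :: (real^2) set) UNIV h k"
    by (rule homeomorphismI) (use c hk in auto)
  then show "(UNIV :: (real^2) set) homeomorphic (UNIV :: complex set)" by (auto simp: homeomorphic_def)
  have "homeomorphism (cball (0 :: real^2) 1) (cball 0 1) h k"
    by (rule homeomorphismI) (use c hk in auto)
  then show "cball (0 :: real^2) 1 homeomorphic cball (0 :: complex) 1" by (auto simp: homeomorphic_def)
qed

text \<open>The reflection in the plane that bisects the segment from the north pole to \<open>p\<close>.\<close>

lemma exists_reflection:
  assumes p: "p \<in> S2"
  obtains Q where "S2_map Q" "\<And>q. Q (Q q) = q" "Q north = p"
proof (cases "p = north")
  case True
  show thesis by (rule that[of "\<lambda>q. q"]) (use True in \<open>auto simp: S2_map_def\<close>)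
next
  case False
  define v where "v = north - p"
  define Q where "Q q = q - (2 * (q \<bullet> v) / (v \<bullet> v)) *\<^sub>R v" for q
  have v: "v \<bullet> v \<noteq> 0" using False by (simp add: v_def)
  have Qv: "Q q \<bullet> v = - (q \<bullet> v)" for q
    using v by (simp add: Q_def inner_diff_left)
  have QQ: "Q (Q q) = q" for q
  proof -
    have "Q (Q q) = Q q - (2 * (Q q \<bullet> v) / (v \<bullet> v)) *\<^sub>R v" by (simp add: Q_def)
    also have "\<dots> = q" unfolding Qv by (simp add: Q_def)
    finally show ?thesis .
  qed
  have nQ: "Q q \<bullet> Q q = q \<bullet> q" for q
  proof -
    define r where "r = 2 * (q \<bullet> v) / (v \<bullet> v)"
    have r: "r * (v \<bullet> v) = 2 * (q \<bullet> v)" using v by (simp add: r_def)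
    have "Q q \<bullet> Q q = q \<bullet> q - 2 * r * (q \<bullet> v) + r * (r * (v \<bullet> v))"
      by (simp add: Q_def r_def[symmetric] inner_diff_left inner_diff_right inner_commute[of v q] right_diff_distrib)
    then show ?thesis unfolding r by simp
  qed
  have "norm (Q q) = norm q" for q by (simp add: norm_eq_sqrt_inner nQ)
  moreover have "continuous_on S2 Q"
    unfolding Q_def using v by (intro continuous_intros) auto
  ultimately have "S2_map Q"
    by (simp add: S2_map_def S2_def image_subset_iff)
  moreover have "Q north = p"
  proof -
    have n: "north \<bullet> north = 1" "p \<bullet> p = 1" using p north_in by (simp_all add: S2_def norm_eq_sqrt_inner)
    have "v \<bullet> v = 2 * (north \<bullet> v)"
      using n by (simp add: v_def inner_diff_left inner_diff_right inner_commute[of p north])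
    then show ?thesis using v by (simp add: Q_def) (simp add: v_def)
  qed
  ultimately show thesis using that QQ by blast
qed

text \<open>A reflection moves the fixed point to the north pole, and the degree is invariant under conjugation.\<close>

theorem theorem1:
  fixes f :: "(nat \<Rightarrow> real) \<Rightarrow> (nat \<Rightarrow> real)"
    and B U\<^sub>1 U\<^sub>2 U\<^sub>3 :: "(nat \<Rightarrow> real) set"
  assumes "orientation_preserving_homeomorphism 2 f"
    and "\<forall>x \<in> topspace (nsphere 2). \<not> wandering_point (nsphere 2) f x"
    and "closed_topological_disk (nsphere 2) B"
    and "open_topological_disk (nsphere 2) U\<^sub>1"
    and "open_topological_disk (nsphere 2) U\<^sub>2"
    and "open_topological_disk (nsphere 2) U\<^sub>3"
    and "U\<^sub>1 \<inter> U\<^sub>2 = {}" and "U\<^sub>1 \<inter> U\<^sub>3 = {}" and "U\<^sub>2 \<inter> U\<^sub>3 = {}"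
    and "f ` U\<^sub>1 = U\<^sub>1" and "f ` U\<^sub>2 = U\<^sub>2" and "f ` U\<^sub>3 = U\<^sub>3"
    and "B \<inter> U\<^sub>1 \<noteq> {}" and "B \<inter> U\<^sub>2 \<noteq> {}" and "B \<inter> U\<^sub>3 \<noteq> {}"
  shows "f ` B \<inter> B \<noteq> {}"
proof -
  let ?X = "nsphere 2"
  have hf: "homeomorphic_map ?X ?X f" and deg: "Brouwer_degree2 2 f = 1"
    using assms(1) by (auto simp: orientation_preserving_homeomorphism_def)
  obtain f0 where f0: "homeomorphic_maps ?X ?X f f0" using hf homeomorphic_map_maps by blast
  have fX: "f x \<in> topspace ?X" "f0 x \<in> topspace ?X" "f0 (f x) = x" "f (f0 x) = x" if "x \<in> topspace ?X" for x
    using f0 that unfolding homeomorphic_maps_def continuous_map_def by auto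
  have cf: "continuous_map ?X ?X f" "continuous_map ?X ?X f0" using f0 by (auto simp: homeomorphic_maps_def)
  \<comment> \<open>In euclidean coordinates, before the fixed point is moved.\<close>
  define \<phi> where "\<phi> = to_S2 \<circ> f \<circ> of_S2"
  have \<phi>: "S2_map \<phi>"
  proof -
    have "continuous_map (top_of_set S2) (top_of_set S2) \<phi>"
      unfolding \<phi>_def by (intro continuous_map_compose[OF continuous_of_S2] continuous_map_compose[OF cf(1)] continuous_to_S2)
    then show ?thesis by (auto simp: S2_map_def)
  qed
  have deg\<phi>: "sphere_degree \<phi> = 1"
  proof -
    have "sphere_degree \<phi> = Brouwer_degree2 2 f"
      unfolding sphere_degree_def by (rule Brouwer_degree2_eq) (simp add: \<phi>_def of_to_S2 fX)
    then show ?thesis using deg by simp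
  qed
  obtain p where p: "p \<in> S2" "\<phi> p = p" using degree_one_fixed_point[OF \<phi> deg\<phi>] by blast
  obtain Q where Q: "S2_map Q" "\<And>q. Q (Q q) = q" "Q north = p" using exists_reflection[OF p(1)] by metis
  have QS: "Q q \<in> S2" if "q \<in> S2" for q using Q(1) that unfolding S2_map_def by blast
  have cQ: "continuous_map (top_of_set S2) (top_of_set S2) Q"
    using Q(1) unfolding S2_map_def by (auto simp: image_subset_iff_funcset)
  define \<tau> where "\<tau> = Q \<circ> to_S2"
  define \<tau>' where "\<tau>' = of_S2 \<circ> Q"
  have \<tau>X: "\<tau> x \<in> S2" "\<tau>' (\<tau> x) = x" if "x \<in> topspace ?X" for x
    using that by (simp_all add: \<tau>_def \<tau>'_def QS to_S2_in Q(2) of_to_S2)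
  have \<tau>S: "\<tau>' q \<in> topspace ?X" "\<tau> (\<tau>' q) = q" if "q \<in> S2" for q
    using that by (simp_all add: \<tau>_def \<tau>'_def QS of_S2_in Q(2) to_of_S2)
  have c\<tau>: "continuous_map ?X (top_of_set S2) \<tau>" "continuous_map (top_of_set S2) ?X \<tau>'"
    unfolding \<tau>_def \<tau>'_def
    by (rule continuous_map_compose[OF continuous_to_S2 cQ], rule continuous_map_compose[OF cQ continuous_of_S2])
  have h\<tau>: "homeomorphic_maps ?X (top_of_set S2) \<tau> \<tau>'"
    unfolding homeomorphic_maps_def using c\<tau> \<tau>X \<tau>S by simp
  have hm\<tau>: "homeomorphic_map ?X (top_of_set S2) \<tau>" "homeomorphic_map (top_of_set S2) ?X \<tau>'"
    using h\<tau> homeomorphic_maps_map by blast+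
  define k where "k = \<tau> \<circ> f \<circ> \<tau>'"
  define k' where "k' = \<tau> \<circ> f0 \<circ> \<tau>'"
  have k\<tau>: "k (\<tau> x) = \<tau> (f x)" if "x \<in> topspace ?X" for x using that by (simp add: k_def \<tau>X)
  have fn: "(f ^^ n) x \<in> topspace ?X" "(k ^^ n) (\<tau> x) = \<tau> ((f ^^ n) x)" if "x \<in> topspace ?X" for n x
  proof -
    show 1: "(f ^^ n) x \<in> topspace ?X" for n by (induction n) (simp_all add: that fX)
    show "(k ^^ n) (\<tau> x) = \<tau> ((f ^^ n) x)" by (induction n) (simp_all add: k\<tau> 1)
  qed
  interpret sphere: sphere_system k k'
  proof
    have "continuous_map (top_of_set S2) (top_of_set S2) k" "continuous_map (top_of_set S2) (top_of_set S2) k'"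
      unfolding k_def k'_def
      by (intro continuous_map_compose[OF c\<tau>(2)] continuous_map_compose[OF cf(1)] continuous_map_compose[OF cf(2)] c\<tau>(1))+
    then show "homeomorphism S2 S2 k k'"
      by (intro homeomorphismI) (auto simp: image_subset_iff_funcset k_def k'_def \<tau>X \<tau>S fX)
    show "k north = north"
    proof -
      have "k north = Q (\<phi> (Q north))" by (simp add: k_def \<tau>_def \<tau>'_def \<phi>_def)
      then show ?thesis using Q(2)[of north] Q(3) p(2) by simp
    qed
    fix V assume V: "openin (top_of_set S2) V" "V \<noteq> {}"
    have VS: "V \<subseteq> S2" using openin_imp_subset[OF V(1)] .
    have oV: "openin ?X (\<tau>' ` V)" using homeomorphic_map_openness[OF hm\<tau>(2)] V(1) VS by simp
    obtain q where q: "q \<in> V" using V(2) by blast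
    then have "\<not> wandering_point ?X f (\<tau>' q)" using assms(2) \<tau>S VS by blast
    then obtain n where n: "n \<ge> 1" "(f ^^ n) ` (\<tau>' ` V) \<inter> \<tau>' ` V \<noteq> {}"
      using oV q unfolding wandering_point_def by blast
    then obtain a b where ab: "a \<in> V" "b \<in> V" "(f ^^ n) (\<tau>' a) = \<tau>' b" by blast
    have "(k ^^ n) a = b"
      using fn(2)[of "\<tau>' a" n] ab \<tau>S VS by (metis subsetD)
    then show "\<exists>n\<ge>1. (k ^^ n) ` V \<inter> V \<noteq> {}" using n ab by blast
  qed
  have degk: "sphere_degree k = 1"
  proof -
    have "k = Q \<circ> \<phi> \<circ> Q" by (simp add: k_def \<tau>_def \<tau>'_def \<phi>_def comp_assoc)
    then show ?thesis using sphere_degree_conjugate[OF \<phi> Q(1,1)] Q(2) deg\<phi> by simp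
  qed
  have sub: "A \<subseteq> topspace ?X" if "openin ?X A" for A using that openin_subset by blast
  have disk: "openin (top_of_set S2) (\<tau> ` U) \<and> \<tau> ` U homeomorphic (UNIV :: complex set)"
    if "open_topological_disk ?X U" for U
  proof
    have U: "openin ?X U" "subtopology ?X U homeomorphic_space top_of_set (UNIV :: (real^2) set)"
      using that by (auto simp: open_topological_disk_def)
    show "openin (top_of_set S2) (\<tau> ` U)" using homeomorphic_map_openness[OF hm\<tau>(1) sub[OF U(1)]] U(1) by simp
    show "\<tau> ` U homeomorphic (UNIV :: complex set)"
      using homeomorphic_chart_image[OF h\<tau> sub[OF U(1)] U(2)] plane_models(1) homeomorphic_trans by blast
  qed
  have UX: "U\<^sub>1 \<subseteq> topspace ?X" "U\<^sub>2 \<subseteq> topspace ?X" "U\<^sub>3 \<subseteq> topspace ?X"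
    using assms(4-6) sub by (auto simp: open_topological_disk_def)
  have BX: "B \<subseteq> topspace ?X" "subtopology ?X B homeomorphic_space top_of_set (cball (0 :: real^2) 1)"
    using assms(3) by (auto simp: closed_topological_disk_def)
  have \<tau>_inj: "inj_on \<tau> (topspace ?X)" using \<tau>X by (metis inj_on_inverseI)
  have \<tau>_disj: "\<tau> ` A \<inter> \<tau> ` C = {}" if "A \<inter> C = {}" "A \<subseteq> topspace ?X" "C \<subseteq> topspace ?X" for A C
    using \<tau>_inj that by (metis image_is_empty inj_on_image_Int)
  have k_im: "k ` \<tau> ` A = \<tau> ` f ` A" if "A \<subseteq> topspace ?X" for A
    using k\<tau> that by (force simp: image_image)
  have "k ` (\<tau> ` B) \<inter> \<tau> ` B \<noteq> {}"
  proof (rule sphere.disk_meets_image[OF degk, of "\<tau> ` B" "\<tau> ` U\<^sub>1" "\<tau> ` U\<^sub>2" "\<tau> ` U\<^sub>3"])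
    show "\<tau> ` B \<subseteq> S2" using BX \<tau>X by blast
    show "\<tau> ` B homeomorphic cball (0 :: complex) 1"
      using homeomorphic_chart_image[OF h\<tau> BX] plane_models(2) homeomorphic_trans by blast
    show "\<tau> ` B \<inter> \<tau> ` U\<^sub>1 \<noteq> {}" "\<tau> ` B \<inter> \<tau> ` U\<^sub>2 \<noteq> {}" "\<tau> ` B \<inter> \<tau> ` U\<^sub>3 \<noteq> {}"
      using assms(13-15) by blast+
    show "k ` \<tau> ` U\<^sub>1 = \<tau> ` U\<^sub>1" "k ` \<tau> ` U\<^sub>2 = \<tau> ` U\<^sub>2" "k ` \<tau> ` U\<^sub>3 = \<tau> ` U\<^sub>3"
      using k_im[OF UX(1)] k_im[OF UX(2)] k_im[OF UX(3)] assms(10-12) by simp_all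
  qed (use disk[OF assms(4)] disk[OF assms(5)] disk[OF assms(6)] \<tau>_disj[OF assms(7) UX(1,2)]
      \<tau>_disj[OF assms(8) UX(1,3)] \<tau>_disj[OF assms(9) UX(2,3)] in simp_all)
  then have "\<tau> ` f ` B \<inter> \<tau> ` B \<noteq> {}" using k_im[OF BX(1)] by simp
  moreover have "f ` B \<subseteq> topspace ?X" using BX(1) fX(1) by blast
  ultimately show ?thesis using \<tau>_disj[OF _ _ BX(1)] by blast
qed

end
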